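(* Let $G$ be a positive definite even integral symmetric $n\times n$ matrix ($n\geq 1$), let $D=\det(G)$, and let $N$ be the level of $G$. Let $c$ be a positive integer and $a$ a nonzero integer with $\gcd(a,c)=1$. Let $\mathbf{w},\mathbf{x}\in\mathbb{Q}^n$ satisfy $G\mathbf{w}\in\mathbb{Z}^n$ and $a\mathbf{x}\in\mathbb{Z}^n$, and put $$\mathfrak{G}_{G}(a/c;\mathbf{w},\mathbf{x})=\sum_{v_1=0}^{c-1}\cdots\sum_{v_n=0}^{c-1}e\!\left(\frac{a}{c}\Big(\tfrac12(\mathbf{v}+\mathbf{w})^{T}G(\mathbf{v}+\mathbf{w})+(\mathbf{v}+\mathbf{w})^{T}\mathbf{x}\Big)\right),\quad \mathbf{v}=(v_1,\dots,v_n).$$ Then: (1) If $\gcd(N,c)=1$, then $$\mathfrak{G}_{G}(a/c;\mathbf{w},\mathbf{x})=c^{n/2}\left(\frac{|a|}{c}\right)_K^n\left(\frac{D}{c}\right)_K e\!\left(\frac{n\,\mathrm{sgn}(a)(1-c_0)}{8}\right)e\!\left(-\frac{a}{2c}\mathbf{x}^{T}G^{-1}\mathbf{x}+\frac{ac'}{2}(\mathbf{w}+G^{-1}\mathbf{x})^{T}G(\mathbf{w}+G^{-1}\mathbf{x})\right),$$ where $c_0$ is the odd part of $c$ and $c'$ is any integer with $cc'\equiv 1\pmod{aN}$. (2) If $N\mid c$, then $$\mathfrak{G}_{G}(a/c;\mathbf{w},\mathbf{x})=\delta\cdot c^{n/2}D^{1/2}\,i^{n/2}\,\mu_G(a,c)\,e\!\left(-\frac{a'a^2\mathbf{x}^{T}G^{-1}\mathbf{x}}{2c}\right),$$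 where $a'$ is any integer with $aa'\equiv1\pmod{cN}$, $\delta=1$ if $a(\mathbf{w}+G^{-1}\mathbf{x})\in\mathbb{Z}^n$ and $\delta=0$ otherwise, and $$\mu_G(a,c)=\begin{cases}\left(\frac{-\mathrm{sgn}(a)\, c}{|a|}\right)_K^n\left(\frac{D}{a}\right)_K e\!\left(\frac{n\,\mathrm{sgn}(a)(1-a)}{8}\right)&\text{if } 2\nmid a,\\[1mm] \left(\frac{a}{D}\right)_K&\text{if }2\mid a.\end{cases}$$
   Context: $e(z)=\exp(2\pi i z)$. A symmetric matrix is even integral if all entries are integers and the diagonal entries are even. The level of a nonsingular even integral symmetric matrix $G$ is the least positive integer $N$ such that $NG^{-1}$ is even integral. $(\frac{m}{n})_K$ denotes the Kronecker–Jacobi symbol (Legendre symbol for odd prime $n$; $(\frac{m}{2})_K=0$ if $m$ even, $(-1)^{(m^2-1)/8}$ if $m$ odd; $(\frac{m}{-1})_K=1$ if $m\ge0$, $-1$ otherwise; $(\frac{m}{1})_K=1$; completely multiplicative in $n$; $(\frac{m}{0})_K=0$ unless $m=\pm1$, where it is $1$). The odd part of $c$ is $c_0$ with $c=2^ec_0$, $c_0$ odd. $\mathrm{sgn}$ is the sign function. Fractional powers are principal branches, so $i^{n/2}=e(n/8)$ and $D^{1/2}>0$. *)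

theory Defs
  imports "HOL-Analysis.Analysis" "HOL-Number_Theory.Number_Theory"
begin

definition ee :: "complex \<Rightarrow> complex" where
  "ee z = exp (2 * of_real pi * \<i> * z)"

definition integral_vec :: "real^'n \<Rightarrow> bool" where
  "integral_vec v \<longleftrightarrow> (\<forall>i. v $ i \<in> \<int>)"

definition rational_vec :: "real^'n \<Rightarrow> bool" where
  "rational_vec v \<longleftrightarrow> (\<forall>i. v $ i \<in> \<rat>)"

definition even_integral :: "real^'n^'n \<Rightarrow> bool" where
  "even_integral A \<longleftrightarrow>
     transpose A = A \<and> (\<forall>i j. A $ i $ j \<in> \<int>) \<and> (\<forall>i. \<exists>k::int. A $ i $ i = of_int (2 * k))"

definition positive_definite :: "real^'n^'n \<Rightarrow> bool" where
  "positive_definite A \<longleftrightarrow> transpose A = A \<and> (\<forall>v. v \<noteq> 0 \<longrightarrow> v \<bullet> (A *v v) > 0)"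

text \<open>Only meaningful for a nonsingular even integral matrix.\<close>

definition level :: "real^'n^'n \<Rightarrow> nat" where
  "level G = (LEAST N::nat. N > 0 \<and> even_integral (real N *\<^sub>R matrix_inv G))"

definition odd_part :: "int \<Rightarrow> int" where
  "odd_part c = c div 2 ^ multiplicity 2 c"

definition kronecker_prime :: "int \<Rightarrow> int \<Rightarrow> int" where
  "kronecker_prime m p =
     (if p = 2 then (if even m then 0 else (-1) ^ nat ((m\<^sup>2 - 1) div 8)) else Legendre m p)"

text \<open>
  For \<open>n \<noteq> 0\<close> this is the completely multiplicative extension from the primes and \<open>-1\<close>:
  \<^term>\<open>prime_factorization n\<close> is the multiset of positive primes dividing \<open>n\<close>, and the first factor
  is the symbol at the unit \<open>sgn n\<close>.
\<close>

definition kronecker :: "int \<Rightarrow> int \<Rightarrow> int" where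
  "kronecker m n =
     (if n = 0 then (if \<bar>m\<bar> = 1 then 1 else 0)
      else (if n < 0 \<and> m < 0 then - 1 else 1) * (\<Prod>p\<in>#prime_factorization n. kronecker_prime m p))"

text \<open>\<open>gauss_sum G a c w x\<close> is the sum at the fraction \<open>a/c\<close>, meant for \<open>c > 0\<close> and \<open>a\<close>, \<open>c\<close> coprime,
  so that \<open>a\<close> and \<open>c\<close> are determined by the fraction.\<close>

definition gauss_sum :: "real^'n^'n \<Rightarrow> int \<Rightarrow> int \<Rightarrow> real^'n \<Rightarrow> real^'n \<Rightarrow> complex" where
  "gauss_sum G a c w x =
     (\<Sum>v \<in> {v::int^'n. \<forall>i. 0 \<le> v $ i \<and> v $ i < c}.
        let u = (\<chi> i. of_int (v $ i)) + w in
        ee (of_real (of_int a / of_int c * (1/2 * (u \<bullet> (G *v u)) + u \<bullet> x))))"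

text \<open>Here \<open>n\<close> is the size and \<open>D\<close> the determinant of the matrix \<open>G\<close>.\<close>

definition gauss_mu :: "nat \<Rightarrow> int \<Rightarrow> int \<Rightarrow> int \<Rightarrow> complex" where
  "gauss_mu n D a c =
     (if odd a
      then of_int (kronecker (- sgn a * c) \<bar>a\<bar>) ^ n * of_int (kronecker D a)
             * ee (of_int (int n * sgn a * (1 - a)) / 8)
      else of_int (kronecker a D))"

end

theory Submission
  imports Defs
begin

text \<open>
  The sum \<open>T(a,c) = \<Sum> e(a/c q(v))\<close> over \<open>v\<close> modulo \<open>c\<close>, with \<open>q(v) = 1/2 v\<^sup>T G v\<close>, is multiplicative:
  \<open>T(a,c\<^sub>1c\<^sub>2) = T(ac\<^sub>2,c\<^sub>1) T(ac\<^sub>1,c\<^sub>2)\<close> for coprime \<open>c\<^sub>1, c\<^sub>2\<close>.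
  For an odd prime \<open>p\<close>, substitutions of determinant prime to \<open>p\<close> diagonalize \<open>G\<close>, so for odd \<open>c\<close> the
  dependence of \<open>T(a,c)\<close> on \<open>a\<close>, and its value when \<open>c\<close> is prime to \<open>det G\<close>, reduce to one-dimensional
  sums. Diagonalization over \<open>\<rat>\<close> also gives Milgram's formula
  \<open>T(1,M) = M\<^bsup>n/2\<^esup> D\<^bsup>1/2\<^esup> e(n/8)\<close> when the level divides \<open>M\<close>. Combined with multiplicativity
  at \<open>M = |a|c\<close> this is a reciprocity law which yields (2) for odd \<open>a\<close>; at \<open>M = 2\<^sup>e m\<close> with \<open>m\<close> odd it
  evaluates \<open>T\<close> at powers of 2, the remaining part of (1). General \<open>w, x\<close> are reduced to
  \<open>w = x = 0\<close> by completing the square with an integral shift.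
\<close>

section \<open>The quadratic Gauss sum\<close>

text \<open>The prime 2 is the obstacle: an even form need not be diagonalizable by substitutions of
  odd determinant, so nothing is computed locally there. Milgram's formula is insensitive to this,
  because it survives every substitution of nonzero determinant: a change of lattice multiplies both
  of its sides by the same integer. It can therefore be checked on diagonal forms, and comparing two
  moduli that differ by a power of 2 isolates the missing local sum. The eighth root of unity has a
  single source, the one-dimensional sum of \<open>e(x\<^sup>2 / 4m)\<close>. Its modulus is
  elementary; its phase comes from a finite product whose factors have known arguments. No
  reciprocity law for Legendre symbols is presupposed. Multiplicativity of the Kronecker symbol in
  its upper argument, and its value at 2, are read off by evaluating nonzero Gauss sums in two
  ways.\<close>

definition eR :: "real \<Rightarrow> complex" where
  "eR x = cis (2 * pi * x)"

lemma ee_of_real: "ee (of_real x) = eR x"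
  by (simp add: ee_def eR_def cis_conv_exp mult_ac)

lemma eR_add: "eR (x + y) = eR x * eR y"
  by (simp add: eR_def cis_mult distrib_left)

lemma eR_0 [simp]: "eR 0 = 1"
  by (simp add: eR_def)

lemma eR_of_int [simp]: "eR (of_int k) = 1"
  by (simp add: eR_def cis_multiple_2pi)

lemma eR_Ints: "x \<in> \<int> \<Longrightarrow> eR x = 1"
  by (auto elim: Ints_cases)

lemma eR_eqI: "x - y \<in> \<int> \<Longrightarrow> eR x = eR y"
  using eR_add[of "x - y" y] by (simp add: eR_Ints)

lemma eR_cnj: "cnj (eR x) = eR (- x)"
  by (simp add: eR_def cis_cnj)

lemma eR_neq_0 [simp]: "eR x \<noteq> 0"
  by (simp add: eR_def)

lemma eR_minus: "eR (- x) = inverse (eR x)"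
  using eR_add[of "- x" x] by (simp add: field_simps)

lemma eR_power: "eR x ^ n = eR (of_nat n * x)"
  by (induction n) (simp_all add: eR_add distrib_right)

lemma eR_sum: "eR (\<Sum>i\<in>I. f i) = (\<Prod>i\<in>I. eR (f i))"
  by (induction I rule: infinite_finite_induct) (simp_all add: eR_add)

lemma eR_eq_1_iff: "eR x = 1 \<longleftrightarrow> x \<in> \<int>"
proof
  assume "eR x = 1"
  then have "cos (2 * pi * x) = 1" by (simp add: eR_def complex_eq_iff)
  then obtain k :: int where "2 * pi * x = of_int k * 2 * pi" by (auto simp: cos_one_2pi_int)
  then have "x = of_int k" by simp
  then show "x \<in> \<int>" by simp
qed (rule eR_Ints)

lemma eR_half [simp]: "eR (1/2) = -1"
  by (simp add: eR_def complex_eq_iff)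

lemma eR_quarter [simp]: "eR (1/4) = \<i>"
  by (simp add: eR_def)

lemma eR_cong:
  assumes "[k = l] (mod c)" "c \<noteq> 0"
  shows "eR (of_int k / of_int c) = eR (of_int l / of_int c)"
proof (rule eR_eqI)
  from assms obtain m where m: "l = k + c * m" by (auto simp: cong_iff_lin)
  have "of_int k / of_int c - of_int l / of_int c = (of_int (- m) :: real)"
    using assms by (simp add: m field_simps)
  then show "of_int k / of_int c - of_int l / of_int c \<in> (\<int> :: real set)" by simp
qed

text \<open>An injective map of a finite set into itself is a bijection, so \<open>\<phi>\<close>
  may be any integer map that separates residues.\<close>

lemma sum_residues_reindex:
  fixes f :: "int \<Rightarrow> complex"
  assumes c: "c > 0"
    and per: "\<And>x y. [x = y] (mod c) \<Longrightarrow> f x = f y"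
    and inj: "\<And>x y. [\<phi> x = \<phi> y] (mod c) \<Longrightarrow> [x = y] (mod c)"
  shows "(\<Sum>x\<in>{0..<c}. f (\<phi> x)) = (\<Sum>x\<in>{0..<c}. f x)"
proof -
  have "inj_on (\<lambda>x. \<phi> x mod c) {0..<c}"
  proof (rule inj_onI)
    fix x y assume "x \<in> {0..<c}" "y \<in> {0..<c}" "\<phi> x mod c = \<phi> y mod c"
    then show "x = y" using inj[of x y] by (simp add: cong_def)
  qed
  moreover have "(\<lambda>x. \<phi> x mod c) ` {0..<c} \<subseteq> {0..<c}"
    using c by auto
  ultimately have "bij_betw (\<lambda>x. \<phi> x mod c) {0..<c} {0..<c}"
    by (simp add: bij_betw_def endo_inj_surj)
  then have "(\<Sum>x\<in>{0..<c}. f (\<phi> x mod c)) = (\<Sum>x\<in>{0..<c}. f x)"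
    by (rule sum.reindex_bij_betw)
  moreover have "f (\<phi> x mod c) = f (\<phi> x)" for x
    by (intro per) (simp add: cong_def)
  ultimately show ?thesis by simp
qed

text \<open>A shift of the variable by 1 multiplies the sum by \<open>e(k/c)\<close>, which differs
  from 1 unless \<open>c\<close> divides \<open>k\<close>.\<close>

lemma sum_additive_character:
  fixes k c :: int
  assumes c: "c > 0"
  shows "(\<Sum>x\<in>{0..<c}. eR (of_int (k * x) / of_int c)) = (if c dvd k then of_int c else 0)"
proof (cases "c dvd k")
  case True
  then obtain m where m: "k = c * m" by auto
  have "eR (of_int (k * x) / of_int c) = 1" for x
    using c eR_of_int[of "m * x"] by (simp add: m)
  then show ?thesis using True c by simp
next
  case False
  let ?S = "\<Sum>x\<in>{0..<c}. eR (of_int (k * x) / of_int c)"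
  have "?S = (\<Sum>x\<in>{0..<c}. eR (of_int (k * (x + 1)) / of_int c))"
    by (rule sum_residues_reindex[symmetric, where f = "\<lambda>x. eR (of_int (k * x) / of_int c)" and \<phi> = "\<lambda>x. x + 1"])
      (use c in \<open>auto intro!: eR_cong cong_mult simp: cong_add_rcancel simp del: of_int_mult\<close>)
  also have "\<dots> = ?S * eR (of_int k / of_int c)"
    unfolding sum_distrib_right
    by (intro sum.cong refl) (simp add: eR_add[symmetric] add_divide_distrib ring_distribs)
  finally have "?S * (1 - eR (of_int k / of_int c)) = 0" by (simp add: algebra_simps)
  moreover have "eR (of_int k / of_int c) \<noteq> 1"
  proof
    assume "eR (of_int k / of_int c) = 1"
    then obtain m where "of_int k / of_int c = (of_int m :: real)"
      by (auto simp: eR_eq_1_iff elim: Ints_cases)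
    then have "(of_int k :: real) = of_int (m * c)" using c by (simp add: field_simps)
    then have "k = m * c" by (simp only: of_int_eq_iff)
    with False show False by simp
  qed
  ultimately show ?thesis using False by simp
qed

section \<open>Gaussian binomials and the phase of the quadratic Gauss sum\<close>

definition qfact :: "complex \<Rightarrow> nat \<Rightarrow> complex" where
  "qfact q n = (\<Prod>i=1..n. 1 - q ^ i)"

text \<open>The Gaussian binomial coefficient. The factors \<open>qfact\<close> omit the customary
  division by powers of \<open>1 - q\<close>, which would cancel in the quotient.\<close>

definition qbinom :: "complex \<Rightarrow> nat \<Rightarrow> nat \<Rightarrow> complex" where
  "qbinom q n k = qfact q n / (qfact q k * qfact q (n - k))"

lemma qfact_0 [simp]: "qfact q 0 = 1" and qfact_Suc: "qfact q (Suc n) = qfact q n * (1 - q ^ Suc n)"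
  by (simp_all add: qfact_def)

lemma qbinom_symmetric: "k \<le> n \<Longrightarrow> qbinom q n (n - k) = qbinom q n k"
  by (simp add: qbinom_def mult.commute)

lemma qfact_nonzero:
  assumes "\<And>i. 0 < i \<Longrightarrow> i \<le> n \<Longrightarrow> q ^ i \<noteq> 1" "k \<le> n"
  shows "qfact q k \<noteq> 0"
  using assms by (auto simp: qfact_def)

lemma qbinom_Pascal:
  assumes nz: "\<And>i. 0 < i \<Longrightarrow> i \<le> Suc n \<Longrightarrow> q ^ i \<noteq> 1" and k: "k < n"
  shows "qbinom q (Suc n) (Suc k) = qbinom q n (Suc k) + q ^ (n - k) * qbinom q n k"
proof -
  obtain d where n: "n = Suc (k + d)" using k less_natE by blast
  have nz': "qfact q j \<noteq> 0" if "j \<le> Suc n" for j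
    using qfact_nonzero[of "Suc n" q j] nz that by blast
  have "qfact q k \<noteq> 0" "qfact q d \<noteq> 0" "1 - q ^ Suc k \<noteq> 0" "1 - q ^ Suc d \<noteq> 0"
    using nz'[of k] nz'[of d] nz[of "Suc k"] nz[of "Suc d"] by (auto simp: n)
  \<comment> \<open>This is the Pascal rule after cancelling the common factorials.\<close>
  moreover have "1 - q ^ Suc (Suc (k + d)) = (1 - q ^ Suc d) + q ^ Suc d * (1 - q ^ Suc k)"
    by (simp add: power_add algebra_simps)
  ultimately show ?thesis
    unfolding qbinom_def n
    by (simp add: qfact_Suc divide_simps del: power_Suc) (simp add: Suc_diff_le power_add algebra_simps)
qed

text \<open>Gauss's identity; at roots of unity its left-hand side becomes a quadratic Gauss sum.\<close>

lemma gauss_qbinom_identity: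
  assumes "\<And>i. 0 < i \<Longrightarrow> i \<le> n \<Longrightarrow> (r\<^sup>2) ^ i \<noteq> 1"
  shows "(\<Sum>j\<le>n. r ^ j * qbinom (r\<^sup>2) n j) = (\<Prod>i=1..n. 1 + r ^ i)"
  using assms
proof (induction n)
  case 0
  show ?case by (simp add: qbinom_def)
next
  case (Suc n)
  let ?q = "r\<^sup>2"
  let ?F = "\<Sum>j\<le>n. r ^ j * qbinom ?q n j"
  have nz: "qfact ?q j \<noteq> 0" if "j \<le> Suc n" for j
    using qfact_nonzero[of "Suc n" ?q j] Suc.prems that by blast
  have one: "qbinom ?q m 0 = 1" "qbinom ?q m m = 1" if "m \<le> Suc n" for m
    using nz[OF that] by (simp_all add: qbinom_def)
  have "(\<Sum>j\<le>Suc n. r ^ j * qbinom ?q (Suc n) j)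
      = 1 + (\<Sum>k<n. r ^ Suc k * qbinom ?q (Suc n) (Suc k)) + r ^ Suc n"
    unfolding sum.atMost_shift[of _ "Suc n"] sum.lessThan_Suc by (simp add: one)
  also have "(\<Sum>k<n. r ^ Suc k * qbinom ?q (Suc n) (Suc k))
      = (\<Sum>k<n. r ^ Suc k * qbinom ?q n (Suc k)) + (\<Sum>k<n. r ^ Suc k * (?q ^ (n - k) * qbinom ?q n k))"
    unfolding sum.distrib[symmetric] using Suc.prems
    by (intro sum.cong refl) (simp add: qbinom_Pascal ring_distribs del: power_Suc)
  \<comment> \<open>As \<open>q = r\<^sup>2\<close>, the weight splits off the constant
    \<open>r ^ Suc n\<close> and leaves \<open>r ^ (n - k)\<close>. The symmetry of the binomials
    then turns the sum into a second copy of \<open>?F\<close>.\<close>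
  also have "(\<Sum>k<n. r ^ Suc k * (?q ^ (n - k) * qbinom ?q n k)) = (\<Sum>k<n. r ^ Suc n * (r ^ (n - k) * qbinom ?q n k))"
  proof (intro sum.cong refl)
    fix k assume "k \<in> {..<n}"
    then have "Suc k + 2 * (n - k) = Suc n + (n - k)" by auto
    then have "r ^ (Suc k + 2 * (n - k)) = r ^ (Suc n + (n - k))" by (simp only:)
    then have "r ^ Suc k * ?q ^ (n - k) = r ^ Suc n * r ^ (n - k)"
      by (simp only: power_add power_mult)
    then show "r ^ Suc k * (?q ^ (n - k) * qbinom ?q n k) = r ^ Suc n * (r ^ (n - k) * qbinom ?q n k)"
      by (simp only: mult.assoc[symmetric])
  qed
  also have "1 + ((\<Sum>k<n. r ^ Suc k * qbinom ?q n (Suc k)) + (\<Sum>k<n. r ^ Suc n * (r ^ (n - k) * qbinom ?q n k))) + r ^ Suc n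
     = (1 + (\<Sum>k<n. r ^ Suc k * qbinom ?q n (Suc k))) + r ^ Suc n * ((\<Sum>k<n. r ^ (n - k) * qbinom ?q n k) + 1)"
    by (simp add: sum_distrib_left algebra_simps)
  also have "1 + (\<Sum>k<n. r ^ Suc k * qbinom ?q n (Suc k)) = ?F"
    by (simp add: sum.atMost_shift one)
  also have "(\<Sum>k<n. r ^ (n - k) * qbinom ?q n k) + 1 = (\<Sum>k\<le>n. r ^ (n - k) * qbinom ?q n k)"
    by (simp add: lessThan_Suc_atMost[symmetric] one)
  also have "\<dots> = (\<Sum>k\<le>n. r ^ (n - k) * qbinom ?q n (n - k))"
    by (intro sum.cong refl) (simp add: qbinom_symmetric)
  also have "\<dots> = ?F"
    by (rule sum.reindex_bij_witness[of _ "\<lambda>k. n - k" "\<lambda>k. n - k"]) auto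
  also have "?F + r ^ Suc n * ?F = ?F * (1 + r ^ Suc n)" by (simp add: algebra_simps)
  also have "?F = (\<Prod>i=1..n. 1 + r ^ i)" using Suc by simp
  finally show ?case by (simp del: power_Suc)
qed

text \<open>For \<open>q\<close> of order \<open>n + 1\<close>, the factor
  \<open>1 - q ^ (n - j)\<close> is \<open>1 - q ^ Suc j\<close> up to a signed power of
  \<open>q\<close>. So the quotient of consecutive binomials is minus the inverse of
  \<open>q ^ Suc j\<close>, and the exponents add up to a triangular number.\<close>

lemma qbinom_root_of_unity:
  assumes M: "q ^ Suc n = 1" and nz: "\<And>i. 0 < i \<Longrightarrow> i \<le> n \<Longrightarrow> q ^ i \<noteq> 1" and j: "j \<le> n"
  shows "qbinom q n j * q ^ (j * (j + 1) div 2) = (-1) ^ j"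
  using j
proof (induction j)
  case 0
  show ?case using qfact_nonzero[of n q n] nz by (simp add: qbinom_def)
next
  case (Suc j)
  obtain d where n: "n = Suc (j + d)" using Suc.prems less_natE[of j n] by (auto simp: Suc_le_eq)
  have f: "qfact q i \<noteq> 0" if "i \<le> n" for i
    using qfact_nonzero[of n q i] nz that by blast
  have fs: "qfact q j \<noteq> 0" "qfact q d \<noteq> 0" "1 - q ^ Suc j \<noteq> 0" "1 - q ^ Suc d \<noteq> 0"
    using f[of j] f[of d] nz[of "Suc j"] nz[of "Suc d"] by (auto simp: n)
  have "q ^ Suc j * q ^ Suc d = 1" using M by (simp add: n power_add mult_ac)
  then have 1: "(1 - q ^ Suc d) * q ^ Suc j = - (1 - q ^ Suc j)" by (simp add: algebra_simps)
  have "qbinom q n (Suc j) * (1 - q ^ Suc j) = qbinom q n j * (1 - q ^ Suc d)"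
    using fs unfolding qbinom_def n by (simp add: qfact_Suc Suc_diff_le field_simps del: power_Suc)
  then have "qbinom q n (Suc j) * q ^ Suc j * (1 - q ^ Suc j) = - qbinom q n j * (1 - q ^ Suc j)"
    using 1 by (metis (no_types, lifting) mult.assoc mult.commute mult_minus_left)
  then have 2: "qbinom q n (Suc j) * q ^ Suc j = - qbinom q n j"
    using fs(3) by (metis mult_right_cancel)
  have "Suc j * (Suc j + 1) div 2 = j * (j + 1) div 2 + Suc j" by simp
  then have "qbinom q n (Suc j) * q ^ (Suc j * (Suc j + 1) div 2)
      = (qbinom q n (Suc j) * q ^ Suc j) * q ^ (j * (j + 1) div 2)"
    by (simp only: power_add mult_ac)
  also have "\<dots> = - (qbinom q n j * q ^ (j * (j + 1) div 2))" by (simp only: 2 mult_minus_left)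
  also have "\<dots> = (-1) ^ Suc j" using Suc by simp
  finally show ?case .
qed

lemma one_plus_eR: "1 + eR (- x) = of_real (2 * cos (pi * x)) * eR (- x / 2)"
proof -
  have "eR (x / 2) + eR (- x / 2) = of_real (2 * cos (pi * x))"
    by (simp add: eR_def complex_eq_iff)
  then have "(eR (x / 2) + eR (- x / 2)) * eR (- x / 2) = of_real (2 * cos (pi * x)) * eR (- x / 2)"
    by simp
  then show ?thesis by (simp add: distrib_right eR_add[symmetric])
qed

lemma one_minus_eR: "1 - eR (- x) = of_real (2 * sin (pi * x)) * eR (1/4 - x / 2)"
proof -
  have "eR (x / 2) - eR (- x / 2) = of_real (2 * sin (pi * x)) * eR (1/4)"
    by (simp add: eR_def complex_eq_iff)
  then have "(eR (x / 2) - eR (- x / 2)) * eR (- x / 2) = of_real (2 * sin (pi * x)) * eR (1/4) * eR (- x / 2)"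
    by simp
  then show ?thesis
    by (simp add: left_diff_distrib eR_add[symmetric] mult.assoc del: eR_quarter)
qed

lemma gauss_sum_even_product:
  fixes m :: nat
  assumes m: "m > 0"
  shows "(\<Sum>j<2*m. eR (real (j\<^sup>2) / real (4 * m))) = (\<Prod>i=1..2*m-1. 1 + (-1) ^ i * eR (- real i / real (4 * m)))"
proof -
  define n where "n = 2 * m - 1"
  \<comment> \<open>Now \<open>r\<^sup>2\<close> is a primitive root of unity of order
    \<open>2 * m\<close>. In \<open>r ^ j * qbinom\<close> the minus sign cancels the
    \<open>(-1) ^ j\<close> of the binomial, and \<open>- j\<close> cancels the linear part of
    \<open>j * (j + 1)\<close>, so that only the square remains in the exponent.\<close>
  define r where "r = - eR (- 1 / real (4 * m))"
  have n: "Suc n = 2 * m" using m by (simp add: n_def)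
  have q: "r\<^sup>2 = eR (- 1 / real (2 * m))"
    using eR_power[of "- 1 / real (4 * m)" 2] by (simp add: r_def)
  have qi: "(r\<^sup>2) ^ i = eR (- real i / real (2 * m))" for i
    by (simp add: q eR_power)
  have nz: "(r\<^sup>2) ^ i \<noteq> 1" if "0 < i" "i \<le> n" for i
  proof
    assume "(r\<^sup>2) ^ i = 1"
    then have "- real i / real (2 * m) \<in> \<int>" by (simp only: qi eR_eq_1_iff)
    then obtain k where "- real i / real (2 * m) = of_int k" by (rule Ints_cases)
    then have "- real i = of_int (k * int (2 * m))" using m by (simp add: field_simps)
    then have "- int i = k * int (2 * m)" by linarith
    then have "int (2 * m) dvd int i" by (metis dvd_triv_right dvd_minus_iff)
    then have "2 * m dvd i" by (simp only: int_dvd_int_iff)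
    then show False using that n by (auto dest: dvd_imp_le)
  qed
  have unit: "(r\<^sup>2) ^ Suc n = 1"
    using m by (simp add: qi n eR_minus del: power_Suc)
      (metis eR_of_int eR_minus inverse_1 of_int_1)
  have ri: "r ^ i = (-1) ^ i * eR (- real i / real (4 * m))" for i
    by (simp add: r_def power_minus[of "eR _"] eR_power)
  have term_eq: "r ^ j * qbinom (r\<^sup>2) n j = eR (real (j\<^sup>2) / real (4 * m))" if "j \<le> n" for j
  proof -
    have "real (j * (j + 1) div 2) = real j * (real j + 1) / 2"
      by (subst real_of_nat_div) (auto simp: algebra_simps)
    then have "- real (j * (j + 1) div 2) / real (2 * m) = - (real j * (real j + 1)) / real (4 * m)"
      by (simp only: of_nat_mult)
    then have "(r\<^sup>2) ^ (j * (j + 1) div 2) = eR (- (real j * (real j + 1)) / real (4 * m))"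
      by (simp only: qi)
    then have "qbinom (r\<^sup>2) n j * eR (- (real j * (real j + 1)) / real (4 * m)) = (-1) ^ j"
      using qbinom_root_of_unity[OF unit nz that] by (simp only:)
    then have "qbinom (r\<^sup>2) n j = (-1) ^ j * eR (real j * (real j + 1) / real (4 * m))"
      by (metis divide_inverse eR_minus eR_neq_0 minus_divide_left nonzero_divide_eq_eq)
    then have "r ^ j * qbinom (r\<^sup>2) n j
        = ((-1) ^ j * (-1) ^ j) * eR (- real j / real (4 * m) + real j * (real j + 1) / real (4 * m))"
      by (simp only: ri eR_add mult_ac)
    also have "- real j / real (4 * m) + real j * (real j + 1) / real (4 * m) = real (j\<^sup>2) / real (4 * m)"
      by (simp add: algebra_simps add_divide_distrib power2_eq_square)
    also have "(-1) ^ j * (-1) ^ j = (1::complex)"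
      by (simp flip: power_add)
    finally show ?thesis by simp
  qed
  have "(\<Sum>j<2*m. eR (real (j\<^sup>2) / real (4 * m))) = (\<Sum>j\<le>n. r ^ j * qbinom (r\<^sup>2) n j)"
    by (intro sum.cong) (use n term_eq in auto)
  also have "\<dots> = (\<Prod>i=1..n. 1 + r ^ i)"
    using nz by (rule gauss_qbinom_identity)
  finally show ?thesis by (simp add: ri n_def)
qed

text \<open>The half-angle formulas write each factor of the product as a sine or cosine times a
  root of unity. The angles lie strictly between 0 and \<open>pi / 2\<close>, so the real factors
  are positive and the phase is the sum of the remaining arguments.\<close>

lemma gauss_sum_even_phase:
  fixes m :: nat
  assumes m: "m > 0"
  shows "\<exists>R>0. (\<Sum>j<2*m. eR (real (j\<^sup>2) / real (4 * m))) = of_real R * eR (1/8)"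
proof -
  define \<rho> where "\<rho> i = 2 * (if even i then cos (pi * (real i / real (4 * m))) else sin (pi * (real i / real (4 * m))))" for i
  define \<phi> where "\<phi> i = (if even i then 0 else 1/4) - real i / real (8 * m)" for i :: nat
  have factor: "1 + (-1) ^ i * eR (- real i / real (4 * m)) = of_real (\<rho> i) * eR (\<phi> i)" for i
    using one_plus_eR[of "real i / real (4 * m)"] one_minus_eR[of "real i / real (4 * m)"]
    by (cases "even i") (simp_all add: \<rho>_def \<phi>_def)
  have pos: "\<rho> i > 0" if "i \<in> {1..2*m-1}" for i
  proof -
    have "0 < real i / real (4 * m)" "real i / real (4 * m) < 1/2"
      using that m by (auto simp: field_simps)
    then have "0 < pi * (real i / real (4 * m))" "pi * (real i / real (4 * m)) < pi / 2"
      using mult_strict_left_mono[of "real i / real (4 * m)" "1/2" pi] mult_pos_pos[of pi "real i / real (4 * m)"]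
      by (simp_all only: pi_gt_zero mult_1_right times_divide_eq_right)
    then show ?thesis unfolding \<rho>_def
      using cos_gt_zero_pi sin_gt_zero by auto
  qed
  \<comment> \<open>Arguments of even and odd index differ by a quarter turn, hence the summation in
    pairs.\<close>
  have "(\<Sum>i<2*k. \<phi> i) = real k / 4 - real k * (2 * real k - 1) / real (8 * m)" for k
  proof (induction k)
    case (Suc k)
    have "\<phi> (2 * k) + \<phi> (Suc (2 * k)) = 1/4 - (4 * real k + 1) / real (8 * m)"
      by (simp add: \<phi>_def add_divide_distrib)
    then show ?case using Suc m by (simp add: field_simps)
  qed simp
  from this[of m] have "(\<Sum>i<2*m. \<phi> i) = 1/8"
    using m by (simp add: field_simps)
  \<comment> \<open>The product starts at index 1, but \<open>\<phi> 0 = 0\<close> lets the paired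
    sum start at 0.\<close>
  moreover have "{..<2*m} = insert 0 {1..2*m-1}" using m by auto
  ultimately have \<phi>: "(\<Sum>i=1..2*m-1. \<phi> i) = 1/8" by (simp add: \<phi>_def)
  have "(\<Sum>j<2*m. eR (real (j\<^sup>2) / real (4 * m))) = (\<Prod>i=1..2*m-1. of_real (\<rho> i) * eR (\<phi> i))"
    unfolding gauss_sum_even_product[OF m] factor ..
  also have "\<dots> = of_real (\<Prod>i=1..2*m-1. \<rho> i) * eR (1/8)"
    by (simp only: prod.distrib of_real_prod eR_sum[symmetric] \<phi>)
  finally show ?thesis using pos by (intro exI[of _ "\<Prod>i=1..2*m-1. \<rho> i"]) (auto intro!: prod_pos)
qed

text \<open>After the substitution \<open>y = x + h\<close> the squares of \<open>x\<close> cancel,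
  the sum over \<open>x\<close> becomes an additive character sum, and only \<open>h = 0\<close>
  survives.\<close>

lemma gauss_sum_even_abs:
  fixes m :: int
  assumes m: "m > 0"
  defines "S \<equiv> (\<Sum>x\<in>{0..<2*m}. eR (of_int (x\<^sup>2) / of_int (4 * m)))"
  shows "cnj S * S = of_int (2 * m)"
proof -
  let ?f = "\<lambda>x. eR (of_int (x\<^sup>2) / of_int (4 * m))"
  \<comment> \<open>The square modulo \<open>4 * m\<close> depends only on \<open>x\<close> modulo
    \<open>2 * m\<close>, so half of the usual period is already a complete sum.\<close>
  have per: "?f x = ?f y" if "[x = y] (mod (2 * m))" for x y
  proof (rule eR_cong)
    from that obtain k where "y = x + 2 * m * k" by (auto simp: cong_iff_lin)
    then have "y\<^sup>2 = x\<^sup>2 + 4 * m * (x * k + m * k\<^sup>2)" by (simp add: power2_eq_square algebra_simps)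
    then show "[x\<^sup>2 = y\<^sup>2] (mod (4 * m))" by (auto simp: cong_iff_lin)
  qed (use m in simp)
  have "cnj S * S = (\<Sum>x\<in>{0..<2*m}. cnj (?f x) * (\<Sum>y\<in>{0..<2*m}. ?f y))"
    by (simp add: S_def sum_distrib_right)
  also have "\<dots> = (\<Sum>x\<in>{0..<2*m}. cnj (?f x) * (\<Sum>h\<in>{0..<2*m}. ?f (x + h)))"
  proof -
    have "(\<Sum>h\<in>{0..<2*m}. ?f (x + h)) = (\<Sum>y\<in>{0..<2*m}. ?f y)" for x
      by (rule sum_residues_reindex[of _ ?f]) (use m per in \<open>auto simp: cong_add_lcancel\<close>)
    then show ?thesis by (simp only:)
  qed
  also have "\<dots> = (\<Sum>x\<in>{0..<2*m}. \<Sum>h\<in>{0..<2*m}. ?f h * eR (of_int (h * x) / of_int (2 * m)))"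
    unfolding sum_distrib_left
  proof (intro sum.cong refl)
    fix x h
    have "- (of_int (x\<^sup>2) / of_int (4 * m)) + of_int ((x + h)\<^sup>2) / of_int (4 * m)
       = of_int (h\<^sup>2) / of_int (4 * m) + (of_int (h * x) / of_int (2 * m) :: real)"
      using m by (simp add: field_simps power2_eq_square)
    then show "cnj (?f x) * ?f (x + h) = ?f h * eR (of_int (h * x) / of_int (2 * m))"
      by (simp only: eR_cnj eR_add[symmetric])
  qed
  also have "\<dots> = (\<Sum>h\<in>{0..<2*m}. ?f h * (\<Sum>x\<in>{0..<2*m}. eR (of_int (h * x) / of_int (2 * m))))"
    by (subst sum.swap) (simp add: sum_distrib_left)
  also have "\<dots> = (\<Sum>h\<in>{0..<2*m}. ?f h * (if 2 * m dvd h then of_int (2 * m) else 0))"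
    using m by (subst sum_additive_character) auto
  also have "\<dots> = (\<Sum>h\<in>{0}. ?f h * (if 2 * m dvd h then of_int (2 * m) else 0))"
    by (rule sum.mono_neutral_right) (use m in \<open>auto dest!: zdvd_imp_le\<close>)
  finally show ?thesis by simp
qed

theorem gauss_sum_even:
  fixes m :: int
  assumes m: "m > 0"
  shows "(\<Sum>x\<in>{0..<2*m}. eR (of_int (x\<^sup>2) / of_int (4 * m))) = of_real (sqrt (of_int (2 * m))) * eR (1/8)"
    (is "?S = _")
proof -
  have "?S = (\<Sum>j<2*nat m. eR (real (j\<^sup>2) / real (4 * nat m)))"
    by (rule sum.reindex_bij_witness[of _ int nat]) (use m in auto)
  then obtain R where R: "R > 0" "?S = of_real R * eR (1/8)"
    using gauss_sum_even_phase[of "nat m"] m by auto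
  have "of_int (2 * m) = cnj (of_real R * eR (1/8)) * (of_real R * eR (1/8))"
    using gauss_sum_even_abs[OF m] by (simp only: R(2))
  also have "\<dots> = of_real (R\<^sup>2)"
    by (simp add: eR_cnj power2_eq_square eR_minus)
  finally have "R\<^sup>2 = of_int (2 * m)"
    by (metis of_real_eq_iff of_real_of_int_eq)
  then have "R = sqrt (of_int (2 * m))" using R(1) by (simp add: real_sqrt_unique)
  then show ?thesis using R(2) by simp
qed

section \<open>Sums over cubes and quadratic forms\<close>

lemma sum_vec_prod:
  fixes f :: "'n::finite \<Rightarrow> 'b \<Rightarrow> 'a::comm_semiring_1"
  assumes "\<And>i. finite (S i)"
  shows "(\<Sum>v\<in>{v::'b^'n. \<forall>i. v $ i \<in> S i}. \<Prod>i\<in>UNIV. f i (v $ i)) = (\<Prod>i\<in>UNIV. \<Sum>x\<in>S i. f i x)"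
proof -
  have "(\<Prod>i\<in>UNIV. \<Sum>x\<in>S i. f i x) = (\<Sum>g\<in>PiE UNIV S. \<Prod>i\<in>UNIV. f i (g i))"
    using assms by (intro prod_sum_PiE) auto
  also have "\<dots> = (\<Sum>v\<in>{v::'b^'n. \<forall>i. v $ i \<in> S i}. \<Prod>i\<in>UNIV. f i (v $ i))"
    by (rule sum.reindex_bij_witness[of _ vec_nth vec_lambda]) auto
  finally show ?thesis ..
qed

text \<open>Sides may differ because the index computation for Milgram's formula meets a box with
  one shorter side.\<close>

definition vbox :: "int^'n \<Rightarrow> (int^'n) set" where
  "vbox b = {v. \<forall>i. 0 \<le> v $ i \<and> v $ i < b $ i}"

abbreviation cube :: "int \<Rightarrow> (int^'n) set" where
  "cube c \<equiv> vbox (vec c)"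

lemma vbox_iff: "v \<in> vbox b \<longleftrightarrow> (\<forall>i. 0 \<le> v $ i \<and> v $ i < b $ i)"
  by (simp add: vbox_def)

lemma sum_vbox_prod:
  fixes f :: "'n::finite \<Rightarrow> int \<Rightarrow> complex"
  shows "(\<Sum>v\<in>vbox b. \<Prod>i\<in>UNIV. f i (v $ i)) = (\<Prod>i\<in>UNIV. \<Sum>x\<in>{0..<b $ i}. f i x)"
  using sum_vec_prod[of "\<lambda>i. {0..<b $ i}" f] by (simp add: vbox_def)

lemma finite_vbox [simp]: "finite (vbox (b :: int^'n))"
proof -
  have "vbox b \<subseteq> vec_lambda ` PiE UNIV (\<lambda>i. {0..<b $ i})"
    by (rule subsetI, rule_tac x = "vec_nth x" in image_eqI) (auto simp: vbox_iff)
  then show ?thesis by (rule finite_subset) (auto intro!: finite_imageI finite_PiE)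
qed

lemma card_vbox:
  fixes b :: "int^'n"
  assumes "\<And>i. b $ i > 0"
  shows "int (card (vbox b)) = (\<Prod>i\<in>UNIV. b $ i)"
proof -
  have "of_nat (card (vbox b)) = (\<Sum>v\<in>vbox b. \<Prod>i\<in>(UNIV::'n set). (\<lambda>_ _. 1::complex) i (v $ i))"
    by simp
  also have "\<dots> = (\<Prod>i\<in>UNIV. \<Sum>x\<in>{0..<b $ i}. 1)"
    by (rule sum_vbox_prod)
  also have "\<dots> = of_int (\<Prod>i\<in>UNIV. b $ i)"
    using assms by (auto simp: less_imp_le intro!: prod.cong)
  finally show ?thesis by (metis of_int_eq_iff of_int_of_nat_eq)
qed

lemma card_cube: "c > 0 \<Longrightarrow> int (card (cube c :: (int^'n) set)) = c ^ CARD('n)"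
  by (simp add: card_vbox)

definition vcong :: "int \<Rightarrow> int^'n \<Rightarrow> int^'n \<Rightarrow> bool" where
  "vcong c u v \<longleftrightarrow> (\<forall>i. [u $ i = v $ i] (mod c))"

lemma vcong_cube_eq: "vcong c u v \<Longrightarrow> u \<in> cube c \<Longrightarrow> v \<in> cube c \<Longrightarrow> u = v"
  by (simp add: vcong_def vbox_iff vec_eq_iff cong_def)

lemma vcongE:
  assumes "vcong c u v"
  obtains w where "v = u + c *s w"
proof -
  from assms have "\<forall>i. \<exists>k. v $ i = u $ i + c * k" by (simp add: vcong_def cong_iff_lin)
  then obtain k where "\<And>i. v $ i = u $ i + c * k i" by metis
  then have "v = u + c *s (\<chi> i. k i)" by (simp add: vec_eq_iff)
  then show ?thesis by (rule that)
qed

definition vmod :: "int \<Rightarrow> int^'n \<Rightarrow> int^'n" where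
  "vmod c v = (\<chi> i. v $ i mod c)"

lemma vmod_in_cube: "c > 0 \<Longrightarrow> vmod c v \<in> cube c"
  by (simp add: vmod_def vbox_iff)

lemma vcong_vmod [simp]: "vcong c (vmod c v) v"
  by (simp add: vmod_def vcong_def cong_def)

lemma vmod_eq_iff: "vmod c u = vmod c v \<longleftrightarrow> vcong c u v"
  by (simp add: vmod_def vcong_def cong_def vec_eq_iff)

lemma sum_cube_reindex:
  fixes f :: "int^'n \<Rightarrow> complex" and \<phi> :: "int^'n \<Rightarrow> int^'n"
  assumes c: "c > 0"
    and per: "\<And>x y. vcong c x y \<Longrightarrow> f x = f y"
    and inj: "\<And>x y. vcong c (\<phi> x) (\<phi> y) \<Longrightarrow> vcong c x y"
  shows "(\<Sum>x\<in>cube c. f (\<phi> x)) = (\<Sum>x\<in>cube c. f x)"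
proof -
  have "inj_on (\<lambda>x. vmod c (\<phi> x)) (cube c)"
    by (rule inj_onI) (metis inj vmod_eq_iff vcong_cube_eq)
  moreover have "(\<lambda>x. vmod c (\<phi> x)) ` cube c \<subseteq> cube c"
    using c by (auto simp: vmod_in_cube)
  ultimately have "bij_betw (\<lambda>x. vmod c (\<phi> x)) (cube c) (cube c)"
    by (simp add: bij_betw_def endo_inj_surj)
  then have "(\<Sum>x\<in>cube c. f (vmod c (\<phi> x))) = (\<Sum>x\<in>cube c. f x)"
    by (rule sum.reindex_bij_betw)
  moreover have "f (vmod c (\<phi> x)) = f (\<phi> x)" for x
    by (intro per) simp
  ultimately show ?thesis by simp
qed

lemma vcong_add_lcancel: "vcong c (t + x) (t + y) \<longleftrightarrow> vcong c x y"
  by (simp add: vcong_def cong_add_lcancel)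

lemma sum_cube_shift:
  fixes f :: "int^'n \<Rightarrow> complex"
  assumes "c > 0" "\<And>x y. vcong c x y \<Longrightarrow> f x = f y"
  shows "(\<Sum>x\<in>cube c. f (t + x)) = (\<Sum>x\<in>cube c. f x)"
  using assms by (intro sum_cube_reindex) (simp_all add: vcong_add_lcancel)

text \<open>Division with remainder by \<open>M\<close> in each coordinate.\<close>

lemma sum_vbox_multiple:
  fixes f :: "int^'n \<Rightarrow> complex"
  assumes M: "M > 0" and per: "\<And>x y. vcong M x y \<Longrightarrow> f x = f y" and m: "\<And>i. m $ i > 0"
  shows "(\<Sum>v\<in>vbox (M *s m). f v) = of_int (\<Prod>i\<in>UNIV. m $ i) * (\<Sum>v\<in>cube M. f v)"
proof -
  have "(\<Sum>v\<in>vbox (M *s m). f v) = (\<Sum>(w, u)\<in>vbox m \<times> cube M. f u)"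
  proof (rule sum.reindex_bij_witness[of _ "\<lambda>(w, u). u + M *s w" "\<lambda>v. (\<chi> i. v $ i div M, vmod M v)"])
    fix v :: "int^'n" assume v: "v \<in> vbox (M *s m)"
    have "v $ i div M < m $ i" for i
    proof -
      have "M * (v $ i div M) \<le> v $ i" using M by (simp add: minus_mod_eq_mult_div[symmetric])
      also have "\<dots> < M * m $ i" using v by (simp add: vbox_iff)
      finally show ?thesis using M by simp
    qed
    then show "(\<chi> i. v $ i div M, vmod M v) \<in> vbox m \<times> cube M"
      using v M by (simp add: vbox_iff pos_imp_zdiv_nonneg_iff vmod_def)
    show "(case (\<chi> i. v $ i div M, vmod M v) of (w, u) \<Rightarrow> u + M *s w) = v"
      by (simp add: vec_eq_iff vmod_def)
    show "(case (\<chi> i. v $ i div M, vmod M v) of (w, u) \<Rightarrow> f u) = f v"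
      using per[of "vmod M v" v] by simp
  next
    fix p :: "(int^'n) \<times> (int^'n)" assume "p \<in> vbox m \<times> cube M"
    then obtain w u where p: "p = (w, u)" and w: "w \<in> vbox m" and u: "u \<in> cube M" by auto
    have "u $ i + M * w $ i < M * m $ i" for i
    proof -
      have "M * (w $ i + 1) \<le> M * m $ i" using w M by (intro mult_left_mono) (auto simp: vbox_iff add1_zle_eq)
      moreover have "u $ i < M" using u by (simp add: vbox_iff)
      ultimately show ?thesis by (simp add: algebra_simps)
    qed
    then show "(case p of (w, u) \<Rightarrow> u + M *s w) \<in> vbox (M *s m)"
      using w u M by (simp add: p vbox_iff)
    have "(u $ i + M * w $ i) div M = w $ i" "(u $ i + M * w $ i) mod M = u $ i" for i
      using u M by (simp_all add: vbox_iff)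
    then show "((\<chi> i. (case p of (w, u) \<Rightarrow> u + M *s w) $ i div M), vmod M (case p of (w, u) \<Rightarrow> u + M *s w)) = p"
      by (simp add: p vec_eq_iff vmod_def)
  qed
  also have "\<dots> = of_nat (card (vbox m)) * (\<Sum>v\<in>cube M. f v)"
    by (simp add: sum.cartesian_product[symmetric])
  also have "of_nat (card (vbox m)) = (of_int (\<Prod>i\<in>UNIV. m $ i) :: complex)"
    using card_vbox[of m] m by (metis of_int_of_nat_eq)
  finally show ?thesis .
qed

section \<open>Integral quadratic forms and their Gauss sums\<close>

definition idot :: "int^'n \<Rightarrow> int^'n \<Rightarrow> int" where
  "idot u v = (\<Sum>i\<in>UNIV. u $ i * v $ i)"

lemma idot_commute: "idot u v = idot v u"
  by (simp add: idot_def mult.commute)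

lemma idot_add: "idot (u + u') v = idot u v + idot u' v" "idot u (v + v') = idot u v + idot u v'"
  by (simp_all add: idot_def algebra_simps sum.distrib)

lemma idot_smult: "idot (k *s u) v = k * idot u v" "idot u (k *s v) = k * idot u v"
  by (simp_all add: idot_def sum_distrib_left mult_ac)

lemma idot_matrix: "idot u (A *v v) = idot (transpose A *v u) v"
proof -
  have "idot u (A *v v) = (\<Sum>i\<in>UNIV. \<Sum>k\<in>UNIV. u $ i * A $ i $ k * v $ k)"
    by (simp add: idot_def matrix_vector_mult_def sum_distrib_left mult_ac)
  also have "\<dots> = idot (transpose A *v u) v"
    by (subst sum.swap) (simp add: idot_def matrix_vector_mult_def transpose_def sum_distrib_right sum_distrib_left mult_ac)
  finally show ?thesis .
qed

text \<open>This is \<open>2q\<close>, which keeps the form integral without a division; the phases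
  therefore have denominator \<open>2 * c\<close>.\<close>

definition qf :: "int^'n^'n \<Rightarrow> int^'n \<Rightarrow> int" where
  "qf A v = idot v (A *v v)"

lemma idot_matrix_sym: "transpose A = A \<Longrightarrow> idot v (A *v u) = idot u (A *v v)"
  by (subst idot_matrix) (simp add: idot_commute)

definition even_sym :: "int^'n^'n \<Rightarrow> bool" where
  "even_sym A \<longleftrightarrow> transpose A = A \<and> (\<forall>i. even (A $ i $ i))"

lemma even_sym_nth: "even_sym A \<Longrightarrow> A $ i $ k = A $ k $ i"
  unfolding even_sym_def by (metis transpose_def vec_lambda_beta)

lemma matrix_smult_vec: "A *v (k *s v) = k *s (A *v v)" for A :: "int^'n^'m"
  by (simp add: vec_eq_iff matrix_vector_mult_def sum_distrib_left mult_ac)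

lemma qf_add:
  assumes "transpose A = A"
  shows "qf A (u + v) = qf A u + 2 * idot u (A *v v) + qf A v"
  using idot_matrix_sym[OF assms, of v u]
  by (simp add: qf_def matrix_vector_right_distrib idot_add)

lemma qf_smult: "qf A (k *s v) = k\<^sup>2 * qf A v"
  by (simp add: qf_def matrix_smult_vec idot_smult power2_eq_square)

text \<open>Off-diagonal terms come in equal pairs.\<close>

lemma even_double_sum:
  fixes f :: "'a \<Rightarrow> 'a \<Rightarrow> int"
  assumes "finite S" "\<And>i k. f i k = f k i" "\<And>i. even (f i i)"
  shows "even (\<Sum>i\<in>S. \<Sum>k\<in>S. f i k)"
  using assms(1)
proof induction
  case (insert a S)
  have "(\<Sum>i\<in>S. f i a) = (\<Sum>k\<in>S. f a k)" using assms(2) by simp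
  then have "(\<Sum>i\<in>insert a S. \<Sum>k\<in>insert a S. f i k) = f a a + 2 * (\<Sum>k\<in>S. f a k) + (\<Sum>i\<in>S. \<Sum>k\<in>S. f i k)"
    using insert by (simp add: sum.distrib)
  then show ?case using insert.IH assms(3) by simp
qed simp

lemma qf_even:
  assumes "even_sym A"
  shows "even (qf A v)"
proof -
  have "qf A v = (\<Sum>i\<in>UNIV. \<Sum>k\<in>UNIV. v $ i * A $ i $ k * v $ k)"
    by (simp add: qf_def idot_def matrix_vector_mult_def sum_distrib_left mult_ac)
  moreover have "even (\<Sum>i\<in>UNIV. \<Sum>k\<in>UNIV. v $ i * A $ i $ k * v $ k)"
    by (rule even_double_sum) (use assms even_sym_nth[OF assms] in \<open>auto simp: even_sym_def mult_ac\<close>)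
  ultimately show ?thesis by simp
qed

lemma qf_congruence: "qf (transpose P ** A ** P) v = qf A (P *v v)"
  by (simp only: qf_def matrix_vector_mul_assoc[symmetric] idot_matrix[of v "transpose P"] transpose_transpose)

lemma qf_axis: "qf A (axis i 1) = A $ i $ i"
  by (simp add: qf_def idot_def matrix_vector_mult_def axis_def if_distrib[of "\<lambda>x. x * _"] if_distrib[of "\<lambda>x. _ * x"] cong: if_cong)

lemma even_sym_congruence:
  assumes "even_sym A"
  shows "even_sym (transpose P ** A ** P)"
proof -
  have "even ((transpose P ** A ** P) $ i $ i)" for i
    using qf_even[OF assms] by (simp flip: qf_axis add: qf_congruence)
  then show ?thesis
    using assms by (simp add: even_sym_def matrix_transpose_mul transpose_transpose matrix_mul_assoc)
qed

definition qsum :: "int^'n^'n \<Rightarrow> int \<Rightarrow> int \<Rightarrow> complex" where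
  "qsum A a c = (\<Sum>v\<in>cube c. eR (of_int (a * qf A v) / of_int (2 * c)))"

text \<open>The cross term carries a factor 2, and \<open>c\<^sup>2 * qf A w\<close> is divisible by
  \<open>2 * c\<close> because the form is even. Hence the Gauss sum may run over vectors modulo
  \<open>c\<close> although its denominator is \<open>2 * c\<close>.\<close>

lemma qf_vcong:
  assumes A: "even_sym A" and uv: "vcong c u v"
  shows "[qf A u = qf A v] (mod (2 * c))"
proof -
  obtain w where w: "v = u + c *s w" using uv by (rule vcongE)
  obtain h where h: "qf A w = 2 * h" using qf_even[OF A] by auto
  have "qf A v = qf A u + 2 * c * (idot u (A *v w) + c * h)"
    using A by (simp add: w qf_add even_sym_def matrix_smult_vec idot_smult qf_smult h power2_eq_square algebra_simps)
  then show ?thesis by (auto simp: cong_iff_lin)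
qed

lemma qsum_term_cong:
  assumes "even_sym A" "c > 0" "vcong c u v"
  shows "eR (of_int (a * qf A u) / of_int (2 * c)) = eR (of_int (a * qf A v) / of_int (2 * c))"
  using assms by (intro eR_cong cong_mult qf_vcong) auto

lemma qsum_cong:
  assumes A: "even_sym A" and c: "c > 0" and ab: "[a = b] (mod c)"
  shows "qsum A a c = qsum A b c"
  unfolding qsum_def
proof (intro sum.cong refl eR_cong)
  fix v
  obtain k where k: "b = a + c * k" using ab by (auto simp: cong_iff_lin)
  obtain h where h: "qf A v = 2 * h" using qf_even[OF A] by auto
  have "b * qf A v = a * qf A v + 2 * c * (k * h)" by (simp add: k h algebra_simps)
  then show "[a * qf A v = b * qf A v] (mod (2 * c))" by (auto simp: cong_iff_lin)
qed (use c in simp)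

lemma qsum_minus: "qsum A (- a) c = cnj (qsum A a c)"
  by (simp add: qsum_def eR_cnj)

lemma matrix_mat_mult_vec: "mat k *v v = k *s v" for v :: "int^'n"
  by (simp add: vec_eq_iff matrix_vector_mult_def mat_def if_distrib[of "\<lambda>x. x * _"] cong: if_cong)

lemma vcong_matrix: "vcong c u v \<Longrightarrow> vcong c (P *v u) (P *v v)" for P :: "int^'n^'m"
  unfolding vcong_def matrix_vector_mult_def by (auto intro!: cong_sum cong_mult)

lemma vcong_smult_cancel:
  assumes "vcong c (k *s u) (k *s v)" "coprime k c"
  shows "vcong c u v"
  using assms by (auto simp: vcong_def cong_mult_lcancel)

text \<open>\<open>Q\<close> inverts \<open>P\<close> up to the factor \<open>k\<close>, so
  \<open>P\<close> permutes the residues modulo \<open>c\<close> as soon as \<open>k\<close> is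
  prime to \<open>c\<close>.\<close>

lemma qsum_congruence:
  fixes A P Q :: "int^'n^'n"
  assumes A: "even_sym A" and c: "c > 0" and QP: "Q ** P = mat k" and k: "coprime k c"
  shows "qsum (transpose P ** A ** P) a c = qsum A a c"
  unfolding qsum_def qf_congruence
proof (rule sum_cube_reindex[OF c, where f = "\<lambda>v. eR (of_int (a * qf A v) / of_int (2 * c))" and \<phi> = "\<lambda>v. P *v v"])
  fix u v assume "vcong c (P *v u) (P *v v)"
  then have "vcong c (Q *v (P *v u)) (Q *v (P *v v))" by (rule vcong_matrix)
  then have "vcong c (k *s u) (k *s v)"
    by (simp add: matrix_vector_mul_assoc QP matrix_mat_mult_vec)
  then show "vcong c u v" using k by (rule vcong_smult_cancel)
qed (rule qsum_term_cong[OF A c])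

text \<open>In the Chinese remainder substitution \<open>c2 *s u + c1 *s v\<close> the cross term
  contributes an integer, and each square leaves one factor of the other modulus in the
  numerator.\<close>

lemma qsum_mult:
  fixes A :: "int^'n^'n"
  assumes A: "even_sym A" and c: "c1 > 0" "c2 > 0" and cop: "coprime c1 c2"
  shows "qsum A a (c1 * c2) = qsum A (a * c2) c1 * qsum A (a * c1) c2"
proof -
  let ?c = "c1 * c2" and ?t = "\<lambda>v. eR (of_int (a * qf A v) / of_int (2 * (c1 * c2)))"
  let ?\<psi> = "\<lambda>(u, v). vmod ?c (c2 *s u + c1 *s v) :: int^'n"
  have cpos: "?c > 0" using c by simp
  have inj: "inj_on ?\<psi> (cube c1 \<times> cube c2)"
  proof (rule inj_onI; clarify)
    fix u v u' v' :: "int^'n"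
    assume u: "u \<in> cube c1" "u' \<in> cube c1" and v: "v \<in> cube c2" "v' \<in> cube c2"
      and "vmod ?c (c2 *s u + c1 *s v) = vmod ?c (c2 *s u' + c1 *s v')"
    then have *: "[c2 * u $ i + c1 * v $ i = c2 * u' $ i + c1 * v' $ i] (mod (c1 * c2))" for i
      by (simp add: vmod_eq_iff vcong_def)
    have "[c2 * u $ i = c2 * u' $ i] (mod c1)" for i
    proof -
      have "[c2 * u $ i + c1 * v $ i = c2 * u' $ i + c1 * v' $ i] (mod c1)"
        using *[of i] by (rule cong_modulus_mult)
      then show ?thesis by (simp add: cong_def)
    qed
    then have "vcong c1 u u'" using cop by (simp add: vcong_def cong_mult_lcancel coprime_commute)
    moreover have "[c1 * v $ i = c1 * v' $ i] (mod c2)" for i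
    proof -
      have "[c2 * u $ i + c1 * v $ i = c2 * u' $ i + c1 * v' $ i] (mod c2)"
        using *[of i] by (subst (asm) mult.commute[of c1 c2]) (rule cong_modulus_mult)
      then show ?thesis by (simp add: cong_def)
    qed
    then have "vcong c2 v v'" using cop by (simp add: vcong_def cong_mult_lcancel)
    ultimately show "u = u' \<and> v = v'" using u v vcong_cube_eq by blast
  qed
  moreover have "?\<psi> ` (cube c1 \<times> cube c2) = cube ?c"
  proof (rule card_subset_eq)
    show "?\<psi> ` (cube c1 \<times> cube c2) \<subseteq> cube ?c" using cpos by (auto simp: vmod_in_cube)
    have "int (card (?\<psi> ` (cube c1 \<times> cube c2))) = int (card (cube c1 :: (int^'n) set)) * int (card (cube c2 :: (int^'n) set))"
      using inj by (simp add: card_image card_cartesian_product)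
    also have "\<dots> = int (card (cube ?c :: (int^'n) set))"
      using c cpos by (simp only: card_cube power_mult_distrib)
    finally show "card (?\<psi> ` (cube c1 \<times> cube c2)) = card (cube ?c :: (int^'n) set)" by simp
  qed simp
  ultimately have bij: "bij_betw ?\<psi> (cube c1 \<times> cube c2) (cube ?c)" by (simp add: bij_betw_def)
  have "qsum A a ?c = (\<Sum>p\<in>cube c1 \<times> cube c2. ?t (?\<psi> p))"
    unfolding qsum_def using bij by (rule sum.reindex_bij_betw[symmetric])
  also have "\<dots> = (\<Sum>(u, v)\<in>cube c1 \<times> cube c2. eR (of_int (a * c2 * qf A u) / of_int (2 * c1)) * eR (of_int (a * c1 * qf A v) / of_int (2 * c2)))"
  proof (intro sum.cong refl; clarify)
    fix u v :: "int^'n"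
    have "?t (vmod ?c (c2 *s u + c1 *s v)) = ?t (c2 *s u + c1 *s v)"
      by (rule qsum_term_cong[OF A cpos]) simp
    also have "of_int (a * qf A (c2 *s u + c1 *s v)) / of_int (2 * (c1 * c2))
      = of_int (a * c2 * qf A u) / of_int (2 * c1) + of_int (a * c1 * qf A v) / of_int (2 * c2) + (of_int (a * idot u (A *v v)) :: real)"
      using A c idot_matrix_sym[of A v u] by (simp add: qf_add even_sym_def matrix_smult_vec idot_smult qf_smult power2_eq_square field_simps)
    finally show "?t (vmod ?c (c2 *s u + c1 *s v)) = eR (of_int (a * c2 * qf A u) / of_int (2 * c1)) * eR (of_int (a * c1 * qf A v) / of_int (2 * c2))"
      by (simp only: eR_add eR_of_int mult_1_right)
  qed
  also have "\<dots> = qsum A (a * c2) c1 * qsum A (a * c1) c2"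
    by (simp add: qsum_def sum_product sum.cartesian_product)
  finally show ?thesis .
qed

lemma qf_diagonal:
  assumes "\<And>i k. i \<noteq> k \<Longrightarrow> A $ i $ k = 0"
  shows "qf A v = (\<Sum>i\<in>UNIV. A $ i $ i * (v $ i)\<^sup>2)"
proof -
  have "(A *v v) $ i = A $ i $ i * v $ i" for i
  proof -
    have "(A *v v) $ i = (\<Sum>k\<in>UNIV. if k = i then A $ i $ i * v $ i else 0)"
      by (simp only: matrix_vector_mult_def vec_lambda_beta) (rule sum.cong, use assms in auto)
    then show ?thesis by simp
  qed
  then show ?thesis by (simp add: qf_def idot_def power2_eq_square mult_ac)
qed

lemma qsum_diagonal:
  assumes "\<And>i k. i \<noteq> k \<Longrightarrow> A $ i $ k = 0"
  shows "qsum A a c = (\<Prod>i\<in>UNIV. \<Sum>x\<in>{0..<c}. eR (of_int (a * A $ i $ i * x\<^sup>2) / of_int (2 * c)))"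
proof -
  have "qsum A a c = (\<Sum>v\<in>cube c. \<Prod>i\<in>UNIV. eR (of_int (a * A $ i $ i * (v $ i)\<^sup>2) / of_int (2 * c)))"
    by (simp add: qsum_def qf_diagonal[OF assms] sum_distrib_left sum_divide_distrib eR_sum[symmetric] mult_ac)
  then show ?thesis using sum_vbox_prod[of "\<lambda>i x. eR (of_int (a * A $ i $ i * x\<^sup>2) / of_int (2 * c))" "vec c"] by simp
qed

section \<open>One-dimensional sums and the Kronecker symbol\<close>

text \<open>Average over \<open>k\<close> modulo \<open>s\<close>: orthogonality of characters keeps
  exactly the terms with \<open>s dvd h x\<close>. The hypothesis \<open>twist\<close> arises when a
  shift of the variable multiplies the summand by a character.\<close>

lemma sum_twist_filter:
  fixes F :: "'a \<Rightarrow> complex" and h :: "'a \<Rightarrow> int"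
  assumes s: "s > 0" and fin: "finite S"
    and twist: "\<And>k. (\<Sum>x\<in>S. F x * eR (of_int (h x * k) / of_int s)) = (\<Sum>x\<in>S. F x)"
  shows "(\<Sum>x\<in>S. F x) = (\<Sum>x\<in>{x\<in>S. s dvd h x}. F x)"
proof -
  have "of_int s * (\<Sum>x\<in>S. F x) = (\<Sum>k\<in>{0..<s}. \<Sum>x\<in>S. F x * eR (of_int (h x * k) / of_int s))"
    using s by (simp only: twist) simp
  also have "\<dots> = (\<Sum>x\<in>S. F x * (\<Sum>k\<in>{0..<s}. eR (of_int (h x * k) / of_int s)))"
    by (subst sum.swap) (simp only: sum_distrib_left)
  also have "\<dots> = (\<Sum>x\<in>S. if s dvd h x then of_int s * F x else 0)"
    unfolding sum_additive_character[OF s] by (intro sum.cong) auto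
  also have "\<dots> = of_int s * (\<Sum>x\<in>{x\<in>S. s dvd h x}. F x)"
    unfolding sum.inter_filter[OF fin] sum_distrib_left by (intro sum.cong) auto
  finally show ?thesis using s by simp
qed

lemma sum_residues_multiple:
  fixes f :: "int \<Rightarrow> complex"
  assumes M: "M > 0" and per: "\<And>x y. [x = y] (mod M) \<Longrightarrow> f x = f y" and m: "m > 0"
  shows "(\<Sum>x\<in>{0..<M * m}. f x) = of_int m * (\<Sum>x\<in>{0..<M}. f x)"
proof -
  have *: "(\<Sum>v\<in>vbox (b :: int^1). f (v $ 1)) = (\<Sum>x\<in>{0..<b $ 1}. f x)" for b
    using sum_vbox_prod[of "\<lambda>_. f" b] by (simp add: UNIV_1)
  have "(\<Sum>v\<in>vbox (M *s vec m :: int^1). f (v $ 1))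
      = of_int (\<Prod>i\<in>(UNIV :: 1 set). vec m $ i) * (\<Sum>v\<in>(cube M :: (int^1) set). f (v $ 1))"
    by (rule sum_vbox_multiple[where f = "\<lambda>v :: int^1. f (v $ 1)"]) (use M m in \<open>auto simp: vcong_def intro: per\<close>)
  then show ?thesis by (simp add: * UNIV_1)
qed

section \<open>One-dimensional Gauss sums at odd prime powers\<close>

definition qgauss :: "int \<Rightarrow> int \<Rightarrow> complex" where
  "qgauss t c = (\<Sum>x\<in>{0..<c}. eR (of_int (t * x\<^sup>2) / of_int c))"

lemma even_sym_mat_2: "even_sym (mat 2)"
  by (simp add: even_sym_def mat_def transpose_def vec_eq_iff)

text \<open>Through the form with matrix \<open>(2)\<close>, multiplicativity and conjugation carry
  over from \<open>qsum\<close>.\<close>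

lemma qsum_mat_2: "qsum (mat 2 :: int^1^1) t c = qgauss t c"
proof -
  have "of_int (t * 2 * x\<^sup>2) / of_int (2 * c) = (of_int (t * x\<^sup>2) / of_int c :: real)" for x
    by simp
  then show ?thesis
    by (subst qsum_diagonal) (simp_all only: qgauss_def UNIV_1, simp_all add: mat_def)
qed

lemma qgauss_mult:
  "c1 > 0 \<Longrightarrow> c2 > 0 \<Longrightarrow> coprime c1 c2 \<Longrightarrow> qgauss a (c1 * c2) = qgauss (a * c2) c1 * qgauss (a * c1) c2"
  using qsum_mult[OF even_sym_mat_2[where 'a = 1]] by (simp add: qsum_mat_2)

lemma qgauss_minus: "qgauss (- t) c = cnj (qgauss t c)"
  using qsum_minus[of "mat 2 :: int^1^1"] by (simp add: qsum_mat_2)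

lemma qgauss_1 [simp]: "qgauss t 1 = 1"
proof -
  have "{0..<1} = {0::int}" by auto
  then show ?thesis by (simp add: qgauss_def)
qed

lemma qgauss_term_cong:
  assumes "c > 0" "[x = y] (mod c)"
  shows "eR (of_int (t * x\<^sup>2) / of_int c) = eR (of_int (t * y\<^sup>2) / of_int c)"
  using assms by (intro eR_cong cong_mult cong_pow) auto

lemma qgauss_square:
  assumes "c > 0" "coprime k c"
  shows "qgauss (k\<^sup>2 * t) c = qgauss t c"
proof -
  have "(\<Sum>x\<in>{0..<c}. eR (of_int (t * (k * x)\<^sup>2) / of_int c)) = qgauss t c"
    unfolding qgauss_def
    by (rule sum_residues_reindex[where f = "\<lambda>x. eR (of_int (t * x\<^sup>2) / of_int c)"])
      (use assms qgauss_term_cong in \<open>auto simp: cong_mult_lcancel\<close>)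
  then show ?thesis by (simp add: qgauss_def power_mult_distrib mult_ac)
qed

lemma qgauss_common_factor:
  assumes "d > 0" "c > 0"
  shows "qgauss (d * t) (d * c) = of_int d * qgauss t c"
proof -
  have "qgauss (d * t) (d * c) = (\<Sum>x\<in>{0..<c * d}. eR (of_int (t * x\<^sup>2) / of_int c))"
    using assms by (simp add: qgauss_def mult.commute)
  also have "\<dots> = of_int d * qgauss t c"
    unfolding qgauss_def using assms qgauss_term_cong by (intro sum_residues_multiple) auto
  finally show ?thesis .
qed

lemma sum_multiples:
  fixes F :: "int \<Rightarrow> complex"
  assumes "p > 0"
  shows "(\<Sum>x\<in>{x\<in>{0..<p * L}. p dvd x}. F x) = (\<Sum>y\<in>{0..<L}. F (p * y))"
  by (rule sum.reindex_bij_witness[of _ "\<lambda>y. p * y" "\<lambda>x. x div p"])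
    (use assms in \<open>auto simp: pos_imp_zdiv_nonneg_iff\<close>)

text \<open>A shift by a multiple of \<open>p ^ (k + 1)\<close> multiplies the term at
  \<open>x\<close> by a character of \<open>2 * t * x\<close> modulo \<open>p\<close>, so only
  multiples of \<open>p\<close> survive. On these the modulus drops by \<open>p\<^sup>2\<close>, and
  the range covers \<open>p\<close> periods.\<close>

lemma qgauss_prime_power_rec:
  fixes p t :: int
  assumes p: "prime p" "odd p" and t: "\<not> p dvd t"
  shows "qgauss t (p ^ (k + 2)) = of_int p * qgauss t (p ^ k)"
proof -
  have pos: "p > 0" using p(1) prime_gt_0_int by blast
  let ?q = "p ^ (k + 2)"
  let ?F = "\<lambda>x. eR (of_int (t * x\<^sup>2) / of_int ?q)"
  have q: "?q > 0" using pos by simp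
  have per: "?F x = ?F y" if "[x = y] (mod ?q)" for x y
    using q that by (rule qgauss_term_cong)
  have "qgauss t ?q = (\<Sum>x\<in>{x\<in>{0..<?q}. p dvd 2 * t * x}. ?F x)"
    unfolding qgauss_def
  proof (rule sum_twist_filter[OF pos])
    fix j
    have "?F (p ^ (k + 1) * j + x) = ?F x * eR (of_int (2 * t * x * j) / of_int p)" for x
    proof -
      have "t * (p ^ (k + 1) * j + x)\<^sup>2 = t * x\<^sup>2 + 2 * t * x * j * p ^ (k + 1) + t * j\<^sup>2 * p ^ k * ?q"
        by (simp add: power2_eq_square power_add algebra_simps)
      then have "of_int (t * (p ^ (k + 1) * j + x)\<^sup>2) / of_int ?q
         = of_int (t * x\<^sup>2) / of_int ?q + of_int (2 * t * x * j) / of_int p + (of_int (t * j\<^sup>2 * p ^ k) :: real)"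
        using pos by (simp add: add_divide_distrib power_add)
      then show ?thesis by (simp only: eR_add eR_of_int mult_1_right)
    qed
    then have "(\<Sum>x\<in>{0..<?q}. ?F x * eR (of_int (2 * t * x * j) / of_int p)) = (\<Sum>x\<in>{0..<?q}. ?F (p ^ (k + 1) * j + x))"
      by (simp only:)
    also have "\<dots> = (\<Sum>x\<in>{0..<?q}. ?F x)"
      by (rule sum_residues_reindex[OF q, where f = ?F, OF per]) (simp_all add: cong_add_lcancel)
    finally show "(\<Sum>x\<in>{0..<?q}. ?F x * eR (of_int (2 * t * x * j) / of_int p)) = (\<Sum>x\<in>{0..<?q}. ?F x)" .
  qed simp
  also have "{x\<in>{0..<?q}. p dvd 2 * t * x} = {x\<in>{0..<p * p ^ (k + 1)}. p dvd x}"
    using p t primes_dvd_imp_eq[of p 2] by (auto simp: prime_dvd_mult_iff)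
  also have "(\<Sum>x\<in>\<dots>. ?F x) = (\<Sum>y\<in>{0..<p ^ (k + 1)}. ?F (p * y))"
    using pos by (rule sum_multiples)
  also have "\<dots> = (\<Sum>y\<in>{0..<p ^ k * p}. eR (of_int (t * y\<^sup>2) / of_int (p ^ k)))"
    using pos by (intro sum.cong) (simp_all add: power_mult_distrib power2_eq_square mult_ac)
  also have "\<dots> = of_int p * qgauss t (p ^ k)"
    unfolding qgauss_def using pos qgauss_term_cong[of "p ^ k"] by (intro sum_residues_multiple) auto
  finally show ?thesis .
qed

lemma qgauss_half_system:
  fixes p t :: int
  assumes p: "prime p" "odd p"
  shows "qgauss t p = 1 + 2 * (\<Sum>x\<in>{1..(p-1) div 2}. eR (of_int (t * x\<^sup>2) / of_int p))"
proof -
  let ?f = "\<lambda>x. eR (of_int (t * x\<^sup>2) / of_int p)" and ?h = "(p - 1) div 2"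
  have p1: "p > 1" using p(1) prime_gt_1_int by blast
  have h: "p = 2 * ?h + 1" using p(2) by (auto elim!: oddE)
  have *: "{0..<p} = insert 0 ({1..?h} \<union> {?h+1..<p})" using p1 h by auto
  have "qgauss t p = 1 + (\<Sum>x\<in>{1..?h} \<union> {?h+1..<p}. ?f x)"
    unfolding qgauss_def * using p1 by (subst sum.insert) auto
  also have "(\<Sum>x\<in>{1..?h} \<union> {?h+1..<p}. ?f x) = (\<Sum>x\<in>{1..?h}. ?f x) + (\<Sum>x\<in>{?h+1..<p}. ?f x)"
    by (rule sum.union_disjoint) auto
  also have "(\<Sum>x\<in>{?h+1..<p}. ?f x) = (\<Sum>x\<in>{1..?h}. ?f x)"
  proof (rule sum.reindex_bij_witness[of _ "\<lambda>x. p - x" "\<lambda>x. p - x"])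
    fix x
    have "[p - x = - x] (mod p)" by (simp add: cong_iff_dvd_diff)
    from cong_pow[OF this, of 2] have "[t * (p - x)\<^sup>2 = t * x\<^sup>2] (mod p)"
      by (intro cong_mult) auto
    then show "?f (p - x) = ?f x" using p1 by (intro eR_cong) auto
  qed (use h in auto)
  finally show ?thesis by simp
qed

text \<open>If \<open>u\<close> is a square, it is absorbed by substitution. Otherwise the squares
  and their multiples by \<open>u\<close> together exhaust the nonzero residues, so the sums for
  \<open>t\<close> and \<open>u * t\<close> add up to twice a vanishing character sum.\<close>

lemma qgauss_Legendre:
  fixes p t u :: int
  assumes p: "prime p" "odd p" and t: "\<not> p dvd t" and u: "\<not> p dvd u"
  shows "qgauss (u * t) p = of_int (Legendre u p) * qgauss t p"
proof (cases "QuadRes p u")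
  case True
  have p0: "p > 0" using p(1) prime_gt_0_int by blast
  obtain y where y: "[y\<^sup>2 = u] (mod p)" using True by (auto simp: QuadRes_def)
  then have "\<not> p dvd y" using u cong_dvd_iff[OF y] by (auto simp: power2_eq_square)
  then have cop: "coprime y p" using p(1) by (metis coprime_commute prime_imp_coprime)
  have "qgauss (u * t) p = qgauss (y\<^sup>2 * t) p"
    unfolding qgauss_def using p0 y
    by (intro sum.cong eR_cong cong_mult) (auto simp: cong_sym)
  also have "\<dots> = qgauss t p" using p0 cop by (rule qgauss_square)
  finally show ?thesis using True u by (simp add: Legendre_def cong_0_iff)
next
  case False
  let ?h = "(p - 1) div 2" and ?e = "\<lambda>x. eR (of_int (t * x) / of_int p)"
  have p1: "p > 1" using p(1) prime_gt_1_int by blast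
  have h: "p = 2 * ?h + 1" using p(2) by (auto elim!: oddE)
  have small: "x = y" if "x \<in> {1..?h}" "y \<in> {1..?h}" "p dvd (x - y) * (x + y)" for x y
  proof -
    have "p dvd x - y \<or> p dvd x + y" using p(1) that(3) by (simp add: prime_dvd_mult_iff)
    moreover have "\<not> p dvd x + y" using that h zdvd_not_zless[of "x + y" p] by auto
    ultimately have "p dvd x - y" by blast
    moreover have "\<bar>x - y\<bar> < p" using that h by auto
    ultimately show ?thesis using dvd_imp_le_int[of "x - y" p] by (cases "x = y") auto
  qed
  have diff_sq: "x\<^sup>2 - y\<^sup>2 = (x - y) * (x + y)" for x y :: int
    by (simp add: power2_eq_square algebra_simps)
  let ?A = "(\<lambda>x. x\<^sup>2 mod p) ` {1..?h}" and ?B = "(\<lambda>x. (u * x\<^sup>2) mod p) ` {1..?h}"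
  have injA: "inj_on (\<lambda>x. x\<^sup>2 mod p) {1..?h}"
    using small by (intro inj_onI) (simp add: mod_eq_dvd_iff diff_sq)
  have injB: "inj_on (\<lambda>x. (u * x\<^sup>2) mod p) {1..?h}"
  proof (rule inj_onI)
    fix x y assume x: "x \<in> {1..?h}" "y \<in> {1..?h}" and "(u * x\<^sup>2) mod p = (u * y\<^sup>2) mod p"
    then have "p dvd u * ((x - y) * (x + y))"
      by (simp add: mod_eq_dvd_iff right_diff_distrib[symmetric] diff_sq)
    then show "x = y" using u p(1) small x by (simp add: prime_dvd_mult_iff[of p u])
  qed
  have nd: "\<not> p dvd x" if "x \<in> {1..?h}" for x
    using that h zdvd_not_zless[of x p] by auto
  have disj: "?A \<inter> ?B = {}"
  proof (rule ccontr)
    assume "?A \<inter> ?B \<noteq> {}"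
    then obtain z where "z \<in> ?A" "z \<in> ?B" by blast
    then obtain x y where "x \<in> {1..?h}" "y \<in> {1..?h}" "z = x\<^sup>2 mod p" "z = (u * y\<^sup>2) mod p" by blast
    then have xy: "x \<in> {1..?h}" "y \<in> {1..?h}" "x\<^sup>2 mod p = (u * y\<^sup>2) mod p" by simp_all
    have "coprime y p" using nd[OF xy(2)] p(1) by (metis coprime_commute prime_imp_coprime)
    then obtain z where z: "[y * z = 1] (mod p)" using cong_solve_coprime_int by blast
    \<comment> \<open>As \<open>z\<close> is inverse to \<open>y\<close>, a common value would
      exhibit \<open>u\<close> as the square of \<open>x * z\<close>.\<close>
    have "[(x * z)\<^sup>2 = u * (y * z)\<^sup>2] (mod p)"
    proof -
      have "[x\<^sup>2 * z\<^sup>2 = u * y\<^sup>2 * z\<^sup>2] (mod p)"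
        using xy(3) by (intro cong_mult) (auto simp: cong_def)
      then show ?thesis by (simp add: power_mult_distrib mult_ac)
    qed
    moreover have "[u * (y * z)\<^sup>2 = u * 1\<^sup>2] (mod p)" using z by (intro cong_mult cong_pow) auto
    ultimately have "[(x * z)\<^sup>2 = u] (mod p)" by (auto intro: cong_trans)
    then show False using False by (auto simp: QuadRes_def)
  qed
  have "?A \<union> ?B = {1..<p}"
  proof (rule card_subset_eq)
    have "y \<in> {1..<p}" if "\<not> p dvd w" "y = w mod p" for w y
    proof -
      have "w mod p \<noteq> 0" using that by (simp add: dvd_eq_mod_eq_0)
      moreover have "0 \<le> w mod p" "w mod p < p" using p1 by auto
      ultimately show ?thesis using that(2) by auto
    qed
    moreover have "\<not> p dvd x\<^sup>2" "\<not> p dvd u * x\<^sup>2" if "x \<in> {1..?h}" for x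
      using nd[OF that] u p(1) by (simp_all add: prime_dvd_mult_iff prime_dvd_power_iff)
    ultimately show "?A \<union> ?B \<subseteq> {1..<p}" by blast
    have "card (?A \<union> ?B) = nat ?h + nat ?h"
      using disj injA injB by (simp add: card_Un_disjoint card_image)
    also have "\<dots> = card {1..<p}" using h p1 by simp
    finally show "card (?A \<union> ?B) = card {1..<p}" .
  qed simp
  then have "(\<Sum>x\<in>{1..<p}. ?e x) = (\<Sum>x\<in>?A. ?e x) + (\<Sum>x\<in>?B. ?e x)"
    using disj by (metis finite_imageI finite_atLeastAtMost_int sum.union_disjoint)
  also have "(\<Sum>x\<in>?A. ?e x) = (\<Sum>x\<in>{1..?h}. eR (of_int (t * x\<^sup>2) / of_int p))"
    unfolding sum.reindex[OF injA] o_def using p1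
    by (intro sum.cong refl eR_cong cong_mult) (auto simp: cong_def)
  also have "(\<Sum>x\<in>?B. ?e x) = (\<Sum>x\<in>{1..?h}. eR (of_int (u * t * x\<^sup>2) / of_int p))"
    unfolding sum.reindex[OF injB] o_def
  proof (intro sum.cong refl eR_cong)
    fix x
    have "[t * (u * x\<^sup>2 mod p) = t * (u * x\<^sup>2)] (mod p)" by (intro cong_mult) (auto simp: cong_def)
    then show "[t * (u * x\<^sup>2 mod p) = u * t * x\<^sup>2] (mod p)" by (simp add: mult_ac)
  qed (use p1 in simp)
  finally have *: "(\<Sum>x\<in>{1..<p}. ?e x) = (\<Sum>x\<in>{1..?h}. eR (of_int (t * x\<^sup>2) / of_int p))
      + (\<Sum>x\<in>{1..?h}. eR (of_int (u * t * x\<^sup>2) / of_int p))" .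
  have "(\<Sum>x\<in>{0..<p}. ?e x) = 0"
    using sum_additive_character[of p t] t p1 by simp
  moreover have "{0..<p} = insert 0 {1..<p}" using p1 by auto
  ultimately have "1 + (\<Sum>x\<in>{1..<p}. ?e x) = 0" by simp
  moreover have "(1 + 2 * a) + (1 + 2 * b) = 2 * (1 + (a + b))" for a b :: complex
    by (simp add: algebra_simps)
  ultimately have "qgauss t p + qgauss (u * t) p = 0"
    unfolding qgauss_half_system[OF p] * by (simp only: mult_zero_right)
  then show ?thesis using False u by (simp add: Legendre_def cong_0_iff add_eq_0_iff)
qed

lemma Legendre_square: "\<not> p dvd u \<Longrightarrow> Legendre u p * Legendre u p = 1"
  by (simp add: Legendre_def cong_0_iff)

text \<open>The recursion lowers the exponent by 2, which does not change the power of a Legendre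
  symbol that is 1 or -1.\<close>

lemma qgauss_prime_power:
  fixes p t u :: int
  assumes p: "prime p" "odd p" and t: "\<not> p dvd t" and u: "\<not> p dvd u"
  shows "qgauss (u * t) (p ^ k) = of_int (Legendre u p) ^ k * qgauss t (p ^ k)"
proof (induction k rule: induct_nat_012)
  case 1
  show ?case using qgauss_Legendre[OF assms] by simp
next
  case (ge2 k)
  have ut: "\<not> p dvd u * t" using p t u by (simp add: prime_dvd_mult_iff)
  have "of_int (Legendre u p) * of_int (Legendre u p) = (1 :: complex)"
    using Legendre_square[OF u] by (metis of_int_1 of_int_mult)
  then have "of_int (Legendre u p) ^ Suc (Suc k) = (of_int (Legendre u p) ^ k :: complex)"
    by (simp add: mult.assoc[symmetric])
  then show ?case
    using ge2(1) qgauss_prime_power_rec[OF p ut, of k] qgauss_prime_power_rec[OF p t, of k]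
    by (simp only: add_2_eq_Suc' mult_ac)
qed simp

text \<open>Removing the full power of \<open>p\<close> at once leaves a coprime cofactor, as
  multiplicativity of Gauss sums requires.\<close>

lemma prime_power_induct_int [consumes 1, case_names 1 prime_power]:
  fixes c :: int
  assumes "c > 0" and "P 1"
    and step: "\<And>p k m. prime p \<Longrightarrow> k > 0 \<Longrightarrow> m > 0 \<Longrightarrow> \<not> p dvd m \<Longrightarrow> P m \<Longrightarrow> P (p ^ k * m)"
  shows "P c"
  using assms(1)
proof (induction "nat c" arbitrary: c rule: less_induct)
  case less
  show ?case
  proof (cases "c = 1")
    case False
    then obtain p where p: "prime p" "p dvd c" using prime_divisor_exists[of c] less.prems by auto
    have p1: "p > 1" using p(1) prime_gt_1_int by blast
    define k where "k = multiplicity p c"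
    obtain m where m: "c = p ^ k * m" "\<not> p dvd m"
      using multiplicity_decompose'[of c p] less.prems p1 unfolding k_def by auto
    have k: "k > 0" using p less.prems p1 by (simp add: k_def multiplicity_gt_zero_iff)
    have pk: "p ^ k > 1" using p1 k by simp
    have m0: "m > 0" using less.prems pk unfolding m(1) by (intro zero_less_mult_pos[of "p ^ k" m]) auto
    have "m < c" using m(1) mult_strict_right_mono[OF pk m0] by simp
    then have "P m" using less.hyps[of m] m0 by simp
    then show ?thesis unfolding m(1) using step p(1) k m0 m(2) by blast
  qed (simp add: assms)
qed

section \<open>The Kronecker symbol as a twist of Gauss sums\<close>

lemma kronecker_1 [simp]: "kronecker m 1 = 1"
  by (simp add: kronecker_def)

lemma kronecker_mult:
  "a > 0 \<Longrightarrow> b > 0 \<Longrightarrow> kronecker m (a * b) = kronecker m a * kronecker m b"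
  by (simp add: kronecker_def prime_factorization_mult mult_less_0_iff)

lemma kronecker_prime_power:
  assumes "prime p"
  shows "kronecker m (p ^ k) = kronecker_prime m p ^ k"
proof -
  have "p > 0" using assms prime_gt_0_int by blast
  then show ?thesis
    using assms by (simp add: kronecker_def prime_factorization_prime_power not_less zero_le_power less_imp_le)
qed

lemma kronecker_odd_prime_power:
  assumes "prime p" "odd p"
  shows "kronecker m (p ^ k) = Legendre m p ^ k"
  using assms by (auto simp: kronecker_prime_power kronecker_prime_def)

lemma coprime_prime_power: "prime p \<Longrightarrow> \<not> p dvd m \<Longrightarrow> coprime (p ^ k) m" for p m :: int
  by (metis coprime_power_left_iff prime_imp_coprime)

text \<open>The multiplier \<open>t\<close> is arbitrary because splitting the modulus multiplies it
  by the cofactor.\<close>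

lemma qgauss_twist:
  fixes c t u :: int
  assumes "c > 0" "odd c" "coprime t c" "coprime u c"
  shows "qgauss (u * t) c = of_int (kronecker u c) * qgauss t c"
  using assms
proof (induction arbitrary: t rule: prime_power_induct_int)
  case (prime_power p k m)
  have p0: "p > 0" using prime_power.hyps(1) prime_gt_0_int by blast
  have odd: "odd p" "odd m" using prime_power by auto
  have cop: "coprime (p ^ k) m" using prime_power by (intro coprime_prime_power)
  have 1: "\<not> p dvd t * m" "\<not> p dvd u"
    using prime_power by (auto simp: prime_dvd_mult_iff dest: coprime_common_divisor[of _ _ p])
  have 2: "coprime (t * p ^ k) m" "coprime u m" using prime_power.prems cop by auto
  have "qgauss (u * t) (p ^ k * m) = qgauss (u * (t * m)) (p ^ k) * qgauss (u * (t * p ^ k)) m"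
    using cop p0 prime_power.hyps by (simp add: qgauss_mult mult.assoc)
  also have "\<dots> = of_int (Legendre u p) ^ k * qgauss (t * m) (p ^ k) * (of_int (kronecker u m) * qgauss (t * p ^ k) m)"
    using prime_power.IH[OF odd(2) 2] qgauss_prime_power[OF prime_power.hyps(1) odd(1) 1] by simp
  also have "\<dots> = of_int (kronecker u (p ^ k * m)) * qgauss t (p ^ k * m)"
    using cop p0 prime_power.hyps odd
    by (simp add: qgauss_mult kronecker_mult kronecker_odd_prime_power)
  finally show ?case .
qed simp

section \<open>Phases at odd moduli and the symbol at 2\<close>

lemma qgauss_4:
  assumes "odd c"
  shows "qgauss c 4 = 2 + 2 * eR (of_int c / 4)"
proof -
  have *: "{0..<4} = {0, 1, 2, 3 :: int}" by auto
  have "eR (of_int (c * 3\<^sup>2) / of_int 4) = eR (of_int (c * 1) / of_int 4)"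
    by (intro eR_cong cong_mult) (auto simp: cong_def)
  moreover have "eR (of_int (c * 2\<^sup>2) / of_int 4) = 1" by simp
  ultimately show ?thesis by (simp add: qgauss_def *)
qed

lemma qgauss_8:
  assumes "odd c"
  shows "qgauss c 8 = 4 * eR (of_int c / 8)"
proof -
  have *: "{0..<8} = {0, 1, 2, 3, 4, 5, 6, 7 :: int}" by auto
  have 1: "eR (of_int (c * x\<^sup>2) / of_int 8) = eR (of_int (c * 1) / of_int 8)" if "x mod 8 \<in> {1, 3, 5, 7}" for x
    using that by (intro eR_cong cong_mult) (auto simp: cong_def power2_eq_square mod_mult_eq[of x 8 x, symmetric])
  have 4: "eR (of_int (c * x\<^sup>2) / of_int 8) = -1" if "x mod 8 \<in> {2, 6}" for x
  proof -
    have "[c * x\<^sup>2 = 4] (mod 8)"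
      using that assms by (auto simp: cong_def power2_eq_square mod_mult_eq[of c 8, symmetric] mod_mult_eq[of x 8 x, symmetric] elim!: oddE)
        (presburger)+
    then have "eR (of_int (c * x\<^sup>2) / of_int 8) = eR (of_int 4 / of_int 8)" by (intro eR_cong) auto
    then show ?thesis by simp
  qed
  have 0: "eR (of_int (c * 4\<^sup>2) / of_int 8) = 1"
    using eR_of_int[of "2 * c"] by simp
  show ?thesis unfolding qgauss_def *
    using 1[of 1] 1[of 3] 1[of 5] 1[of 7] 4[of 2] 4[of 6] 0 by simp
qed

lemma qgauss_even_modulus:
  fixes m :: int
  assumes m: "m > 0"
  shows "qgauss 1 (4 * m) = 2 * of_real (sqrt (of_int (2 * m))) * eR (1/8)"
proof -
  have "qgauss 1 (4 * m) = (\<Sum>x\<in>{0..<2 * m * 2}. eR (of_int (x\<^sup>2) / of_int (4 * m)))"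
    by (simp add: qgauss_def)
  also have "\<dots> = of_int 2 * (\<Sum>x\<in>{0..<2 * m}. eR (of_int (x\<^sup>2) / of_int (4 * m)))"
  proof (rule sum_residues_multiple)
    fix x y assume "[x = y] (mod (2 * m))"
    then obtain k where "y = x + 2 * m * k" by (auto simp: cong_iff_lin)
    then have "y\<^sup>2 = x\<^sup>2 + 4 * m * (x * k + m * k\<^sup>2)" by (simp add: power2_eq_square algebra_simps)
    then show "eR (of_int (x\<^sup>2) / of_int (4 * m)) = eR (of_int (y\<^sup>2) / of_int (4 * m))"
      using m by (intro eR_cong) (auto simp: cong_iff_lin)
  qed (use m in auto)
  finally show ?thesis using gauss_sum_even[OF m] by simp
qed

text \<open>Split the modulus \<open>8 * c\<close>: the full sum is known, the part modulo 8 is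
  computed directly, and \<open>8 = 2\<^sup>2 * 2\<close> leaves the multiplier 2 modulo
  \<open>c\<close>. This gives one formula for all odd \<open>c\<close>, without cases modulo
  4.\<close>

lemma qgauss_2_odd:
  assumes c: "c > 0" "odd c"
  shows "qgauss 2 c = of_real (sqrt (of_int c)) * eR (of_int (1 - c) / 8)"
proof -
  have "qgauss 1 (4 * (2 * c)) = qgauss c 8 * qgauss 8 c"
    using c qgauss_mult[of 8 c 1] coprime_power_left_iff[of 2 3 c] by simp
  moreover have "qgauss 8 c = qgauss 2 c" using qgauss_square[of c 2 2] c by simp
  moreover have "sqrt (of_int (2 * (2 * c))) = 2 * sqrt (of_int c)"
    by (simp add: real_sqrt_mult)
  then have "qgauss 1 (4 * (2 * c)) = 4 * (of_real (sqrt (of_int c)) * eR (1/8))"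
    using qgauss_even_modulus[of "2 * c"] c by simp
  ultimately have "4 * (of_real (sqrt (of_int c)) * eR (1/8)) = 4 * (eR (of_int c / 8) * qgauss 2 c)"
    by (simp only: qgauss_8[OF c(2)] mult.assoc)
  then have "of_real (sqrt (of_int c)) * eR (1/8) = eR (of_int c / 8) * qgauss 2 c"
    by (simp only: mult_cancel_left) simp
  moreover have "eR (of_int (1 - c) / 8) * eR (of_int c / 8) = eR (1/8)"
    by (simp add: eR_add[symmetric] add_divide_distrib[symmetric])
  ultimately have "eR (of_int c / 8) * (of_real (sqrt (of_int c)) * eR (of_int (1 - c) / 8)) = eR (of_int c / 8) * qgauss 2 c"
    by (simp only: mult_ac)
  then show ?thesis by (simp only: mult_cancel_left eR_neq_0) simp
qed

text \<open>The same comparison at the modulus \<open>4 * c\<close>. The factor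
  \<open>1 + e(c/4)\<close> depends on \<open>c\<close> modulo 4 and stays on the left; the identity
  shows in particular that the sum does not vanish.\<close>

lemma qgauss_1_odd:
  assumes c: "c > 0" "odd c"
  shows "(1 + eR (of_int c / 4)) * qgauss 1 c = of_real (sqrt (of_int (2 * c))) * eR (1/8)"
proof -
  have "qgauss 1 (4 * c) = qgauss c 4 * qgauss 4 c"
    using c qgauss_mult[of 4 c 1] coprime_power_left_iff[of 2 2 c] by simp
  moreover have "qgauss 4 c = qgauss 1 c" using qgauss_square[of c 2 1] c by simp
  ultimately have "2 * of_real (sqrt (of_int (2 * c))) * eR (1/8) = (2 + 2 * eR (of_int c / 4)) * qgauss 1 c"
    using c by (simp add: qgauss_even_modulus qgauss_4)
  then have "2 * ((1 + eR (of_int c / 4)) * qgauss 1 c) = 2 * (of_real (sqrt (of_int (2 * c))) * eR (1/8))"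
    by (simp add: algebra_simps)
  then show ?thesis by (simp only: mult_cancel_left) simp
qed

lemma eR_eighth: "of_real (sqrt 2) * eR (1/8) = 1 + \<i>"
proof -
  have "sqrt 2 * (sqrt 2 / 2) = (1::real)" by simp
  then show ?thesis
    by (simp add: eR_def complex_eq_iff cos_45 sin_45)
qed

text \<open>The symbol \<open>(2/c)\<close> is the quotient of the sums with multipliers 2 and 1.
  Comparing their two evaluations for \<open>c\<close> modulo 8 yields the second supplementary
  law.\<close>

lemma kronecker_2_odd:
  assumes c: "c > 0" "odd c"
  shows "kronecker 2 c = kronecker c 2"
proof -
  let ?E = "eR (of_int c / 4)" and ?k = "of_int (kronecker 2 c) :: complex"
  have twist: "qgauss 2 c = ?k * qgauss 1 c"
    using qgauss_twist[of c 1 2] c by simp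
  have "(1 + ?E) * (of_real (sqrt (of_int c)) * eR (of_int (1 - c) / 8)) = ?k * ((1 + ?E) * qgauss 1 c)"
    using twist qgauss_2_odd[OF c] by (simp add: mult_ac)
  also have "\<dots> = ?k * (of_real (sqrt (of_int c)) * (of_real (sqrt 2) * eR (1/8)))"
    unfolding qgauss_1_odd[OF c] by (simp add: real_sqrt_mult)
  finally have *: "(1 + ?E) * eR (of_int (1 - c) / 8) = ?k * (1 + \<i>)"
    using c by (simp only: eR_eighth) simp
  have "c\<^sup>2 \<ge> 1" using c by (simp add: one_le_power)
  then have k2: "kronecker c 2 = (if even ((c\<^sup>2 - 1) div 8) then 1 else -1)"
    using kronecker_prime_power[of 2 c 1] c
    by (simp add: kronecker_prime_def minus_one_power_iff even_nat_iff pos_imp_zdiv_nonneg_iff)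
  define j where "j = c div 8"
  have j: "c = 8 * j + c mod 8" by (simp add: j_def)
  have j0: "j \<ge> 0" using c by (simp add: j_def)
  have m8: "c mod 8 = 1 \<or> c mod 8 = 3 \<or> c mod 8 = 5 \<or> c mod 8 = 7" using c by presburger
  have E: "?E = eR (of_int (c mod 8) / 4)"
    using eR_cong[of c "c mod 8" 4] by (simp add: cong_def mod_mod_cancel)
  have E8: "eR (of_int (1 - c) / 8) = eR (of_int (1 - c mod 8) / 8)"
    using eR_cong[of "1 - c" "1 - c mod 8" 8] by (simp add: cong_def mod_diff_right_eq)
  have e3: "eR (3/4) = - \<i>" "eR (5/4) = \<i>" "eR (7/4) = - \<i>" "eR (- (1/4)) = - \<i>" "eR (- (1/2)) = -1" "eR (- (3/4)) = \<i>"
    using eR_add[of "1/2" "1/4"] eR_add[of "1" "1/4"] eR_add[of "1" "3/4"] eR_minus[of "1/4"] eR_minus[of "1/2"] eR_minus[of "3/4"]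
      eR_of_int[of 1] by simp_all
  \<comment> \<open>Only the parity matters, and the first two summands are even, so the symbol
    depends on \<open>c\<close> modulo 8.\<close>
  have sq: "(c\<^sup>2 - 1) div 8 = 8 * j\<^sup>2 + 2 * j * (c mod 8) + ((c mod 8)\<^sup>2 - 1) div 8" if "((c mod 8)\<^sup>2 - 1) mod 8 = 0"
  proof -
    have "c\<^sup>2 - 1 = 8 * (8 * j\<^sup>2 + 2 * j * (c mod 8) + ((c mod 8)\<^sup>2 - 1) div 8)"
      using that by (subst j) (simp add: power2_eq_square algebra_simps, presburger)
    then show ?thesis by simp
  qed
  have **: "(1 + eR (of_int (c mod 8) / 4)) * eR (of_int (1 - c mod 8) / 8) = ?k * (1 + \<i>)"
    using * by (simp only: E E8)
  consider "c mod 8 = 1" | "c mod 8 = 3" | "c mod 8 = 5" | "c mod 8 = 7" using m8 by blast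
  then have "?k = of_int (kronecker c 2)"
  proof cases
  qed (use ** in \<open>auto simp: k2 sq e3 complex_eq_iff\<close>)
  then show ?thesis by simp
qed

section \<open>Diagonalization at an odd prime\<close>

text \<open>As a change of basis: \<open>b $ k\<close> times the basis vector \<open>j\<close> is
  added to the basis vector \<open>k\<close>, for all \<open>k\<close> at once.\<close>

definition shear_mat :: "'n \<Rightarrow> int^'n \<Rightarrow> int^'n^'n" where
  "shear_mat j b = (\<chi> i k. (if i = k then 1 else 0) + (if i = j then b $ k else 0))"

definition scale_mat :: "'n \<Rightarrow> int \<Rightarrow> int^'n^'n" where
  "scale_mat j s = (\<chi> i k. if i = k then (if i = j then 1 else s) else 0)"

text \<open>The complement of \<open>scale_mat\<close>: their product is \<open>s\<close> times the
  identity, so each inverts the other away from \<open>s\<close>.\<close>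

definition coscale_mat :: "'n \<Rightarrow> int \<Rightarrow> int^'n^'n" where
  "coscale_mat j s = (\<chi> i k. if i = k then (if i = j then s else 1) else 0)"

lemma shear_mult_vec: "shear_mat j b *v x = x + idot b x *s axis j 1"
proof -
  have "(\<Sum>k\<in>UNIV. ((if i = k then 1 else 0) + (if i = j then b $ k else 0)) * x $ k)
      = x $ i + (if i = j then idot b x else 0)" for i
    by (simp add: distrib_right sum.distrib idot_def if_distrib[of "\<lambda>y. y * _"] cong: if_cong)
  then show ?thesis by (simp add: vec_eq_iff matrix_vector_mult_def shear_mat_def axis_def)
qed

lemma scale_mult_vec: "scale_mat j s *v x = (\<chi> i. (if i = j then 1 else s) * x $ i)"
  by (simp add: vec_eq_iff matrix_vector_mult_def scale_mat_def if_distrib[of "\<lambda>y. y * _"] cong: if_cong)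

lemma coscale_mult_vec: "coscale_mat j s *v x = (\<chi> i. (if i = j then s else 1) * x $ i)"
  by (simp add: vec_eq_iff matrix_vector_mult_def coscale_mat_def if_distrib[of "\<lambda>y. y * _"] cong: if_cong)

lemma idot_axis: "idot b (axis j 1) = b $ j" "idot (axis j 1) b = b $ j"
  by (simp_all add: idot_def axis_def if_distrib[of "\<lambda>y. y * _"] if_distrib[of "\<lambda>y. _ * y"] cong: if_cong)

lemma shear_inverse:
  assumes "b $ j = 0"
  shows "shear_mat j b ** shear_mat j (- b) = mat 1"
proof -
  have "idot (- b) x = - idot b x" for x by (simp add: idot_def sum_negf)
  then show ?thesis using assms
    by (simp add: matrix_eq matrix_vector_mul_assoc[symmetric] shear_mult_vec matrix_mat_mult_vec idot_add idot_smult idot_axis vec_eq_iff)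
qed

lemma shear_inverse':
  assumes "b $ j = 0"
  shows "shear_mat j (- b) ** shear_mat j b = mat 1"
  using shear_inverse[of "- b" j] assms by simp

lemma scale_coscale: "scale_mat j s ** coscale_mat j s = mat s" "coscale_mat j s ** scale_mat j s = mat s"
  by (auto simp: matrix_eq matrix_vector_mul_assoc[symmetric] scale_mult_vec coscale_mult_vec matrix_mat_mult_vec vec_eq_iff)

lemma matrix_mult_axis: "A *v axis k 1 = column k A" for A :: "int^'n^'m"
  by (simp add: vec_eq_iff matrix_vector_mult_def column_def axis_def if_distrib[of "\<lambda>y. _ * y"] cong: if_cong)

lemma congruence_nth: "(transpose P ** A ** P) $ i $ k = idot (column i P) (A *v column k P)"
proof -
  have "(transpose P ** A ** P) $ i $ k = idot (axis i 1) ((transpose P ** A ** P) *v axis k 1)"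
    by (simp add: idot_axis matrix_mult_axis column_def)
  also have "\<dots> = idot (P *v axis i 1) (A *v (P *v axis k 1))"
    by (simp only: matrix_vector_mul_assoc[symmetric] idot_matrix[of _ "transpose P"] transpose_transpose)
  finally show ?thesis by (simp add: matrix_mult_axis)
qed

lemma column_shear: "column k (shear_mat j b) = axis k 1 + b $ k *s axis j 1"
  by (simp add: vec_eq_iff column_def shear_mat_def axis_def)

lemma column_scale: "column k (scale_mat j s) = (if k = j then 1 else s) *s axis k 1"
  by (simp add: vec_eq_iff column_def scale_mat_def axis_def)

lemma idot_axis_matrix: "idot (axis i 1) (A *v axis k 1) = A $ i $ k"
  by (simp add: idot_axis matrix_mult_axis column_def)

lemma shear_congruence_nth:
  "(transpose (shear_mat j b) ** A ** shear_mat j b) $ i $ k =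
     A $ i $ k + b $ k * A $ i $ j + b $ i * A $ j $ k + b $ i * b $ k * A $ j $ j"
  by (simp add: congruence_nth column_shear matrix_vector_right_distrib matrix_smult_vec idot_add idot_smult idot_axis_matrix algebra_simps)

lemma scale_congruence_nth:
  "(transpose (scale_mat j s) ** A ** scale_mat j s) $ i $ k =
     (if i = j then 1 else s) * (if k = j then 1 else s) * A $ i $ k"
  by (simp add: congruence_nth column_scale matrix_smult_vec idot_smult idot_axis_matrix)

text \<open>
  Pivot on an entry of minimal \<open>p\<close>-adic valuation; as \<open>p\<close> is odd, a minimal entry off the diagonal
  can be moved to the diagonal by adding one basis vector to another.
\<close>

lemma even_sym_diagonalization_induct [consumes 3, case_names diagonal shear scale]:
  fixes A :: "int^'n^'n" and p :: int
  assumes p: "prime p" "odd p" and "even_sym A"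
    and diag: "\<And>A. even_sym A \<Longrightarrow> (\<And>i k. i \<noteq> k \<Longrightarrow> A $ i $ k = 0) \<Longrightarrow> P A"
    and shear: "\<And>A j b. even_sym A \<Longrightarrow> b $ j = 0 \<Longrightarrow> P (transpose (shear_mat j b) ** A ** shear_mat j b) \<Longrightarrow> P A"
    and scale: "\<And>A j s. even_sym A \<Longrightarrow> s > 0 \<Longrightarrow> \<not> p dvd s \<Longrightarrow> P (transpose (scale_mat j s) ** A ** scale_mat j s) \<Longrightarrow> P A"
  shows "P A"
proof -
  \<comment> \<open>The coordinates not yet split off orthogonally; their number decreases in the
    induction.\<close>
  define J where "J A = {i. \<exists>k. k \<noteq> i \<and> A $ i $ k \<noteq> 0}" for A :: "int^'n^'n"
  have J0: "A $ i $ k = 0" if "i \<notin> J A" "k \<noteq> i" for A i k using that by (auto simp: J_def)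
  have J0': "A $ k $ i = 0" if "even_sym A" "i \<notin> J A" "k \<noteq> i" for A i k
    using J0[of i A k] even_sym_nth[of A i k] that by simp
  show ?thesis using assms(3)
  proof (induction "card (J A)" arbitrary: A rule: less_induct)
    case less
    note A = less.prems
    have pivot: "P B" if B: "even_sym B" and card: "card (J B) \<le> card (J A)" and j: "j \<in> J B"
      and col: "\<And>l. p ^ e dvd B $ l $ j" and piv: "\<not> p ^ Suc e dvd B $ j $ j" for B j e
    proof -
      obtain u where u: "B $ j $ j = p ^ e * u" using col by (metis dvdE)
      have pu: "\<not> p dvd u" using piv by (auto simp: u mult.commute)
      \<comment> \<open>Clearing column \<open>j\<close> with the pivot \<open>p ^ e * u\<close>
        would require division by \<open>u\<close>. So the other coordinates are first stretched by
        \<open>\<bar>u\<bar>\<close>, which is prime to \<open>p\<close>, and \<open>b\<close> then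
        has integral entries.\<close>
      define b where "b = (\<chi> i. if i = j then 0 else - sgn u * (B $ i $ j div p ^ e))"
      have sgn_u: "\<bar>u\<bar> = sgn u * u" by (simp add: abs_sgn)
      let ?B1 = "transpose (scale_mat j \<bar>u\<bar>) ** B ** scale_mat j \<bar>u\<bar>"
      let ?B2 = "transpose (shear_mat j b) ** ?B1 ** shear_mat j b"
      have B1: "even_sym ?B1" and B2: "even_sym ?B2" using B by (auto intro: even_sym_congruence)
      have bk: "b $ k * p ^ e = - sgn u * B $ k $ j" if "k \<noteq> j" for k
        using that col[of k] by (simp add: b_def)
      have nj: "j \<notin> J ?B2"
      proof -
        have "?B2 $ j $ k = 0" if "k \<noteq> j" for k
        proof -
          have "?B2 $ j $ k = \<bar>u\<bar> * B $ k $ j + (b $ k * p ^ e) * u"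
            using that even_sym_nth[OF B, of j k]
            by (simp add: shear_congruence_nth scale_congruence_nth u b_def)
          then show ?thesis by (simp add: bk[OF that] sgn_u)
        qed
        then show ?thesis by (auto simp: J_def)
      qed
      have "J ?B2 \<subseteq> J B"
      proof (rule ccontr)
        assume "\<not> J ?B2 \<subseteq> J B"
        then obtain i k where i: "i \<notin> J B" "k \<noteq> i" "?B2 $ i $ k \<noteq> 0" by (auto simp: J_def)
        have "i \<noteq> j" using i j by auto
        then have "B $ i $ j = 0" "B $ i $ k = 0" "b $ i = 0"
          using J0[OF i(1)] i(2) by (auto simp: b_def)
        then show False using i(3) by (simp add: shear_congruence_nth scale_congruence_nth)
      qed
      then have "J ?B2 \<subset> J B" using nj j by auto
      then have "card (J ?B2) < card (J A)" using card psubset_card_mono[of "J B" "J ?B2"] by simp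
      then have "P ?B2" using less.hyps B2 by blast
      then have "P ?B1" using shear[OF B1, of b j] by (simp add: b_def)
      moreover have "\<bar>u\<bar> > 0" "\<not> p dvd \<bar>u\<bar>" using pu by auto
      ultimately show "P B" using scale[OF B] by blast
    qed
    show "P A"
    proof (cases "J A = {}")
      case True
      then show ?thesis using diag[OF A] J0[of _ A] by auto
    next
      case False
      then obtain i0 k0 where ik0: "i0 \<in> J A" "k0 \<noteq> i0" "A $ i0 $ k0 \<noteq> 0" by (auto simp: J_def)
      have k0: "k0 \<in> J A" using ik0 even_sym_nth[OF A, of i0 k0] by (auto simp: J_def)
      define Q where "Q e \<longleftrightarrow> (\<exists>i\<in>J A. \<exists>k\<in>J A. \<not> p ^ Suc e dvd A $ i $ k)" for e
      have "\<not> p ^ Suc (multiplicity p (A $ i0 $ k0)) dvd A $ i0 $ k0"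
        using ik0(3) p(1) by (subst power_dvd_iff_le_multiplicity) auto
      then have "Q (multiplicity p (A $ i0 $ k0))" using ik0 k0 by (auto simp: Q_def)
      define e where "e = (LEAST e. Q e)"
      have Qe: "Q e" unfolding e_def using \<open>Q _\<close> by (rule LeastI)
      have div: "p ^ e dvd A $ i $ k" if "i \<in> J A" "k \<in> J A" for i k
      proof (cases e)
        case (Suc e')
        then have "\<not> Q e'" using not_less_Least[of e' Q] by (simp add: e_def)
        then show ?thesis using that Suc by (auto simp: Q_def)
      qed simp
      have div': "p ^ e dvd A $ l $ k" if "k \<in> J A" for l k
        using div[of l k] J0[of l A k] that by (cases "l \<in> J A"; cases "k = l") auto
      obtain i k where ik: "i \<in> J A" "k \<in> J A" "\<not> p ^ Suc e dvd A $ i $ k" using Qe by (auto simp: Q_def)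
      show ?thesis
      proof (cases "\<exists>j\<in>J A. \<not> p ^ Suc e dvd A $ j $ j")
        case True
        then show ?thesis using pivot[OF A] div' by blast
      next
        case False
        then have ne: "i \<noteq> k" and dd: "p ^ Suc e dvd A $ i $ i" "p ^ Suc e dvd A $ k $ k" using ik by auto
        \<comment> \<open>Adding basis vector \<open>k\<close> to basis vector \<open>i\<close>
          produces the diagonal entry \<open>A $ i $ i + A $ k $ k + 2 * A $ i $ k\<close>. Its
          outer terms have larger valuation and 2 is a unit at \<open>p\<close>, so its valuation is
          exactly \<open>e\<close>.\<close>
        let ?b = "axis i 1 :: int^'n"
        let ?B = "transpose (shear_mat k ?b) ** A ** shear_mat k ?b"
        have bk: "?b $ k = 0" using ne by (simp add: axis_def)
        have B: "even_sym ?B" using A by (rule even_sym_congruence)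
        have JB: "J ?B \<subseteq> J A"
        proof (rule ccontr)
          assume "\<not> J ?B \<subseteq> J A"
          then obtain l m where l: "l \<notin> J A" "m \<noteq> l" "?B $ l $ m \<noteq> 0" by (auto simp: J_def)
          have "l \<noteq> i" "l \<noteq> k" using l ik by auto
          then have "A $ l $ k = 0" "A $ l $ m = 0" "?b $ l = 0"
            using J0[OF l(1)] l(2) by (auto simp: axis_def)
          then show False using l(3) by (simp add: shear_congruence_nth)
        qed
        have "P ?B"
        \<comment> \<open>If the new basis vector is already orthogonal to the others,
          \<open>J\<close> has shrunk and no pivoting is called for.\<close>
        proof (cases "i \<in> J ?B")
          case True
          show ?thesis
          proof (rule pivot[OF B _ True])
            show "card (J ?B) \<le> card (J A)" using JB by (intro card_mono) auto
            show "p ^ e dvd ?B $ l $ i" for l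
              unfolding shear_congruence_nth using ik div' by (intro dvd_add dvd_mult) auto
            have "?B $ i $ i = (A $ i $ i + A $ k $ k) + 2 * A $ i $ k"
              using even_sym_nth[OF A, of i k] by (simp add: shear_congruence_nth axis_def)
            moreover have "\<not> p ^ Suc e dvd 2 * A $ i $ k"
            proof -
              have "coprime (p ^ Suc e) 2" using p(2) by (simp add: coprime_power_left_iff coprime_commute)
              then show ?thesis using ik(3) by (simp add: coprime_dvd_mult_right_iff)
            qed
            ultimately show "\<not> p ^ Suc e dvd ?B $ i $ i"
              using dvd_add[OF dd] by (simp add: dvd_add_right_iff del: power_Suc)
          qed
        next
          case False
          then have "J ?B \<subset> J A" using JB ik(1) by auto
          then have "card (J ?B) < card (J A)" by (intro psubset_card_mono) auto
          then show ?thesis using less.hyps B by blast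
        qed
        then show ?thesis using shear[OF A bk] by blast
      qed
    qed
  qed
qed

text \<open>The determinant is a unit of the integers, and congruences see only its square.\<close>

lemma det_shear_square:
  assumes "b $ j = 0"
  shows "(det (shear_mat j b))\<^sup>2 = 1"
proof -
  have "det (shear_mat j b) * det (shear_mat j (- b)) = 1"
    using shear_inverse[OF assms] by (metis det_I det_mul)
  then have "det (shear_mat j b) = 1 \<or> det (shear_mat j b) = -1"
    using zmult_eq_1_iff by blast
  then show ?thesis by auto
qed

lemma det_scale: "det (scale_mat (j :: 'n::finite) s) = s ^ (CARD('n) - 1)"
proof -
  have "det (scale_mat j s) = (\<Prod>i\<in>UNIV. if i = j then 1 else s)"
    by (subst det_diagonal) (simp_all add: scale_mat_def)
  also have "\<dots> = (\<Prod>i\<in>UNIV - {j}. if i = j then 1 else s)"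
    by (subst prod.remove[of _ j]) auto
  also have "\<dots> = (\<Prod>i\<in>UNIV - {j}. s)"
    by (rule prod.cong) auto
  finally show ?thesis by (simp add: card_Diff_singleton)
qed

lemma det_congruence: "det (transpose P ** A ** P) = det A * (det P)\<^sup>2" for P :: "int^'n^'n"
  by (simp add: det_mul det_transpose power2_eq_square)

text \<open>A multiple of the inverse form is carried along with \<open>A\<close>, at the price of
  the factor \<open>k\<^sup>2\<close>. This keeps the hypotheses on \<open>B\<close> and the modulus
  available during diagonalization.\<close>

lemma inverse_congruence:
  fixes P Q A B :: "int^'n^'n"
  assumes PQ: "P ** Q = mat k" and QP: "Q ** P = mat k" and AB: "A ** B = mat M"
  shows "(transpose P ** A ** P) ** (Q ** B ** transpose Q) = mat (k\<^sup>2 * M)"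
proof -
  have "transpose P ** transpose Q = mat k"
    by (metis QP matrix_transpose_mul transpose_mat)
  then have PQt: "transpose P *v (transpose Q *v x) = k *s x" for x
    by (simp only: matrix_vector_mul_assoc matrix_mat_mult_vec)
  have PQv: "P *v (Q *v x) = k *s x" for x
    by (simp add: matrix_vector_mul_assoc PQ matrix_mat_mult_vec)
  have ABv: "A *v (B *v x) = M *s x" for x
    by (simp add: matrix_vector_mul_assoc AB matrix_mat_mult_vec)
  show ?thesis
    by (simp only: matrix_eq matrix_vector_mul_assoc[symmetric] matrix_mat_mult_vec PQv matrix_smult_vec ABv PQt)
      (simp add: power2_eq_square mult_ac)
qed

lemma qgauss_1_nonzero: "c > 0 \<Longrightarrow> odd c \<Longrightarrow> qgauss 1 c \<noteq> 0"
  using qgauss_1_odd[of c] by auto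

text \<open>Twist the nonzero sum \<open>qgauss 1 c\<close> by \<open>u * v\<close> once at a time
  and once in one go.\<close>

lemma kronecker_mult_left:
  assumes c: "c > 0" "odd c" and "coprime u c" "coprime v c"
  shows "kronecker (u * v) c = kronecker u c * kronecker v c"
proof -
  have "of_int (kronecker (u * v) c) * qgauss 1 c = of_int (kronecker u c * kronecker v c) * qgauss 1 c"
    using assms qgauss_twist[of c 1 "u * v"] qgauss_twist[of c v u] qgauss_twist[of c 1 v]
    by (auto simp: mult.assoc[symmetric])
  then have "(of_int (kronecker (u * v) c) :: complex) = of_int (kronecker u c * kronecker v c)"
    using qgauss_1_nonzero[OF c] by (simp only: mult_cancel_right) simp
  then show ?thesis by (simp only: of_int_eq_iff)
qed

lemma Legendre_eq_kronecker:
  "prime p \<Longrightarrow> odd p \<Longrightarrow> Legendre m p = kronecker m p"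
  using kronecker_odd_prime_power[of p m 1] by simp

lemma coprime_primeI: "prime p \<Longrightarrow> \<not> p dvd u \<Longrightarrow> coprime u p" for p u :: int
  by (metis coprime_commute prime_imp_coprime)

lemma Legendre_mult:
  fixes p :: int
  assumes "prime p" "odd p" "\<not> p dvd u" "\<not> p dvd v"
  shows "Legendre (u * v) p = Legendre u p * Legendre v p"
  using assms kronecker_mult_left[of p u v] prime_gt_0_int[of p]
  by (simp add: Legendre_eq_kronecker coprime_primeI)

lemma Legendre_prod:
  fixes p :: int
  assumes p: "prime p" "odd p" and "\<And>i. i \<in> I \<Longrightarrow> \<not> p dvd f i" "finite I"
  shows "Legendre (\<Prod>i\<in>I. f i) p = (\<Prod>i\<in>I. Legendre (f i) p)"
  using assms(4,3)
proof (induction I)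
  case empty
  have "[1\<^sup>2 = 1] (mod p)" by simp
  then have "QuadRes p 1" unfolding QuadRes_def by blast
  moreover have "\<not> p dvd 1" using prime_gt_1_int[OF p(1)] by auto
  ultimately show ?case by (simp add: Legendre_def cong_0_iff)
next
  case (insert i I)
  have "\<not> p dvd (\<Prod>i\<in>I. f i)"
    using insert p(1) by (auto simp: prime_dvd_prod_iff)
  then show ?case using insert Legendre_mult[OF p] by simp
qed

lemma Legendre_mult_square:
  fixes p :: int
  assumes p: "prime p" "odd p" and "\<not> p dvd u" "\<not> p dvd s"
  shows "Legendre (u * s\<^sup>2) p = Legendre u p"
  using assms Legendre_mult[OF p, of u "s\<^sup>2"] Legendre_mult[OF p, of s s] Legendre_square[of p s]
  by (simp add: power2_eq_square prime_dvd_mult_iff)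

section \<open>Gauss sums of forms at odd moduli\<close>

lemma qsum_shear:
  assumes "even_sym A" "c > 0" "b $ j = 0"
  shows "qsum (transpose (shear_mat j b) ** A ** shear_mat j b) a c = qsum A a c"
  using assms by (intro qsum_congruence[where k = 1 and Q = "shear_mat j (- b)"]) (auto simp: shear_inverse')

lemma qsum_scale:
  assumes "even_sym A" "c > 0" "coprime s c"
  shows "qsum (transpose (scale_mat j s) ** A ** scale_mat j s) a c = qsum A a c"
  using assms by (intro qsum_congruence[where k = s and Q = "coscale_mat j s"]) (auto simp: scale_coscale)

lemma qsum_diagonal_qgauss:
  fixes A :: "int^'n^'n"
  assumes "even_sym A" "\<And>i k. i \<noteq> k \<Longrightarrow> A $ i $ k = 0"
  shows "qsum A a c = (\<Prod>i\<in>UNIV. qgauss (a * (A $ i $ i div 2)) c)"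
proof -
  have "of_int (a * A $ i $ i * x\<^sup>2) / of_int (2 * c) = (of_int (a * (A $ i $ i div 2) * x\<^sup>2) / of_int c :: real)" for i x
  proof -
    obtain h where h: "A $ i $ i = 2 * h" using assms(1) by (auto simp: even_sym_def)
    show ?thesis by (simp add: h)
  qed
  moreover have "qsum A a c = (\<Prod>i\<in>UNIV. \<Sum>x\<in>{0..<c}. eR (of_int (a * A $ i $ i * x\<^sup>2) / of_int (2 * c)))"
    by (rule qsum_diagonal) (rule assms(2))
  ultimately show ?thesis by (simp only: qgauss_def)
qed

text \<open>Shears preserve the determinant, and scalings change it by a square prime to
  \<open>p\<close>, which the Legendre symbol ignores. So the diagonal case decides.\<close>

lemma qsum_prime_power_unit:
  fixes A :: "int^'n^'n" and p :: int
  assumes p: "prime p" "odd p" and A: "even_sym A" and det: "\<not> p dvd det A" and a: "\<not> p dvd a"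
  shows "qsum A a (p ^ k) = of_int (Legendre (det A) p) ^ k * qgauss (2 * a) (p ^ k) ^ CARD('n)"
  using p A det
proof (induction A rule: even_sym_diagonalization_induct)
  case (diagonal A)
  have p0: "p > 0" and p2: "\<not> p dvd 2" using p prime_gt_0_int primes_dvd_imp_eq[of p 2] by auto
  have det: "det A = (\<Prod>i\<in>UNIV. A $ i $ i)" using diagonal by (intro det_diagonal) auto
  have unit: "\<not> p dvd A $ i $ i" for i
    using diagonal(3) p(1) by (auto simp: det prime_dvd_prod_iff)
  have "qgauss (a * (A $ i $ i div 2)) (p ^ k) = of_int (Legendre (A $ i $ i) p) ^ k * qgauss (2 * a) (p ^ k)" for i
  proof -
    obtain h where h: "A $ i $ i = 2 * h" using diagonal(1) by (auto simp: even_sym_def)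
    \<comment> \<open>The square 4 replaces half of the diagonal entry by the entry itself and
      accounts for the multiplier \<open>2 * a\<close>.\<close>
    have "qgauss (a * h) (p ^ k) = qgauss (2\<^sup>2 * (a * h)) (p ^ k)"
      by (rule qgauss_square[symmetric]) (use p0 p(2) in \<open>simp_all add: coprime_power_right_iff\<close>)
    also have "2\<^sup>2 * (a * h) = A $ i $ i * (2 * a)" by (simp add: h)
    also have "qgauss \<dots> (p ^ k) = of_int (Legendre (A $ i $ i) p) ^ k * qgauss (2 * a) (p ^ k)"
      using p a p2 unit by (intro qgauss_prime_power) (auto simp: prime_dvd_mult_iff)
    finally show ?thesis by (simp add: h)
  qed
  then have "qsum A a (p ^ k) = (\<Prod>i\<in>UNIV. of_int (Legendre (A $ i $ i) p)) ^ k * qgauss (2 * a) (p ^ k) ^ CARD('n)"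
    using diagonal by (subst qsum_diagonal_qgauss) (simp_all add: prod.distrib prod_power_distrib)
  also have "(\<Prod>i\<in>UNIV. of_int (Legendre (A $ i $ i) p)) = (of_int (Legendre (det A) p) :: complex)"
    unfolding det by (subst Legendre_prod) (use p unit in simp_all)
  finally show ?case .
next
  case (shear A j b)
  have "det (transpose (shear_mat j b) ** A ** shear_mat j b) = det A"
    using shear(2) by (simp add: det_congruence det_shear_square)
  then show ?case using shear p prime_gt_0_int[of p] qsum_shear[of A "p ^ k" b j a] by simp
next
  case (scale A j s)
  have p0: "p > 0" using p prime_gt_0_int by auto
  have s: "\<not> p dvd s ^ m" for m using scale(3) p(1) by (auto dest: prime_dvd_power)
  have det: "det (transpose (scale_mat j s) ** A ** scale_mat j s) = det A * (s ^ (CARD('n) - 1))\<^sup>2"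
    by (simp add: det_congruence det_scale)
  have "coprime s (p ^ k)" using scale(3) p(1) by (simp add: coprime_primeI coprime_power_right_iff)
  moreover have "\<not> p dvd det (transpose (scale_mat j s) ** A ** scale_mat j s)"
    using scale(5) s p(1) unfolding det power2_eq_square by (simp add: prime_dvd_mult_iff)
  ultimately show ?case
    using scale p0 s Legendre_mult_square[OF p, of "det A" "s ^ (CARD('n) - 1)"] qsum_scale[of A "p ^ k" s j a]
    by (simp add: det)
qed

lemma Legendre_power_cong:
  assumes "\<not> p dvd u" "even m \<longleftrightarrow> even n"
  shows "Legendre u p ^ m = Legendre u p ^ n"
proof -
  have "Legendre u p = 1 \<or> Legendre u p = -1" using assms(1) by (simp add: Legendre_def cong_0_iff)
  then show ?thesis using assms(2) by (auto simp: minus_one_power_iff)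
qed

lemma multiplicity_mult_not_dvd:
  fixes p x y :: int
  assumes "prime p" "\<not> p dvd x" "y \<noteq> 0"
  shows "multiplicity p (x * y) = multiplicity p y"
proof -
  have "x \<noteq> 0" using assms(2) by auto
  then have "multiplicity p (x * y) = multiplicity p x + multiplicity p y"
    using assms by (intro prime_elem_multiplicity_mult_distrib prime_imp_prime_elem)
  then show ?thesis using assms(2) by (simp add: not_dvd_imp_multiplicity_0)
qed

text \<open>Each diagonal entry divides \<open>N\<close>, so its valuation \<open>s i\<close> is at
  most \<open>k\<close> and its sum reduces to the modulus \<open>p ^ (k - s i)\<close>. The twists
  contribute the exponents \<open>k - s i\<close>, and the valuations add up to that of
  \<open>det A\<close>.\<close>

lemma qsum_prime_power_twist:
  fixes A B :: "int^'n^'n" and p :: int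
  assumes p: "prime p" "odd p" and A: "even_sym A" and AB: "A ** B = mat N" and N: "\<not> p ^ Suc k dvd N"
    and a: "\<not> p dvd a" and b: "\<not> p dvd b"
  shows "qsum A (a * b) (p ^ k) = of_int (Legendre a p) ^ (k * CARD('n) + multiplicity p (det A)) * qsum A b (p ^ k)"
  using p A AB N
proof (induction A arbitrary: B N rule: even_sym_diagonalization_induct)
  case (diagonal A)
  have p0: "p > 0" and p2: "\<not> p dvd 2" using p prime_gt_0_int primes_dvd_imp_eq[of p 2] by auto
  have det: "det A = (\<Prod>i\<in>UNIV. A $ i $ i)" using diagonal by (intro det_diagonal) auto
  have AN: "A $ i $ i * B $ i $ i = N" for i
  proof -
    have "(A ** B) $ i $ i = (\<Sum>k\<in>UNIV. if k = i then A $ i $ i * B $ i $ i else 0)"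
      unfolding matrix_matrix_mult_def vec_lambda_beta by (rule sum.cong) (use diagonal(2) in auto)
    then show ?thesis using diagonal(3) by (simp add: mat_def)
  qed
  have Aii: "\<not> p ^ Suc k dvd A $ i $ i" for i
    using diagonal(4) AN[of i] by (metis dvd_mult2)
  have nz: "A $ i $ i \<noteq> 0" for i using Aii[of i] by auto
  define m where "m i = A $ i $ i div 2" for i
  have m: "A $ i $ i = 2 * m i" for i using diagonal(1) by (simp add: even_sym_def m_def)
  define s where "s i = multiplicity p (m i)" for i
  have m0: "m i \<noteq> 0" for i using nz[of i] by (simp add: m)
  have s: "multiplicity p (A $ i $ i) = s i" for i
    using p(1) p2 m0[of i] by (simp add: m s_def multiplicity_mult_not_dvd)
  have sk: "s i \<le> k" for i
    using Aii[of i] nz[of i] p(1) s[of i] by (subst (asm) power_dvd_iff_le_multiplicity) auto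
  have gauss: "qgauss (a * b * m i) (p ^ k) = of_int (Legendre a p ^ (k + s i)) * qgauss (b * m i) (p ^ k)" for i
  proof -
    obtain u where u: "m i = p ^ s i * u" "\<not> p dvd u"
      using multiplicity_decompose'[of "m i" p] m0[of i] p(1) prime_gt_1_int[of p] unfolding s_def by auto
    have pk: "p ^ k = p ^ s i * p ^ (k - s i)" using sk[of i] by (simp flip: power_add)
    have "qgauss (a * b * m i) (p ^ k) = of_int (p ^ s i) * qgauss (a * (b * u)) (p ^ (k - s i))"
      using qgauss_common_factor[of "p ^ s i" "p ^ (k - s i)" "a * (b * u)"] p0 by (simp add: u pk mult_ac)
    also have "qgauss (a * (b * u)) (p ^ (k - s i)) = of_int (Legendre a p) ^ (k - s i) * qgauss (b * u) (p ^ (k - s i))"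
      using p a b u by (intro qgauss_prime_power) (auto simp: prime_dvd_mult_iff)
    also have "of_int (p ^ s i) * (of_int (Legendre a p) ^ (k - s i) * qgauss (b * u) (p ^ (k - s i)))
        = of_int (Legendre a p ^ (k - s i)) * qgauss (b * m i) (p ^ k)"
      using qgauss_common_factor[of "p ^ s i" "p ^ (k - s i)" "b * u"] p0 by (simp add: u pk mult_ac)
    \<comment> \<open>Only parity counts, and the sum avoids truncated subtraction when the
      exponents are added.\<close>
    also have "Legendre a p ^ (k - s i) = Legendre a p ^ (k + s i)"
      using sk[of i] by (intro Legendre_power_cong[OF a]) auto
    finally show ?thesis .
  qed
  have "multiplicity p (det A) = (\<Sum>i\<in>UNIV. s i)"
    unfolding det using p(1) nz by (subst prime_elem_multiplicity_prod_distrib) (auto simp: s)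
  then have exp: "k * CARD('n) + multiplicity p (det A) = (\<Sum>i\<in>(UNIV :: 'n set). k + s i)"
    by (simp add: sum.distrib)
  have "qsum A (a * b) (p ^ k) = (\<Prod>i\<in>UNIV. qgauss (a * b * m i) (p ^ k))"
    unfolding m_def by (rule qsum_diagonal_qgauss) (use diagonal in auto)
  also have "\<dots> = of_int (Legendre a p) ^ (k * CARD('n) + multiplicity p (det A)) * (\<Prod>i\<in>UNIV. qgauss (b * m i) (p ^ k))"
    by (simp add: gauss prod.distrib exp power_sum)
  also have "(\<Prod>i\<in>UNIV. qgauss (b * m i) (p ^ k)) = qsum A b (p ^ k)"
    unfolding m_def by (rule qsum_diagonal_qgauss[symmetric]) (use diagonal in auto)
  finally show ?case .
next
  case (shear A j v)
  have det: "det (transpose (shear_mat j v) ** A ** shear_mat j v) = det A"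
    using shear(2) by (simp add: det_congruence det_shear_square)
  have "(transpose (shear_mat j v) ** A ** shear_mat j v) ** (shear_mat j (- v) ** B ** transpose (shear_mat j (- v))) = mat (1\<^sup>2 * N)"
    using shear by (intro inverse_congruence) (simp_all add: shear_inverse shear_inverse')
  from shear.IH[OF this] show ?case
    using shear p prime_gt_0_int[of p] by (simp add: det qsum_shear)
next
  case (scale A j s)
  have p0: "p > 0" using p prime_gt_0_int by auto
  have s: "\<not> p dvd s ^ m" for m using scale(3) p(1) by (auto dest: prime_dvd_power)
  have det: "det (transpose (scale_mat j s) ** A ** scale_mat j s) = det A * (s ^ (CARD('n) - 1))\<^sup>2"
    by (simp add: det_congruence det_scale)
  have s2: "\<not> p dvd (s ^ (CARD('n) - 1))\<^sup>2" using s[of "(CARD('n) - 1) * 2"] by (simp add: power_mult)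
  have det0: "det A \<noteq> 0"
  proof
    assume "det A = 0"
    then have "det (mat N :: int^'n^'n) = 0" using scale.prems(1) det_mul[of A B] by simp
    then have "N ^ CARD('n) = 0" by (subst (asm) det_diagonal) (auto simp: mat_def)
    then show False using scale.prems(2) by simp
  qed
  have mult: "multiplicity p (det A * (s ^ (CARD('n) - 1))\<^sup>2) = multiplicity p (det A)"
  proof -
    have "(s ^ (CARD('n) - 1))\<^sup>2 \<noteq> 0" using scale(2) by simp
    then show ?thesis using det0 p(1) s2
      by (subst mult.commute, intro multiplicity_mult_not_dvd)
  qed
  have cop: "coprime s (p ^ k)" using scale(3) p(1) by (simp add: coprime_primeI coprime_power_right_iff)
  have AB: "(transpose (scale_mat j s) ** A ** scale_mat j s) ** (coscale_mat j s ** B ** transpose (coscale_mat j s)) = mat (s\<^sup>2 * N)"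
    using scale by (intro inverse_congruence) (simp_all add: scale_coscale)
  have "coprime (p ^ Suc k) (s\<^sup>2)" using scale(3) p(1)
    by (metis coprime_commute coprime_power_left_iff coprime_power_right_iff coprime_primeI)
  then have "\<not> p ^ Suc k dvd s\<^sup>2 * N"
    using scale.prems(2) by (simp add: coprime_dvd_mult_right_iff del: power_Suc)
  from scale.IH[OF AB this, unfolded det mult] show ?case
    using scale p0 cop by (simp add: qsum_scale)
qed

lemma qsum_1 [simp]:
  fixes A :: "int^'n^'n"
  shows "qsum A a 1 = 1"
proof -
  have "0 \<le> y \<and> y < 1 \<longleftrightarrow> y = 0" for y :: int by auto
  then have "cube 1 = {0 :: int^'n}" by (simp add: vbox_def vec_eq_iff set_eq_iff)
  then show ?thesis by (simp add: qsum_def qf_def idot_def)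
qed

lemma qsum_odd_unit:
  fixes A :: "int^'n^'n" and c :: int
  assumes A: "even_sym A" and c: "c > 0" "odd c" and "coprime (det A) c" "coprime a c"
  shows "qsum A a c = of_int (kronecker (det A) c) * qgauss (2 * a) c ^ CARD('n)"
  using c assms(4,5)
proof (induction arbitrary: a rule: prime_power_induct_int)
  case (prime_power p k m)
  have p0: "p > 0" using prime_power.hyps(1) prime_gt_0_int by blast
  have odd: "odd p" "odd m" using prime_power by auto
  have cop: "coprime (p ^ k) m" using prime_power by (intro coprime_prime_power)
  have 1: "\<not> p dvd det A" "\<not> p dvd a * m"
    using prime_power by (auto simp: prime_dvd_mult_iff dest: coprime_common_divisor[of _ _ p])
  have 2: "coprime (det A) m" "coprime (a * p ^ k) m" using prime_power.prems cop by auto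
  have gauss: "qgauss (2 * a) (p ^ k * m) = qgauss (2 * (a * m)) (p ^ k) * qgauss (2 * (a * p ^ k)) m"
    using qgauss_mult[of "p ^ k" m "2 * a"] cop p0 prime_power.hyps by (simp add: mult.assoc)
  have kron: "kronecker (det A) (p ^ k * m) = Legendre (det A) p ^ k * kronecker (det A) m"
    using p0 prime_power.hyps odd by (simp add: kronecker_mult kronecker_odd_prime_power)
  have "qsum A a (p ^ k * m) = qsum A (a * m) (p ^ k) * qsum A (a * p ^ k) m"
    using cop p0 prime_power.hyps A by (simp add: qsum_mult)
  also have "\<dots> = (of_int (Legendre (det A) p) ^ k * qgauss (2 * (a * m)) (p ^ k) ^ CARD('n))
      * (of_int (kronecker (det A) m) * qgauss (2 * (a * p ^ k)) m ^ CARD('n))"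
    using qsum_prime_power_unit[OF prime_power.hyps(1) odd(1) A 1] prime_power.IH[OF odd(2) 2] by (simp only:)
  also have "\<dots> = of_int (kronecker (det A) (p ^ k * m)) * qgauss (2 * a) (p ^ k * m) ^ CARD('n)"
    unfolding gauss kron by (simp add: power_mult_distrib)
  finally show ?case .
qed simp

text \<open>Primes of \<open>S\<close> outside \<open>D\<close> contribute exponent 0;
  \<open>S\<close> will be the set of primes of the modulus.\<close>

lemma kronecker_eq_prod_Legendre:
  fixes c D :: int
  assumes "D > 0" "finite S" "\<And>p. p \<in> S \<Longrightarrow> prime p" "prime_factors D \<subseteq> S" "2 \<notin> S"
  shows "kronecker a D = (\<Prod>p\<in>S. Legendre a p ^ multiplicity p D)"
proof -
  have "kronecker a D = (\<Prod>p\<in>prime_factors D. kronecker_prime a p ^ multiplicity p D)"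
    using assms(1)
    by (auto simp: kronecker_def image_prod_mset_multiplicity count_prime_factorization intro!: prod.cong)
  also have "\<dots> = (\<Prod>p\<in>prime_factors D. Legendre a p ^ multiplicity p D)"
    using assms(4,5) by (intro prod.cong) (auto simp: kronecker_prime_def)
  also have "\<dots> = (\<Prod>p\<in>S. Legendre a p ^ multiplicity p D)"
    using assms by (intro prod.mono_neutral_left) (auto simp: prime_factors_multiplicity not_dvd_imp_multiplicity_0 prime_factors_dvd)
  finally show ?thesis .
qed

text \<open>The condition on \<open>N\<close> is stated prime by prime because it must pass to
  coprime factors of \<open>c\<close>, which \<open>N dvd c\<close> does not.\<close>

lemma qsum_odd_twist_prod:
  fixes A B :: "int^'n^'n" and c :: int
  assumes A: "even_sym A" and AB: "A ** B = mat N" and c: "c > 0" "odd c"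
    and "\<And>p. prime p \<Longrightarrow> p dvd c \<Longrightarrow> \<not> p ^ Suc (multiplicity p c) dvd N"
    and "coprime a c" "coprime b c"
  shows "qsum A (a * b) c = of_int (kronecker a c) ^ CARD('n) *
    of_int (\<Prod>p\<in>prime_factors c. Legendre a p ^ multiplicity p (det A)) * qsum A b c"
  using c assms(5-)
proof (induction arbitrary: b rule: prime_power_induct_int)
  case (prime_power p k m)
  have p0: "p > 0" using prime_power.hyps(1) prime_gt_0_int by blast
  have odd: "odd p" "odd m" using prime_power by auto
  have cop: "coprime (p ^ k) m" using prime_power by (intro coprime_prime_power)
  have 1: "\<not> p dvd a" "\<not> p dvd b * m"
    using prime_power by (auto simp: prime_dvd_mult_iff dest: coprime_common_divisor[of _ _ p])
  have 2: "coprime a m" "coprime (b * p ^ k) m" using prime_power.prems cop by auto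
  have pk0: "p ^ k \<noteq> 0" "m \<noteq> 0" using p0 prime_power.hyps by auto
  have mp: "multiplicity p (p ^ k * m) = k"
    using prime_power.hyps pk0 multiplicity_mult_not_dvd[of p m "p ^ k"] prime_gt_1_int[of p]
    by (simp add: mult.commute multiplicity_same_power)
  have Np: "\<not> p ^ Suc k dvd N"
    using prime_power.prems(2)[of p] prime_power.hyps mp by (simp add: dvd_mult2 dvd_power del: power_Suc)
  have Nm: "\<not> q ^ Suc (multiplicity q m) dvd N" if q: "prime q" "q dvd m" for q
  proof -
    have "\<not> q dvd p ^ k" using q prime_power.hyps by (metis prime_dvd_power primes_dvd_imp_eq)
    then have "multiplicity q (p ^ k * m) = multiplicity q m"
      using q pk0 by (simp add: multiplicity_mult_not_dvd)
    then show ?thesis using prime_power.prems(2)[of q] q by (simp del: power_Suc)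
  qed
  have pf: "prime_factors (p ^ k * m) = insert p (prime_factors m)" "p \<notin> prime_factors m"
    using prime_power.hyps pk0
    by (auto simp: prime_factors_dvd prime_dvd_mult_iff prime_dvd_power_iff dest: primes_dvd_imp_eq)
  have qs: "qsum A b (p ^ k * m) = qsum A (b * m) (p ^ k) * qsum A (b * p ^ k) m"
    using cop p0 prime_power.hyps A by (simp add: qsum_mult)
  have kron: "kronecker a (p ^ k * m) = Legendre a p ^ k * kronecker a m"
    using p0 prime_power.hyps odd by (simp add: kronecker_mult kronecker_odd_prime_power)
  have "qsum A (a * b) (p ^ k * m) = qsum A (a * (b * m)) (p ^ k) * qsum A (a * (b * p ^ k)) m"
    using cop p0 prime_power.hyps A by (simp add: qsum_mult mult.assoc)
  also have "\<dots> = (of_int (Legendre a p) ^ (k * CARD('n) + multiplicity p (det A)) * qsum A (b * m) (p ^ k))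
      * (of_int (kronecker a m) ^ CARD('n) * of_int (\<Prod>p\<in>prime_factors m. Legendre a p ^ multiplicity p (det A)) * qsum A (b * p ^ k) m)"
    using qsum_prime_power_twist[OF prime_power.hyps(1) odd(1) A AB Np 1] prime_power.IH[OF odd(2) Nm 2] by (simp only:)
  also have "\<dots> = of_int (kronecker a (p ^ k * m)) ^ CARD('n) *
      of_int (\<Prod>p\<in>prime_factors (p ^ k * m). Legendre a p ^ multiplicity p (det A)) * qsum A b (p ^ k * m)"
    unfolding qs kron pf(1) using pf(2)
    by (simp add: power_mult_distrib power_mult[symmetric] power_add)
  finally show ?case .
qed simp

lemma det_dvd_power:
  fixes A B :: "int^'n^'n"
  assumes "A ** B = mat N"
  shows "det A dvd N ^ CARD('n)"
proof -
  have "det A * det B = det (mat N :: int^'n^'n)" using assms by (metis det_mul)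
  also have "\<dots> = N ^ CARD('n)" by (subst det_diagonal) (auto simp: mat_def)
  finally show ?thesis by (metis dvd_triv_left)
qed

text \<open>Every prime of \<open>det A\<close> divides \<open>N\<close> and hence \<open>c\<close>,
  so the product over primes of \<open>c\<close> is the symbol at \<open>det A\<close>.\<close>

lemma qsum_odd_twist:
  fixes A B :: "int^'n^'n" and c :: int
  assumes A: "even_sym A" and AB: "A ** B = mat N" and N: "N \<noteq> 0" and c: "c > 0" "odd c" "N dvd c"
    and cop: "coprime a c" "coprime b c" and det: "det A > 0"
  shows "qsum A (a * b) c = of_int (kronecker a c) ^ CARD('n) * of_int (kronecker a (det A)) * qsum A b c"
proof -
  have "\<not> p ^ Suc (multiplicity p c) dvd N" if "prime p" for p
  proof
    assume "p ^ Suc (multiplicity p c) dvd N"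
    then have "p ^ Suc (multiplicity p c) dvd c" using c(3) by (rule dvd_trans)
    then show False using that c(1) by (subst (asm) power_dvd_iff_le_multiplicity) auto
  qed
  then have "qsum A (a * b) c = of_int (kronecker a c) ^ CARD('n) *
      of_int (\<Prod>p\<in>prime_factors c. Legendre a p ^ multiplicity p (det A)) * qsum A b c"
    by (intro qsum_odd_twist_prod[OF A AB c(1,2) _ cop]) auto
  moreover have "kronecker a (det A) = (\<Prod>p\<in>prime_factors c. Legendre a p ^ multiplicity p (det A))"
  proof (rule kronecker_eq_prod_Legendre[OF det])
    show "prime_factors (det A) \<subseteq> prime_factors c"
    proof
      fix p assume p: "p \<in> prime_factors (det A)"
      then have "p dvd N ^ CARD('n)" using det_dvd_power[OF AB] by (auto intro: dvd_trans)
      then have "p dvd c" using p c(3) by (auto dest!: prime_dvd_power[rotated] intro: dvd_trans)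
      then show "p \<in> prime_factors c" using p c(1) by (auto simp: prime_factors_dvd)
    qed
  qed (use c in \<open>auto simp: prime_factors_dvd\<close>)
  ultimately show ?thesis by simp
qed

section \<open>Milgram's formula\<close>

text \<open>Positivity on integer vectors suffices, since all substitutions have integer
  matrices.\<close>

definition posdef :: "int^'n^'n \<Rightarrow> bool" where
  "posdef A \<longleftrightarrow> (\<forall>v. v \<noteq> 0 \<longrightarrow> qf A v > 0)"

lemma posdef_congruence:
  fixes A P Q :: "int^'n^'n"
  assumes "posdef A" "Q ** P = mat k" "k \<noteq> 0"
  shows "posdef (transpose P ** A ** P)"
  unfolding posdef_def qf_congruence
proof (intro allI impI)
  fix v :: "int^'n" assume v: "v \<noteq> 0"
  have "Q *v (P *v v) = k *s v" by (simp add: matrix_vector_mul_assoc assms(2) matrix_mat_mult_vec)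
  moreover have "k *s v \<noteq> 0" using v assms(3) by (auto simp: vec_eq_iff)
  ultimately have "P *v v \<noteq> 0" by (metis matrix_vector_mult_0_right)
  then show "0 < qf A (P *v v)" using assms(1) by (simp add: posdef_def)
qed

text \<open>The lattice \<open>\<int>\<^sup>n\<close> with the form \<open>A\<close> has index \<open>s\<close> in a superlattice which, up to
  scaling by \<open>s\<close>, carries the congruent form.\<close>

lemma qsum_scale_index:
  fixes A B :: "int^'n^'n" and j :: 'n
  assumes A: "even_sym A" and B: "even_sym B" and AB: "A ** B = mat M" and M: "M > 0" and s: "s > 0"
  shows "qsum (transpose (scale_mat j s) ** A ** scale_mat j s) 1 (s\<^sup>2 * M) = of_int (s ^ (2 * CARD('n) - 1)) * qsum A 1 M"
proof -
  define A2 where "A2 = transpose (scale_mat j s) ** A ** scale_mat j s"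
  define F where "F v = eR (of_int (1 * qf A2 v) / of_int (2 * (s\<^sup>2 * M)))" for v
  have A2: "even_sym A2" unfolding A2_def using A by (rule even_sym_congruence)
  have M2: "s\<^sup>2 * M > 0" using s M by simp
  have per: "F u = F v" if "vcong (s\<^sup>2 * M) u v" for u v
    unfolding F_def using A2 M2 that by (rule qsum_term_cong)
  \<comment> \<open>Up to the factor \<open>M\<close>, \<open>y\<close> is dual to coordinate
    \<open>j\<close>. The vector \<open>t\<close> transports it so that
    \<open>A2 *v t = (s * M) *s axis j 1\<close>; shifting by multiples of \<open>t\<close> then
    detects \<open>v $ j\<close> modulo \<open>s\<close>.\<close>
  define y where "y = B *v axis j 1"
  define t where "t = coscale_mat j s *v y"
  have Ay: "A *v y = M *s axis j 1"
    by (simp add: y_def matrix_vector_mul_assoc AB matrix_mat_mult_vec)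
  have scale_t: "scale_mat j s *v t = s *s y"
    by (simp add: t_def matrix_vector_mul_assoc scale_coscale matrix_mat_mult_vec)
  have scale_axis: "scale_mat j s *v axis j 1 = axis j 1"
    by (simp add: scale_mult_vec vec_eq_iff axis_def)
  have scale_transpose: "transpose (scale_mat j s) = scale_mat j s"
    by (simp add: scale_mat_def transpose_def vec_eq_iff)
  have A2t: "A2 *v t = (s * M) *s axis j 1"
    unfolding A2_def by (simp only: matrix_vector_mul_assoc[symmetric] scale_t scale_transpose matrix_smult_vec Ay scale_axis)
      (simp add: vec_eq_iff)
  have qft: "qf A2 t = s\<^sup>2 * M * B $ j $ j"
  proof -
    have "qf A2 t = qf A (s *s y)" by (simp add: A2_def qf_congruence scale_t)
    also have "\<dots> = s\<^sup>2 * idot y (M *s axis j 1)" by (simp only: qf_smult) (simp add: qf_def Ay)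
    also have "idot y (M *s axis j 1) = M * B $ j $ j"
      by (simp add: idot_smult idot_axis y_def matrix_mult_axis column_def)
    finally show ?thesis by simp
  qed
  \<comment> \<open>Evenness of \<open>B\<close> makes the quadratic term of the shift an integer,
    which leaves a pure character.\<close>
  obtain \<beta> where \<beta>: "B $ j $ j = 2 * \<beta>" using B by (auto simp: even_sym_def)
  have shift: "F (k *s t + v) = F v * eR (of_int (v $ j * k) / of_int s)" for k v
  proof -
    have "idot (k *s t) (A2 *v v) = idot v (A2 *v (k *s t))"
      using A2 by (intro idot_matrix_sym) (simp add: even_sym_def)
    also have "\<dots> = k * s * M * v $ j" by (simp add: matrix_smult_vec A2t idot_smult idot_axis)
    finally have "qf A2 (k *s t + v) = k\<^sup>2 * (s\<^sup>2 * M * (2 * \<beta>)) + 2 * (k * s * M * v $ j) + qf A2 v"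
      using A2 by (simp add: qf_add even_sym_def qf_smult qft \<beta>)
    then have "of_int (1 * qf A2 (k *s t + v)) / of_int (2 * (s\<^sup>2 * M))
      = of_int (1 * qf A2 v) / of_int (2 * (s\<^sup>2 * M)) + of_int (v $ j * k) / of_int s + (of_int (k\<^sup>2 * \<beta>) :: real)"
      using s M by (simp add: field_simps power2_eq_square)
    then show ?thesis unfolding F_def by (simp only: eR_add eR_of_int mult_1_right)
  qed
  have "qsum A2 1 (s\<^sup>2 * M) = (\<Sum>v\<in>cube (s\<^sup>2 * M). F v)"
    by (simp only: qsum_def F_def)
  also have "\<dots> = (\<Sum>v\<in>{v\<in>cube (s\<^sup>2 * M). s dvd v $ j}. F v)"
  proof (rule sum_twist_filter[OF s])
    fix k
    have "(\<Sum>v\<in>cube (s\<^sup>2 * M). F v * eR (of_int (v $ j * k) / of_int s)) = (\<Sum>v\<in>cube (s\<^sup>2 * M). F (k *s t + v))"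
      by (simp only: shift)
    also have "\<dots> = (\<Sum>v\<in>cube (s\<^sup>2 * M). F v)"
      using M2 per by (rule sum_cube_shift)
    finally show "(\<Sum>v\<in>cube (s\<^sup>2 * M). F v * eR (of_int (v $ j * k) / of_int s)) = (\<Sum>v\<in>cube (s\<^sup>2 * M). F v)" .
  qed simp
  \<comment> \<open>The surviving vectors are the image of \<open>coscale_mat j s\<close>, on which
    the new form is \<open>s\<^sup>2\<close> times the old one. Dividing by \<open>s\<close>
    shortens side \<open>j\<close> only, and the box contains
    \<open>s * (s\<^sup>2) ^ (n - 1)\<close> copies of the cube.\<close>
  also have "\<dots> = (\<Sum>u\<in>vbox (M *s (\<chi> i. if i = j then s else s\<^sup>2)). F (coscale_mat j s *v u))"
  proof (rule sum.reindex_bij_witness[of _ "\<lambda>u. coscale_mat j s *v u" "\<lambda>v. \<chi> i. if i = j then v $ i div s else v $ i"])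
    fix v assume v: "v \<in> {v\<in>cube (s\<^sup>2 * M). s dvd v $ j}"
    then obtain r where r: "v $ j = s * r" by auto
    have *: "0 \<le> v $ i" "v $ i < s\<^sup>2 * M" for i using v by (auto simp: vbox_iff)
    show "coscale_mat j s *v (\<chi> i. if i = j then v $ i div s else v $ i) = v"
      using v by (auto simp: coscale_mult_vec vec_eq_iff)
    then show "F (coscale_mat j s *v (\<chi> i. if i = j then v $ i div s else v $ i)) = F v" by simp
    have "0 \<le> s * r" "s * r < s * (s * M)" using *[of j] by (simp_all add: r power2_eq_square mult.assoc)
    then have "0 \<le> r" "r < s * M" using s by (simp_all add: zero_le_mult_iff)
    then show "(\<chi> i. if i = j then v $ i div s else v $ i) \<in> vbox (M *s (\<chi> i. if i = j then s else s\<^sup>2))"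
      using * r s by (auto simp: vbox_iff mult.commute)
  next
    fix u assume "u \<in> vbox (M *s (\<chi> i. if i = j then s else s\<^sup>2))"
    then have *: "0 \<le> u $ i" "u $ i < M * (if i = j then s else s\<^sup>2)" for i by (auto simp: vbox_iff)
    have "s * u $ j < s * (M * s)" using *[of j] s by simp
    moreover have "u $ i < M * (s * s)" if "i \<noteq> j" for i
      using *(2)[of i] that by (simp add: power2_eq_square)
    ultimately show "coscale_mat j s *v u \<in> {v\<in>cube (s\<^sup>2 * M). s dvd v $ j}"
      using * s by (auto simp: coscale_mult_vec vbox_iff power2_eq_square mult_ac)
    show "(\<chi> i. if i = j then (coscale_mat j s *v u) $ i div s else (coscale_mat j s *v u) $ i) = u"
      using s by (auto simp: coscale_mult_vec vec_eq_iff)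
  qed
  also have "\<dots> = (\<Sum>u\<in>vbox (M *s (\<chi> i. if i = j then s else s\<^sup>2)). eR (of_int (1 * qf A u) / of_int (2 * M)))"
  proof (intro sum.cong refl)
    fix u
    have "qf A2 (coscale_mat j s *v u) = s\<^sup>2 * qf A u"
      by (simp add: A2_def qf_congruence matrix_vector_mul_assoc scale_coscale matrix_mat_mult_vec qf_smult)
    then show "F (coscale_mat j s *v u) = eR (of_int (1 * qf A u) / of_int (2 * M))"
      using s by (simp add: F_def)
  qed
  also have "\<dots> = of_int (\<Prod>i\<in>UNIV. (\<chi> i. if i = j then s else s\<^sup>2) $ i) * (\<Sum>u\<in>cube M. eR (of_int (1 * qf A u) / of_int (2 * M)))"
    by (rule sum_vbox_multiple[where f = "\<lambda>u. eR (of_int (1 * qf A u) / of_int (2 * M))", OF M qsum_term_cong[OF A M]]) (use s in auto)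
  also have "(\<Prod>i\<in>UNIV. (\<chi> i. if i = j then s else s\<^sup>2) $ i) = s ^ (2 * CARD('n) - 1)"
  proof -
    have "(\<Prod>i\<in>UNIV. (\<chi> i. if i = j then s else s\<^sup>2) $ i) = s * (\<Prod>i\<in>UNIV - {j}. if i = j then s else s\<^sup>2)"
      by (simp add: prod.remove[of UNIV j])
    also have "(\<Prod>i\<in>UNIV - {j}. if i = j then s else s\<^sup>2) = (\<Prod>i\<in>UNIV - {j}. s\<^sup>2)"
      by (rule prod.cong) auto
    also have "\<dots> = s ^ (2 * (CARD('n) - 1))" by (simp add: card_Diff_singleton power_mult)
    also have "s * s ^ (2 * (CARD('n) - 1)) = s ^ (2 * CARD('n) - 1)"
    proof -
      have "2 * CARD('n) - 1 = Suc (2 * (CARD('n) - 1))" using zero_less_card_finite[where 'a = 'n] by linarith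
      then show ?thesis by simp
    qed
    finally show ?thesis .
  qed
  finally show ?thesis by (simp only: A2_def qsum_def)
qed

lemma real_sqrt_prod: "sqrt (\<Prod>i\<in>I. f i) = (\<Prod>i\<in>I. sqrt (f i))"
  by (induction I rule: infinite_finite_induct) (simp_all add: real_sqrt_mult)

text \<open>With \<open>A $ i $ i = 2 * m\<close> and \<open>B $ i $ i = 2 * \<beta>\<close> the
  modulus is \<open>4 * m * \<beta>\<close>. Removing the common factor \<open>m\<close> leaves the
  sum of modulus \<open>4 * \<beta>\<close>, which is Gauss's case.\<close>

lemma qsum_milgram_diagonal:
  fixes A B :: "int^'n^'n"
  assumes A: "even_sym A" "\<And>i k. i \<noteq> k \<Longrightarrow> A $ i $ k = 0" and pos: "posdef A"
    and B: "even_sym B" and AB: "A ** B = mat M" and M: "M > 0"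
  shows "qsum A 1 M = of_real (sqrt (of_int (M ^ CARD('n) * det A))) * eR (of_nat CARD('n) / 8)"
proof -
  have Apos: "A $ i $ i > 0" for i
  proof -
    have "axis i 1 \<noteq> (0 :: int^'n)" by (simp add: axis_eq_0_iff)
    then have "qf A (axis i 1) > 0" using pos unfolding posdef_def by blast
    then show ?thesis by (simp only: qf_axis)
  qed
  have AM: "A $ i $ i * B $ i $ i = M" for i
  proof -
    have "(A ** B) $ i $ i = (\<Sum>k\<in>UNIV. if k = i then A $ i $ i * B $ i $ i else 0)"
      unfolding matrix_matrix_mult_def vec_lambda_beta by (rule sum.cong) (use A(2) in auto)
    then show ?thesis using AB by (simp add: mat_def)
  qed
  have one: "qgauss (1 * (A $ i $ i div 2)) M = of_real (sqrt (of_int (M * A $ i $ i))) * eR (1/8)" for i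
  proof -
    obtain m where m: "A $ i $ i = 2 * m" using A(1) by (auto simp: even_sym_def)
    obtain \<beta> where \<beta>: "B $ i $ i = 2 * \<beta>" using B by (auto simp: even_sym_def)
    have m0: "m > 0" using Apos[of i] by (simp add: m)
    have MM: "M = 4 * m * \<beta>" using AM[of i] by (simp add: m \<beta>)
    then have \<beta>0: "\<beta> > 0" using M m0 by (simp add: zero_less_mult_iff)
    have "qgauss (1 * (A $ i $ i div 2)) M = qgauss (m * 1) (m * (4 * \<beta>))" by (simp add: m MM mult_ac)
    also have "\<dots> = of_int m * (2 * of_real (sqrt (of_int (2 * \<beta>))) * eR (1/8))"
      using m0 \<beta>0 by (subst qgauss_common_factor) (simp_all add: qgauss_even_modulus)
    also have "of_int m * (2 * of_real (sqrt (of_int (2 * \<beta>))) * eR (1/8)) = of_real (of_int (2 * m) * sqrt (of_int (2 * \<beta>))) * eR (1/8)"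
      by simp
    also have "of_int (2 * m) * sqrt (of_int (2 * \<beta>)) = sqrt (of_int (M * A $ i $ i))"
      using m0 \<beta>0 by (intro real_sqrt_unique[symmetric]) (simp_all add: m MM power_mult_distrib power2_eq_square)
    finally show ?thesis .
  qed
  have "qsum A 1 M = (\<Prod>i\<in>UNIV. qgauss (1 * (A $ i $ i div 2)) M)"
    by (rule qsum_diagonal_qgauss) (use A in auto)
  also have "\<dots> = (\<Prod>i\<in>UNIV. of_real (sqrt (of_int (M * A $ i $ i))) * eR (1/8))"
    by (simp only: one)
  also have "\<dots> = of_real (\<Prod>i\<in>(UNIV::'n set). sqrt (of_int (M * A $ i $ i))) * eR (of_nat CARD('n) / 8)"
    by (simp add: prod.distrib eR_power)
  also have "(\<Prod>i\<in>(UNIV::'n set). sqrt (of_int (M * A $ i $ i))) = sqrt (of_int (M ^ CARD('n) * det A))"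
  proof -
    have "M ^ CARD('n) * det A = (\<Prod>i\<in>UNIV. M * A $ i $ i)"
      using det_diagonal[of A] A by (simp add: prod.distrib)
    then show ?thesis by (simp only: of_int_prod real_sqrt_prod)
  qed
  finally show ?thesis .
qed

text \<open>Any odd prime would serve in the diagonalization; 3 is a choice. What matters is that
  both sides respond in the same way to every substitution used.\<close>

theorem qsum_milgram:
  fixes A B :: "int^'n^'n"
  assumes A: "even_sym A" and pos: "posdef A"
    and B: "even_sym B" and AB: "A ** B = mat M" and M: "M > 0"
  shows "qsum A 1 M = of_real (sqrt (of_int (M ^ CARD('n) * det A))) * eR (of_nat CARD('n) / 8)"
proof -
  have p: "prime (3 :: int)" "odd (3 :: int)" by simp_all
  show ?thesis
    using p A pos B AB M
  proof (induction A arbitrary: B M rule: even_sym_diagonalization_induct)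
    case (diagonal A)
    then show ?case by (intro qsum_milgram_diagonal) auto
  next
    case (shear A j v)
    let ?P = "shear_mat j v" and ?Q = "shear_mat j (- v)"
    have det: "det (transpose ?P ** A ** ?P) = det A"
      using shear(2) by (simp add: det_congruence det_shear_square)
    have 1: "posdef (transpose ?P ** A ** ?P)"
      using shear by (intro posdef_congruence[where k = 1 and Q = ?Q]) (auto simp: shear_inverse')
    have 2: "even_sym (?Q ** B ** transpose ?Q)"
      using even_sym_congruence[of B "transpose ?Q"] shear by (simp add: transpose_transpose)
    have 3: "(transpose ?P ** A ** ?P) ** (?Q ** B ** transpose ?Q) = mat (1\<^sup>2 * M)"
      using shear by (intro inverse_congruence) (simp_all add: shear_inverse shear_inverse')
    from shear.IH[OF 1 2 3] show ?case
      using shear by (simp add: det qsum_shear)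
  next
    case (scale A j s)
    let ?P = "scale_mat j s" and ?Q = "coscale_mat j s" and ?n = "CARD('n)"
    have det: "det (transpose ?P ** A ** ?P) = det A * (s ^ (?n - 1))\<^sup>2"
      by (simp add: det_congruence det_scale)
    have 1: "posdef (transpose ?P ** A ** ?P)"
      using scale by (intro posdef_congruence[where k = s and Q = ?Q]) (auto simp: scale_coscale)
    have 2: "even_sym (?Q ** B ** transpose ?Q)"
      using even_sym_congruence[of B "transpose ?Q"] scale by (simp add: transpose_transpose)
    have 3: "(transpose ?P ** A ** ?P) ** (?Q ** B ** transpose ?Q) = mat (s\<^sup>2 * M)"
      using scale by (intro inverse_congruence) (simp_all add: scale_coscale)
    have "s\<^sup>2 * M > 0" using scale by simp
    from scale.IH[OF 1 2 3 this] have IH: "qsum (transpose ?P ** A ** ?P) 1 (s\<^sup>2 * M)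
      = of_real (sqrt (of_int ((s\<^sup>2 * M) ^ ?n * (det A * (s ^ (?n - 1))\<^sup>2)))) * eR (of_nat ?n / 8)"
      unfolding det .
    \<comment> \<open>Under the root this yields \<open>s ^ (2 * ?n - 1)\<close>, the factor that
      \<open>qsum_scale_index\<close> produces on the other side.\<close>
    have "(s\<^sup>2 * M) ^ n * (d * (s ^ k)\<^sup>2) = (s ^ (n + k))\<^sup>2 * (M ^ n * d)" for n k d
      by (simp add: power_mult_distrib power_add power2_eq_square)
    then have "(s\<^sup>2 * M) ^ ?n * (det A * (s ^ (?n - 1))\<^sup>2) = (s ^ (?n + (?n - 1)))\<^sup>2 * (M ^ ?n * det A)"
      by blast
    also have "?n + (?n - 1) = 2 * ?n - 1" using zero_less_card_finite[where 'a = 'n] by linarith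
    finally have eq: "(s\<^sup>2 * M) ^ ?n * (det A * (s ^ (?n - 1))\<^sup>2) = (s ^ (2 * ?n - 1))\<^sup>2 * (M ^ ?n * det A)" .
    have sqrt_eq: "sqrt (of_int (t\<^sup>2 * y)) = of_int t * sqrt (of_int y)" if "t \<ge> 0" for t y
      using that by (simp add: real_sqrt_mult)
    have "sqrt (of_int ((s\<^sup>2 * M) ^ ?n * (det A * (s ^ (?n - 1))\<^sup>2)))
        = of_int (s ^ (2 * ?n - 1)) * sqrt (of_int (M ^ ?n * det A))"
      unfolding eq using scale(2) by (intro sqrt_eq) simp
    then have "of_int (s ^ (2 * ?n - 1)) * qsum A 1 M
        = of_int (s ^ (2 * ?n - 1)) * (of_real (sqrt (of_int (M ^ ?n * det A))) * eR (of_nat ?n / 8))"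
      using IH qsum_scale_index[OF scale(1) scale.prems(2-4) scale(2), of j] by (simp only: of_real_mult of_real_of_int_eq mult.assoc)
    moreover have "of_int (s ^ (2 * ?n - 1)) \<noteq> (0 :: complex)" using scale(2) by simp
    ultimately show ?case by (simp only: mult_cancel_left) simp
  qed
qed

lemma posdef_det_pos:
  fixes A :: "int^'n^'n"
  assumes "even_sym A" "posdef A"
  shows "det A > 0"
proof -
  have p: "prime (3 :: int)" "odd (3 :: int)" by simp_all
  show ?thesis
    using p assms
  proof (induction A rule: even_sym_diagonalization_induct)
    case (diagonal A)
    have "A $ i $ i > 0" for i
    proof -
      have "axis i 1 \<noteq> (0 :: int^'n)" by (simp add: axis_eq_0_iff)
      then have "qf A (axis i 1) > 0" using diagonal(3) unfolding posdef_def by blast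
      then show ?thesis by (simp only: qf_axis)
    qed
    then show ?case using det_diagonal[of A] diagonal by (simp add: prod_pos)
  next
    case (shear A j v)
    have "posdef (transpose (shear_mat j v) ** A ** shear_mat j v)"
      using shear by (intro posdef_congruence[where k = 1 and Q = "shear_mat j (- v)"]) (auto simp: shear_inverse')
    then show ?case using shear by (simp add: det_congruence det_shear_square)
  next
    case (scale A j s)
    have "posdef (transpose (scale_mat j s) ** A ** scale_mat j s)"
      using scale by (intro posdef_congruence[where k = s and Q = "coscale_mat j s"]) (auto simp: scale_coscale)
    then have "det A * (s ^ (CARD('n) - 1))\<^sup>2 > 0" using scale.IH by (simp only: det_congruence det_scale)
    then show ?case by (auto simp: zero_less_mult_iff)
  qed
qed

section \<open>Evaluation without linear terms\<close>

lemma qsum_milgram_multiple: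
  fixes A B :: "int^'n^'n"
  assumes A: "even_sym A" "posdef A" and B: "even_sym B" and AB: "A ** B = mat N"
    and M: "M > 0" "N dvd M"
  shows "qsum A 1 M = of_real (sqrt (of_int (M ^ CARD('n) * det A))) * eR (of_nat CARD('n) / 8)"
proof -
  obtain m where m: "M = N * m" using M(2) by auto
  let ?B = "\<chi> i k. m * B $ i $ k"
  have "even_sym ?B" using B by (simp add: even_sym_def transpose_def vec_eq_iff)
  moreover have "(A ** ?B) $ i $ k = mat M $ i $ k" for i k
  proof -
    have "(A ** ?B) $ i $ k = m * (A ** B) $ i $ k"
      by (simp add: matrix_matrix_mult_def sum_distrib_left mult_ac)
    then show ?thesis by (simp add: AB m mat_def)
  qed
  then have "A ** ?B = mat M" by (simp add: vec_eq_iff)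
  ultimately show ?thesis using A M(1) by (intro qsum_milgram)
qed

lemma kronecker_square:
  fixes c u :: int
  assumes "c > 0" "coprime u c"
  shows "kronecker u c * kronecker u c = 1"
  using assms
proof (induction rule: prime_power_induct_int)
  case (prime_power p k m)
  have p0: "p > 0" using prime_power.hyps(1) prime_gt_0_int by blast
  have u: "\<not> p dvd u" "coprime u m"
    using prime_power by (auto dest: coprime_common_divisor[of _ _ p])
  have "kronecker_prime u p * kronecker_prime u p = 1"
    using u(1) Legendre_square[of p u] by (auto simp: kronecker_prime_def minus_one_power_iff)
  then have "kronecker_prime u p ^ k * kronecker_prime u p ^ k = 1"
    by (simp flip: power_mult_distrib)
  moreover have "kronecker u (p ^ k * m) = kronecker_prime u p ^ k * kronecker u m"
    using p0 prime_power.hyps by (simp add: kronecker_mult kronecker_prime_power)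
  moreover have "kronecker u m * kronecker u m = 1" using u(2) prime_power.IH by blast
  ultimately show ?case by (simp add: mult_ac)
qed simp

lemma kronecker_even_power:
  assumes "c > 0" "coprime u c" "even n"
  shows "kronecker u c ^ n = 1"
proof -
  obtain m where "n = 2 * m" using assms(3) by auto
  then show ?thesis using kronecker_square[OF assms(1,2)] by (simp add: power_mult power2_eq_square)
qed

lemma kronecker_power_left:
  assumes "c > 0" "odd c" "coprime u c"
  shows "kronecker (u ^ k) c = kronecker u c ^ k"
proof (induction k)
  case 0
  have "kronecker (1 * 1) c = kronecker 1 c * kronecker 1 c"
    using assms by (intro kronecker_mult_left) auto
  then show ?case using kronecker_square[of c 1] assms by simp
next
  case (Suc k)
  then show ?case using assms kronecker_mult_left[of c u "u ^ k"] by simp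
qed

lemma kronecker_minus_right:
  assumes "m \<ge> 0"
  shows "kronecker m (- c) = kronecker m c"
proof -
  have "prime_factorization (- c) = prime_factorization c"
    using prime_factorization_normalize[of c] prime_factorization_normalize[of "- c"]
    by (simp del: prime_factorization_normalize)
  then show ?thesis using assms by (simp add: kronecker_def)
qed

lemma qgauss_2_mult:
  assumes c: "c > 0" "odd c" and a: "coprime a c"
  shows "qgauss (2 * a) c = of_int (kronecker a c) * (of_real (sqrt (of_int c)) * eR (of_int (1 - c) / 8))"
  using qgauss_twist[OF c _ a, of 2] c by (simp add: mult.commute qgauss_2_odd)

text \<open>For negative \<open>a\<close> conjugate the sum for \<open>\<bar>a\<bar>\<close>: the
  real symbol stays and the sign moves into the phase.\<close>

lemma qgauss_2_mult_sgn:
  assumes c: "c > 0" "odd c" and a: "coprime a c" "a \<noteq> 0"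
  shows "qgauss (2 * a) c = of_int (kronecker \<bar>a\<bar> c) * (of_real (sqrt (of_int c)) * eR (of_int (sgn a * (1 - c)) / 8))"
proof (cases "a > 0")
  case True
  then show ?thesis using qgauss_2_mult[OF c a(1)] by simp
next
  case False
  then have "qgauss (2 * a) c = cnj (qgauss (2 * \<bar>a\<bar>) c)"
    using qgauss_minus[of "2 * \<bar>a\<bar>" c] by simp
  then show ?thesis using qgauss_2_mult[OF c, of "\<bar>a\<bar>"] False a
    by (simp add: eR_cnj minus_divide_left)
qed

lemma qgauss_2_mult_norm:
  assumes c: "c > 0" "odd c" and a: "coprime a c"
  shows "qgauss (2 * a) c * qgauss (2 * - a) c = of_int c"
proof -
  have "qgauss (2 * - a) c = cnj (qgauss (2 * a) c)" using qgauss_minus[of "2 * a" c] by simp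
  then have "qgauss (2 * a) c * qgauss (2 * - a) c
      = of_int (kronecker a c * kronecker a c) * (of_real (sqrt (of_int c) * sqrt (of_int c)) * (eR (of_int (1 - c) / 8) * inverse (eR (of_int (1 - c) / 8))))"
    unfolding qgauss_2_mult[OF c a] by (simp only: complex_cnj_mult complex_cnj_of_int complex_cnj_complex_of_real eR_cnj eR_minus of_int_mult of_real_mult mult_ac)
  also have "\<dots> = of_int c" using c kronecker_square[OF c(1) a] by simp
  finally show ?thesis .
qed

lemma odd_part_odd: "odd c \<Longrightarrow> odd_part c = c"
  by (simp add: odd_part_def not_dvd_imp_multiplicity_0)

lemma odd_part_mult_power:
  assumes "odd m" "m > 0"
  shows "odd_part (2 ^ e * m) = m"
proof -
  have "multiplicity 2 (2 ^ e * m) = multiplicity 2 (m * 2 ^ e)" by (simp add: mult.commute)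
  also have "\<dots> = e" using assms multiplicity_mult_not_dvd[of 2 m "2 ^ e"] by (simp add: multiplicity_same_power)
  finally show ?thesis by (simp add: odd_part_def)
qed

lemma sqrt_power_int: "of_real (sqrt (of_int c)) ^ n = complex_of_real (sqrt (of_int (c ^ n)))"
  by (simp add: real_sqrt_power)

text \<open>\<open>B\<close> is \<open>N\<close> times the inverse of \<open>A\<close>, and its
  evenness says that \<open>N\<close> is a multiple of the level.\<close>

locale even_lattice =
  fixes A B :: "int^'n^'n" and N :: int
  assumes A: "even_sym A" "posdef A" and B: "even_sym B" and AB: "A ** B = mat N" and N: "N > 0"
begin

abbreviation D where "D \<equiv> det A"

lemma D_pos: "D > 0"
  using A by (rule posdef_det_pos)

lemma D_dvd: "D dvd N ^ CARD('n)"
  using AB by (rule det_dvd_power)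

lemma coprime_D: "coprime N c \<Longrightarrow> coprime D c"
  using D_dvd by (meson coprime_divisors coprime_power_left_iff dvd_refl)

lemma coprime_D': "coprime c N \<Longrightarrow> coprime c D"
  using coprime_D by (simp add: coprime_commute)

lemma odd_D: "odd N \<Longrightarrow> odd D"
  using coprime_D[of 2] by simp

lemma milgram:
  assumes "M > 0" "N dvd M"
  shows "qsum A 1 M = of_real (sqrt (of_int (M ^ CARD('n))) * sqrt (of_int D)) * eR (of_nat CARD('n) / 8)"
  using qsum_milgram_multiple[OF A B AB assms] by (simp add: real_sqrt_mult)

lemma twist:
  assumes "c > 0" "odd c" "N dvd c" "coprime a c" "coprime b c"
  shows "qsum A (a * b) c = of_int (kronecker a c) ^ CARD('n) * of_int (kronecker a D) * qsum A b c"
  using N D_pos assms by (intro qsum_odd_twist[OF A(1) AB]) auto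

text \<open>Complex conjugation acts on Milgram's value like the twist by \<open>-1\<close>, which only changes the sign.\<close>

lemma even_n:
  assumes "odd N"
  shows "even CARD('n)"
proof -
  let ?\<epsilon> = "kronecker (-1) N ^ CARD('n) * kronecker (-1) D" and ?E = "eR (of_nat CARD('n) / 8)"
  define R where "R = sqrt (of_int (N ^ CARD('n))) * sqrt (of_int D)"
  have R: "R \<noteq> 0" using N D_pos by (simp add: R_def)
  have m: "qsum A 1 N = of_real R * ?E" using milgram[of N] N by (simp add: R_def)
  have "cnj (qsum A 1 N) = of_int ?\<epsilon> * qsum A 1 N"
    using twist[of N "-1" 1] qsum_minus[of A 1 N] N assms by simp
  then have "of_real R * inverse ?E = of_real R * (of_int ?\<epsilon> * ?E)"
    unfolding m by (simp add: eR_cnj eR_minus mult_ac)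
  then have *: "inverse ?E = of_int ?\<epsilon> * ?E" using R by (simp only: mult_cancel_left) simp
  then have "1 = of_int ?\<epsilon> * (?E * ?E)" by (metis eR_neq_0 left_inverse mult.assoc)
  \<comment> \<open>Squaring removes the sign and leaves \<open>e(n/2) = 1\<close>.\<close>
  then have "1 = (of_int ?\<epsilon> * (?E * ?E)) * (of_int ?\<epsilon> * (?E * ?E))" by simp
  also have "\<dots> = of_int (?\<epsilon> * ?\<epsilon>) * (?E * ?E * ?E * ?E)" by simp
  also have "?\<epsilon> * ?\<epsilon> = (kronecker (-1) N * kronecker (-1) N) ^ CARD('n) * (kronecker (-1) D * kronecker (-1) D)"
    by (simp add: power_mult_distrib)
  also have "\<dots> = 1" using kronecker_square[of N "-1"] kronecker_square[of D "-1"] N D_pos by simp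
  also have "?E * ?E * ?E * ?E = eR (of_nat CARD('n) / 2)" by (simp add: eR_add[symmetric])
  finally have "of_nat CARD('n) / 2 \<in> (\<int> :: real set)" by (simp add: eR_eq_1_iff[symmetric])
  then obtain k where "of_nat CARD('n) / 2 = (of_int k :: real)" by (rule Ints_cases)
  then have "int CARD('n) = 2 * k" by linarith
  then show ?thesis by presburger
qed

text \<open>
  Choose \<open>c\<close> congruent to \<open>a\<close> modulo \<open>2\<^sup>e\<close> and divisible by \<open>N\<close>. Then Milgram's formula evaluates
  the sums of moduli \<open>c\<close> and \<open>2\<^sup>e c\<close>, and their quotient is the sum of modulus \<open>2\<^sup>e\<close> up to a twist.
\<close>

lemma qsum_power_of_2:
  assumes "odd N" "odd a"
  shows "qsum A a (2 ^ e) = of_real (sqrt (of_int ((2 ^ e) ^ CARD('n)))) * of_int (kronecker D 2) ^ e"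
proof -
  \<comment> \<open>The exponent \<open>Suc e\<close> forces \<open>c\<close> to be odd also when
    \<open>e = 0\<close>. The multiple of \<open>2 ^ Suc e\<close> added to \<open>k\<close> makes
    \<open>c\<close> positive.\<close>
  have "coprime N (2 ^ Suc e)" using assms(1) by simp
  then obtain k0 where k0: "[N * k0 = 1] (mod 2 ^ Suc e)" using cong_solve_coprime_int by blast
  define k where "k = a * k0 + 2 ^ Suc e * (\<bar>a * k0\<bar> + 1)"
  define c where "c = N * k"
  have "2 ^ Suc e * (\<bar>a * k0\<bar> + 1) \<ge> 1 * (\<bar>a * k0\<bar> + 1)"
    by (intro mult_right_mono one_le_power) auto
  then have "k \<ge> a * k0 + 1 * (\<bar>a * k0\<bar> + 1)" unfolding k_def by (rule add_left_mono)
  moreover have "x + 1 * (\<bar>x\<bar> + 1) > 0" for x :: int by (cases "x \<ge> 0") auto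
  ultimately have "k > 0" by (rule less_le_trans[rotated])
  then have c0: "c > 0" using N by (simp add: c_def)
  have "[a * (N * k0) = c] (mod 2 ^ Suc e)"
    unfolding cong_iff_lin
    by (rule exI[of _ "N * (\<bar>a * k0\<bar> + 1)"]) (simp add: c_def k_def algebra_simps)
  then have "[c = a * (N * k0)] (mod 2 ^ Suc e)" by (rule cong_sym)
  also have "[a * (N * k0) = a * 1] (mod 2 ^ Suc e)" using k0 by (intro cong_mult) auto
  finally have ca: "[c = a] (mod 2 ^ Suc e)" by simp
  have "[c = a] (mod 2)" using ca by (rule cong_dvd_modulus) simp
  then have oc: "odd c" using assms(2) by (metis cong_dvd_iff)
  have ca': "[c = a] (mod 2 ^ e)" using ca by (rule cong_dvd_modulus) (simp add: le_imp_power_dvd)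
  have Nc: "N dvd c" by (simp add: c_def)
  let ?k = "of_int (kronecker D 2) ^ e :: complex"
  \<comment> \<open>The supplementary law exchanges \<open>(2/D)\<close> and \<open>(D/2)\<close>;
    the symbol over \<open>c\<close> disappears because its exponent is even.\<close>
  have "kronecker (2 ^ e) D = kronecker D 2 ^ e"
    using D_pos odd_D[OF assms(1)] by (simp add: kronecker_power_left kronecker_2_odd)
  moreover have "kronecker (2 ^ e) c ^ CARD('n) = 1"
    using c0 oc even_n[OF assms(1)] by (intro kronecker_even_power) auto
  then have "of_int (kronecker (2 ^ e) c) ^ CARD('n) = (1 :: complex)" by (metis of_int_1 of_int_power)
  ultimately have t: "qsum A (2 ^ e) c = ?k * qsum A 1 c"
    using twist[of c "2 ^ e" 1] c0 oc Nc by simp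
  have kk: "?k * ?k = 1"
    using kronecker_square[of 2 D] odd_D[OF assms(1)]
    by (simp add: power_mult_distrib[symmetric]) (metis of_int_1 of_int_mult power_one)
  define S where "S = of_real (sqrt (of_int (c ^ CARD('n))) * sqrt (of_int D)) * eR (of_nat CARD('n) / 8)"
  have S0: "S \<noteq> 0" using c0 D_pos by (simp add: S_def)
  have "qsum A 1 (2 ^ e * c) = of_real (sqrt (of_int ((2 ^ e * c) ^ CARD('n))) * sqrt (of_int D)) * eR (of_nat CARD('n) / 8)"
    using c0 Nc by (intro milgram) auto
  also have "\<dots> = of_real (sqrt (of_int ((2 ^ e) ^ CARD('n)))) * S"
    by (simp add: S_def power_mult_distrib real_sqrt_mult)
  finally have "of_real (sqrt (of_int ((2 ^ e) ^ CARD('n)))) * S = qsum A c (2 ^ e) * qsum A (2 ^ e) c"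
    using qsum_mult[OF A(1), of "2 ^ e" c 1] c0 oc by simp
  also have "\<dots> = (qsum A c (2 ^ e) * ?k) * S"
    using milgram[OF c0 Nc] by (simp add: t S_def)
  finally have "of_real (sqrt (of_int ((2 ^ e) ^ CARD('n)))) = qsum A c (2 ^ e) * ?k"
    using S0 by (simp only: mult_cancel_right) simp
  then have "qsum A c (2 ^ e) = of_real (sqrt (of_int ((2 ^ e) ^ CARD('n)))) * ?k"
    using kk by (simp add: mult.assoc)
  moreover have "qsum A c (2 ^ e) = qsum A a (2 ^ e)"
    using ca' by (intro qsum_cong[OF A(1)]) auto
  ultimately show ?thesis by simp
qed

text \<open>Odd \<open>c\<close> is the unit case. For even \<open>c\<close> the level multiple
  \<open>N\<close> is odd, so \<open>n\<close> is even; all symbols raised to the power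
  \<open>n\<close> become 1 and the two coprime parts of \<open>c\<close> simply combine.\<close>

lemma qsum_coprime_level:
  assumes c: "c > 0" and Nc: "coprime N c" and a: "coprime a c" "a \<noteq> 0"
  shows "qsum A a c = of_real (sqrt (of_int (c ^ CARD('n)))) * of_int (kronecker \<bar>a\<bar> c) ^ CARD('n) * of_int (kronecker D c)
    * eR (of_int (int CARD('n) * sgn a * (1 - odd_part c)) / 8)"
proof (cases "odd c")
  case True
  have "qsum A a c = of_int (kronecker D c) * qgauss (2 * a) c ^ CARD('n)"
    using A(1) c True coprime_D[OF Nc] a by (intro qsum_odd_unit) auto
  also have "qgauss (2 * a) c ^ CARD('n) = of_int (kronecker \<bar>a\<bar> c) ^ CARD('n) * (of_real (sqrt (of_int (c ^ CARD('n)))) * eR (of_int (int CARD('n) * sgn a * (1 - c)) / 8))"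
    unfolding qgauss_2_mult_sgn[OF c True a] by (simp add: power_mult_distrib sqrt_power_int[symmetric] eR_power mult.assoc del: of_int_power)
  finally show ?thesis by (simp add: odd_part_odd[OF True])
next
  case False
  have oN: "odd N" using Nc False by (metis coprime_common_divisor odd_one)
  have en: "even CARD('n)" using oN by (rule even_n)
  define e where "e = multiplicity 2 c"
  obtain m where m: "c = 2 ^ e * m" "odd m"
    using multiplicity_decompose'[of c 2] c unfolding e_def by auto
  have m0: "m > 0" using m c by (simp add: zero_less_mult_iff)
  have e0: "e > 0" using m False by (cases e) auto
  have oa: "odd a" using a(1) False by (metis coprime_common_divisor odd_one)
  have cop: "coprime (2 ^ e) m" "coprime a m" "coprime N m" using m a Nc by auto
  let ?a = "a * 2 ^ e"
  have am: "coprime ?a m" "?a \<noteq> 0" using cop a by auto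
  have "qsum A a c = qsum A (a * m) (2 ^ e) * qsum A ?a m"
    unfolding m(1) using A(1) m0 cop by (intro qsum_mult) auto
  also have "qsum A (a * m) (2 ^ e) = of_real (sqrt (of_int ((2 ^ e) ^ CARD('n)))) * of_int (kronecker D 2) ^ e"
    using oN oa m by (intro qsum_power_of_2) auto
  also have "qsum A ?a m = of_int (kronecker D m) * qgauss (2 * ?a) m ^ CARD('n)"
    using A(1) m0 m coprime_D[OF cop(3)] am by (intro qsum_odd_unit) auto
  also have "qgauss (2 * ?a) m ^ CARD('n) = of_int (kronecker \<bar>?a\<bar> m ^ CARD('n)) * (of_real (sqrt (of_int (m ^ CARD('n)))) * eR (of_int (int CARD('n) * sgn ?a * (1 - m)) / 8))"
    unfolding qgauss_2_mult_sgn[OF m0 m(2) am] by (simp add: power_mult_distrib sqrt_power_int[symmetric] eR_power mult.assoc del: of_int_power)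
  also have "kronecker \<bar>?a\<bar> m ^ CARD('n) = 1"
    using m0 am en by (intro kronecker_even_power) auto
  also have "sgn ?a = sgn a" by (simp add: sgn_mult)
  also have "of_real (sqrt (of_int ((2 ^ e) ^ CARD('n)))) * of_int (kronecker D 2) ^ e * (of_int (kronecker D m) * (of_int 1 * (of_real (sqrt (of_int (m ^ CARD('n)))) * eR (of_int (int CARD('n) * sgn a * (1 - m)) / 8))))
     = of_real (sqrt (of_int ((2 ^ e) ^ CARD('n))) * sqrt (of_int (m ^ CARD('n)))) * of_int (kronecker D 2 ^ e * kronecker D m) * eR (of_int (int CARD('n) * sgn a * (1 - m)) / 8)"
    by simp
  also have "sqrt (of_int ((2 ^ e) ^ CARD('n))) * sqrt (of_int (m ^ CARD('n))) = sqrt (of_int (c ^ CARD('n)))"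
    by (simp add: m(1) power_mult_distrib real_sqrt_mult)
  also have "kronecker D 2 ^ e * kronecker D m = kronecker D c"
    using m0 kronecker_prime_power[of 2 D 1] by (simp add: m(1) kronecker_mult kronecker_prime_power)
  also have "m = odd_part c" using m m0 by (simp add: odd_part_mult_power)
  moreover have "of_int (kronecker \<bar>a\<bar> c) ^ CARD('n) = (1 :: complex)"
    using c a en kronecker_even_power[of c "\<bar>a\<bar>" "CARD('n)"] by (metis coprime_abs_left_iff of_int_1 of_int_power)
  ultimately show ?thesis by simp
qed

text \<open>Milgram's formula at modulus \<open>a c\<close> expresses the sum through the one with \<open>a\<close> and \<open>c\<close> exchanged.\<close>

lemma qsum_level_dvd_odd:
  assumes c: "c > 0" "N dvd c" and a: "coprime a c" "a > 0" "odd a"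
  shows "qsum A a c = of_real (sqrt (of_int (c ^ CARD('n)))) * of_real (sqrt (of_int D)) * eR (of_nat CARD('n) / 8)
    * (of_int (kronecker (- c) a) ^ CARD('n) * of_int (kronecker D a) * eR (of_int (int CARD('n) * (1 - a)) / 8))"
    and "qsum A (- a) c = of_real (sqrt (of_int (c ^ CARD('n)))) * of_real (sqrt (of_int D)) * eR (- (of_nat CARD('n) / 8))
    * (of_int (kronecker c a) ^ CARD('n) * of_int (kronecker D a) * eR (of_int (int CARD('n) * (1 - a)) / 8))"
proof -
  have ca: "coprime c a" "coprime (- c) a" using a(1) by (simp_all add: coprime_commute)
  have "coprime a N" using a(1) c(2) by (meson coprime_divisors dvd_refl)
  then have Da: "coprime D a" using coprime_D' coprime_commute by blast
  let ?k = "of_int (kronecker D a) :: complex" and ?E = "eR (of_nat CARD('n) / 8)"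
  let ?g = "qgauss (2 * c) a" and ?h = "qgauss (2 * - c) a"
  define S where "S = complex_of_real (sqrt (of_int (c ^ CARD('n)))) * of_real (sqrt (of_int D))"
  have kk: "?k * ?k = 1" using kronecker_square[OF a(2) Da] by (metis of_int_1 of_int_mult)
  have gh: "?g * ?h = of_int a" using a ca(1) by (intro qgauss_2_mult_norm)
  have cnj_g: "cnj ?g = ?h" "cnj ?h = ?g" using qgauss_minus[of "2 * c" a] by simp_all
  have "qsum A 1 (a * c) = qsum A (1 * c) a * qsum A (1 * a) c"
    using A(1) a c by (intro qsum_mult)
  moreover have "qsum A (1 * c) a = ?k * ?g ^ CARD('n)"
    using qsum_odd_unit[OF A(1) a(2,3) Da ca(1)] by simp
  moreover have "qsum A 1 (a * c) = of_real (sqrt (of_int (a ^ CARD('n)))) * (S * ?E)"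
    using milgram[of "a * c"] a c by (simp add: S_def power_mult_distrib real_sqrt_mult)
  ultimately have "of_real (sqrt (of_int (a ^ CARD('n)))) * (S * ?E) = ?k * ?g ^ CARD('n) * qsum A a c" by simp
  \<comment> \<open>The factor \<open>?g ^ CARD('n)\<close> is cleared by its conjugate, as
    \<open>?g * ?h = a\<close>; the sign \<open>?k\<close> is its own inverse.\<close>
  then have "of_real (sqrt (of_int (a ^ CARD('n)))) * (S * ?E) * (?k * ?h ^ CARD('n)) = ?k * ?k * (?g * ?h) ^ CARD('n) * qsum A a c"
    by (simp add: power_mult_distrib)
  then have 1: "of_real (sqrt (of_int (a ^ CARD('n)))) * (S * ?E) * (?k * ?h ^ CARD('n)) = of_int a ^ CARD('n) * qsum A a c"
    by (simp only: kk gh mult_1_left)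
  define r where "r = complex_of_real (sqrt (of_int (a ^ CARD('n))))"
  have r0: "r * r \<noteq> 0" using a by (simp add: r_def)
  have rr: "of_int a ^ CARD('n) = r * r"
    using a by (simp add: r_def of_real_mult[symmetric] del: of_real_mult)
  have "?h ^ CARD('n) = r * (of_int (kronecker (- c) a) ^ CARD('n) * eR (of_int (int CARD('n) * (1 - a)) / 8))"
    unfolding qgauss_2_mult[OF a(2,3) ca(2)]
    by (simp add: power_mult_distrib r_def sqrt_power_int[symmetric] eR_power mult_ac del: of_int_power)
  with 1 have "(r * r) * (S * ?E * (of_int (kronecker (- c) a) ^ CARD('n) * ?k * eR (of_int (int CARD('n) * (1 - a)) / 8))) = (r * r) * qsum A a c"
    unfolding rr r_def[symmetric] by (simp add: mult_ac)
  then show "qsum A a c = of_real (sqrt (of_int (c ^ CARD('n)))) * of_real (sqrt (of_int D)) * ?E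
    * (of_int (kronecker (- c) a) ^ CARD('n) * ?k * eR (of_int (int CARD('n) * (1 - a)) / 8))"
    using r0 unfolding mult_cancel_left S_def by simp
  \<comment> \<open>Negating \<open>a\<close> conjugates the sum, so the same identity serves for
    negative arguments.\<close>
  have "cnj (of_real (sqrt (of_int (a ^ CARD('n)))) * (S * ?E) * (?k * ?h ^ CARD('n))) = cnj (of_int a ^ CARD('n) * qsum A a c)"
    by (simp only: 1)
  then have 2: "r * (S * eR (- (of_nat CARD('n) / 8))) * (?k * ?g ^ CARD('n)) = of_int a ^ CARD('n) * qsum A (- a) c"
    by (simp only: r_def S_def complex_cnj_mult complex_cnj_power complex_cnj_complex_of_real complex_cnj_of_int
        cnj_g eR_cnj qsum_minus)
  have "?g ^ CARD('n) = r * (of_int (kronecker c a) ^ CARD('n) * eR (of_int (int CARD('n) * (1 - a)) / 8))"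
    unfolding qgauss_2_mult[OF a(2,3) ca(1)]
    by (simp add: power_mult_distrib r_def sqrt_power_int[symmetric] eR_power mult_ac del: of_int_power)
  with 2 have "(r * r) * (S * eR (- (of_nat CARD('n) / 8)) * (of_int (kronecker c a) ^ CARD('n) * ?k * eR (of_int (int CARD('n) * (1 - a)) / 8))) = (r * r) * qsum A (- a) c"
    unfolding rr by (simp add: mult_ac)
  then show "qsum A (- a) c = of_real (sqrt (of_int (c ^ CARD('n)))) * of_real (sqrt (of_int D)) * eR (- (of_nat CARD('n) / 8))
    * (of_int (kronecker c a) ^ CARD('n) * ?k * eR (of_int (int CARD('n) * (1 - a)) / 8))"
    using r0 unfolding mult_cancel_left S_def by simp
qed

text \<open>Odd \<open>a\<close> is covered by reciprocity. If \<open>a\<close> is even, then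
  \<open>c\<close> and \<open>N\<close> are odd and \<open>n\<close> is even, so twisting Milgram's
  value by \<open>a\<close> leaves only \<open>(a/D)\<close>.\<close>

lemma qsum_level_dvd:
  assumes c: "c > 0" "N dvd c" and a: "coprime a c" "a \<noteq> 0"
  shows "qsum A a c = of_real (sqrt (of_int (c ^ CARD('n)))) * of_real (sqrt (of_int D)) * eR (of_nat CARD('n) / 8) * gauss_mu CARD('n) D a c"
proof (cases "odd a")
  case odd: True
  show ?thesis
  proof (cases "a > 0")
    case True
    then show ?thesis using qsum_level_dvd_odd(1)[OF c a(1) True odd] odd
      by (simp add: gauss_mu_def ee_of_real[symmetric])
  next
    case False
    define b where "b = - a"
    have b: "coprime b c" "b > 0" "odd b" "a = - b" using False a odd by (auto simp: b_def)
    \<comment> \<open>For \<open>a = - b\<close> both sides equal \<open>e(-nb/8)\<close>.\<close>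
    have "eR (of_nat CARD('n) / 8) * eR (of_int (int CARD('n) * sgn a * (1 - a)) / 8) = eR (- (of_nat CARD('n) / 8)) * eR (of_int (int CARD('n) * (1 - b)) / 8)"
    proof -
      have "of_nat CARD('n) / 8 + of_int (int CARD('n) * sgn a * (1 - a)) / 8 = - (of_nat CARD('n) / 8) + (of_int (int CARD('n) * (1 - b)) / 8 :: real)"
        using b by (simp add: algebra_simps diff_divide_distrib)
      then show ?thesis by (simp only: eR_add[symmetric])
    qed
    moreover have "ee (of_int (int CARD('n) * sgn a * (1 - a)) / 8) = eR (of_int (int CARD('n) * sgn a * (1 - a)) / 8)"
      by (simp flip: ee_of_real)
    moreover have "kronecker D a = kronecker D b" using D_pos b by (simp add: kronecker_minus_right)
    moreover have "kronecker (- sgn a * c) \<bar>a\<bar> = kronecker c b" using b by simp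
    ultimately show ?thesis using qsum_level_dvd_odd(2)[OF c b(1-3)] odd
      unfolding gauss_mu_def by (simp add: b(4)[symmetric] mult_ac)
  qed
next
  case False
  have oc: "odd c" using a(1) False by (metis coprime_common_divisor odd_one)
  have oN: "odd N" using oc c(2) by auto
  have "qsum A a c = of_int (kronecker a c ^ CARD('n)) * of_int (kronecker a D) * qsum A 1 c"
    using twist[of c a 1] c oc a by simp
  also have "kronecker a c ^ CARD('n) = 1"
    using c a even_n[OF oN] by (intro kronecker_even_power) auto
  finally show ?thesis using milgram[OF c] False by (simp add: gauss_mu_def)
qed

end

section \<open>Linear terms\<close>

text \<open>The vector \<open>h\<close> plays the role of \<open>aG(w + G\<^sup>-\<^sup>1x)\<close>, which is integral although \<open>w\<close> and \<open>x\<close> are not.\<close>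

definition qsum_lin :: "int^'n^'n \<Rightarrow> int \<Rightarrow> int \<Rightarrow> int^'n \<Rightarrow> complex" where
  "qsum_lin A a c h = (\<Sum>v\<in>cube c. eR (of_int (a * qf A v + 2 * idot v h) / of_int (2 * c)))"

lemma idot_cong: "vcong c u v \<Longrightarrow> [idot u h = idot v h] (mod c)"
  unfolding idot_def vcong_def by (intro cong_sum cong_mult) auto

lemma qsum_lin_term_cong:
  assumes "even_sym A" "c > 0" "vcong c u v"
  shows "eR (of_int (a * qf A u + 2 * idot u h) / of_int (2 * c)) = eR (of_int (a * qf A v + 2 * idot v h) / of_int (2 * c))"
proof (rule eR_cong)
  have "[2 * idot u h = 2 * idot v h] (mod (2 * c))"
    using idot_cong[OF assms(3), of h] by (simp add: cong_def mult_mod_right[symmetric])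
  moreover have "[a * qf A u = a * qf A v] (mod (2 * c))"
    using qf_vcong[OF assms(1,3)] by (intro cong_mult) auto
  ultimately show "[a * qf A u + 2 * idot u h = a * qf A v + 2 * idot v h] (mod (2 * c))"
    by (intro cong_add)
qed (use assms in simp)

text \<open>Completing the square needs \<open>a *s (A *v r)\<close> to equal \<open>h\<close> only
  modulo \<open>c\<close>: the discrepancy changes the exponents by integers.\<close>

lemma qsum_lin_complete_square:
  assumes A: "even_sym A" and c: "c > 0" and r: "vcong c (a *s (A *v r)) h"
  shows "qsum_lin A a c h = eR (- of_int (a * qf A r) / of_int (2 * c)) * qsum A a c"
proof -
  let ?t = "\<lambda>v. eR (of_int (a * qf A v) / of_int (2 * c))"
  have "eR (of_int (a * qf A v + 2 * idot v h) / of_int (2 * c)) = eR (- of_int (a * qf A r) / of_int (2 * c)) * ?t (r + v)" for v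
  proof -
    have "idot r (A *v v) = idot v (A *v r)"
      using A by (intro idot_matrix_sym) (simp add: even_sym_def)
    then have qf: "a * qf A (r + v) = a * qf A r + 2 * (a * idot v (A *v r)) + a * qf A v"
      using A by (simp add: qf_add even_sym_def algebra_simps)
    have "[idot v (a *s (A *v r)) = idot v h] (mod c)"
      using idot_cong[OF r, of v] by (simp add: idot_commute)
    then have "[2 * (a * idot v (A *v r)) = 2 * idot v h] (mod (2 * c))"
      by (simp add: idot_smult cong_def mult_mod_right[symmetric])
    then have "[a * qf A v + 2 * idot v h = a * qf A v + 2 * (a * idot v (A *v r))] (mod (2 * c))"
      by (intro cong_add cong_refl) (rule cong_sym)
    moreover have "a * qf A (r + v) - a * qf A r = a * qf A v + 2 * (a * idot v (A *v r))"
      by (simp add: qf)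
    ultimately have "[a * qf A v + 2 * idot v h = a * qf A (r + v) - a * qf A r] (mod (2 * c))"
      by (simp only:)
    then have "eR (of_int (a * qf A v + 2 * idot v h) / of_int (2 * c)) = eR (of_int (a * qf A (r + v) - a * qf A r) / of_int (2 * c))"
      using c by (intro eR_cong) auto
    also have "of_int (a * qf A (r + v) - a * qf A r) / of_int (2 * c)
       = - of_int (a * qf A r) / of_int (2 * c) + (of_int (a * qf A (r + v)) / of_int (2 * c) :: real)"
      by (simp add: diff_divide_distrib)
    finally show ?thesis by (simp only: eR_add)
  qed
  then have "qsum_lin A a c h = eR (- of_int (a * qf A r) / of_int (2 * c)) * (\<Sum>v\<in>cube c. ?t (r + v))"
    by (simp only: qsum_lin_def sum_distrib_left)
  also have "(\<Sum>v\<in>cube c. ?t (r + v)) = qsum A a c"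
    unfolding qsum_def using c qsum_term_cong[OF A c] by (rule sum_cube_shift)
  finally show ?thesis .
qed

text \<open>The vector \<open>t\<close> satisfies \<open>A *v t = c *s axis i 1\<close>, so a shift
  by \<open>t\<close> changes the quadratic part by integers only. The linear part gives the
  constant factor \<open>e((B *v h) $ i / N)\<close>, which is not 1.\<close>

lemma qsum_lin_eq_0:
  fixes A B :: "int^'n^'n"
  assumes A: "even_sym A" and B: "even_sym B" and AB: "A ** B = mat N" and N: "N > 0"
    and c: "c > 0" "N dvd c" and i: "\<not> N dvd (B *v h) $ i"
  shows "qsum_lin A a c h = 0"
proof -
  obtain m where m: "c = N * m" using c(2) by auto
  have m0: "m > 0" using c(1) N by (simp add: m zero_less_mult_iff)
  define t where "t = m *s (B *v axis i 1)"
  let ?t = "\<lambda>v. eR (of_int (a * qf A v + 2 * idot v h) / of_int (2 * c))"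
  obtain \<beta> where \<beta>: "B $ i $ i = 2 * \<beta>" using B by (auto simp: even_sym_def)
  have At: "A *v t = c *s axis i 1"
    by (simp add: t_def matrix_smult_vec matrix_vector_mul_assoc AB matrix_mat_mult_vec m vec_eq_iff)
  have qft: "qf A t = 2 * c * (m * \<beta>)"
    by (simp only: qf_def At idot_smult idot_axis) (simp add: t_def matrix_mult_axis column_def \<beta>)
  have th: "idot t h = m * (B *v h) $ i"
  proof -
    have "idot (B *v axis i 1) h = idot h (B *v axis i 1)" by (rule idot_commute)
    also have "\<dots> = idot (axis i 1) (B *v h)"
      using B by (intro idot_matrix_sym) (simp add: even_sym_def)
    finally show ?thesis by (simp add: t_def idot_smult idot_axis)
  qed
  have shift: "?t (t + v) = eR (of_int ((B *v h) $ i) / of_int N) * ?t v" for v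
  proof -
    have "idot t (A *v v) = idot v (A *v t)"
      using A by (intro idot_matrix_sym) (simp add: even_sym_def)
    then have "qf A (t + v) = 2 * c * (m * \<beta>) + 2 * (c * v $ i) + qf A v"
      using A by (simp add: qf_add even_sym_def qft At idot_smult idot_axis)
    then have "a * qf A (t + v) + 2 * idot (t + v) h
      = 2 * c * (a * m * \<beta> + a * v $ i) + 2 * (m * (B *v h) $ i) + (a * qf A v + 2 * idot v h)"
      by (simp add: idot_add th algebra_simps)
    then have "of_int (a * qf A (t + v) + 2 * idot (t + v) h) / of_int (2 * c)
      = of_int (a * m * \<beta> + a * v $ i) + (of_int ((B *v h) $ i) / of_int N + of_int (a * qf A v + 2 * idot v h) / of_int (2 * c) :: real)"
      using m0 N by (simp add: m field_simps)
    then show ?thesis by (simp only: eR_add eR_of_int mult_1_left)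
  qed
  have "qsum_lin A a c h = (\<Sum>v\<in>cube c. ?t (t + v))"
    unfolding qsum_lin_def by (rule sum_cube_shift[symmetric]) (use c qsum_lin_term_cong[OF A c(1)] in auto)
  also have "\<dots> = eR (of_int ((B *v h) $ i) / of_int N) * qsum_lin A a c h"
    by (simp only: shift qsum_lin_def sum_distrib_left)
  finally have "(1 - eR (of_int ((B *v h) $ i) / of_int N)) * qsum_lin A a c h = 0"
    by (simp add: algebra_simps)
  moreover have "eR (of_int ((B *v h) $ i) / of_int N) \<noteq> 1"
  proof
    assume "eR (of_int ((B *v h) $ i) / of_int N) = 1"
    then obtain k where "of_int ((B *v h) $ i) / of_int N = (of_int k :: real)"
      by (auto simp only: eR_eq_1_iff elim: Ints_cases)
    then have "of_int ((B *v h) $ i) = (of_int (N * k) :: real)" using N by (simp add: field_simps)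
    then have "(B *v h) $ i = N * k" by (simp only: of_int_eq_iff)
    then show False using i by simp
  qed
  ultimately show ?thesis by simp
qed

section \<open>Passage to real matrices\<close>

definition rvec :: "int^'n \<Rightarrow> real^'n" where
  "rvec v = (\<chi> i. of_int (v $ i))"

definition rmat :: "int^'n^'m \<Rightarrow> real^'n^'m" where
  "rmat A = (\<chi> i k. of_int (A $ i $ k))"

lemma rvec_nth [simp]: "rvec v $ i = of_int (v $ i)"
  by (simp add: rvec_def)

lemma rmat_nth [simp]: "rmat A $ i $ k = of_int (A $ i $ k)"
  by (simp add: rmat_def)

lemma rvec_inj: "rvec u = rvec v \<Longrightarrow> u = v"
  by (simp add: vec_eq_iff)

lemma rmat_inj: "rmat A = rmat B \<Longrightarrow> A = B"
  by (simp add: vec_eq_iff)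

lemma integral_vec_iff: "integral_vec v \<longleftrightarrow> (\<exists>u. v = rvec u)"
proof
  assume "integral_vec v"
  then have "\<forall>i. \<exists>k. v $ i = of_int k" by (auto simp: integral_vec_def elim: Ints_cases)
  then obtain k where "\<And>i. v $ i = of_int (k i)" by metis
  then have "v = rvec (\<chi> i. k i)" by (simp add: vec_eq_iff)
  then show "\<exists>u. v = rvec u" by blast
qed (auto simp: integral_vec_def)

lemma rvec_mult: "rvec (A *v v) = rmat A *v rvec v"
  by (simp add: vec_eq_iff matrix_vector_mult_def)

lemma rvec_smult: "rvec (k *s v) = of_int k *\<^sub>R rvec v"
  by (simp add: vec_eq_iff)

lemma rvec_inner: "rvec u \<bullet> rvec v = of_int (idot u v)"
  by (simp add: inner_vec_def idot_def)

lemma rvec_qf: "rvec v \<bullet> (rmat A *v rvec v) = of_int (qf A v)"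
  by (simp add: qf_def rvec_inner rvec_mult[symmetric])

lemma det_rmat: "det (rmat A) = of_int (det A)"
  by (simp add: det_def)

lemma even_integral_iff: "even_integral G \<longleftrightarrow> (\<exists>A. G = rmat A \<and> even_sym A)"
proof
  assume G: "even_integral G"
  then have "\<forall>i k. G $ i $ k \<in> \<int>" by (simp add: even_integral_def)
  then have "\<forall>i k. \<exists>m. G $ i $ k = of_int m" by (meson Ints_cases)
  then obtain m where m: "\<And>i k. G $ i $ k = of_int (m i k)" by metis
  define A where "A = (\<chi> i k. m i k)"
  have GA: "G = rmat A" by (simp add: A_def m vec_eq_iff)
  have "transpose A = A"
    using G by (intro rmat_inj) (simp add: even_integral_def GA vec_eq_iff transpose_def)
  moreover have "even (A $ i $ i)" for i
  proof -
    obtain k :: int where "of_int (A $ i $ i) = (of_int (2 * k) :: real)" using G by (auto simp: even_integral_def GA)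
    then have "A $ i $ i = 2 * k" by (simp only: of_int_eq_iff)
    then show ?thesis by simp
  qed
  ultimately show "\<exists>A. G = rmat A \<and> even_sym A" using GA by (auto simp: even_sym_def)
next
  assume "\<exists>A. G = rmat A \<and> even_sym A"
  then obtain A where A: "G = rmat A" "even_sym A" by blast
  have "\<exists>k. of_int (A $ i $ i) = (of_int (2 * k) :: real)" for i
  proof -
    obtain k where "A $ i $ i = 2 * k" using A(2) by (auto simp: even_sym_def)
    then show ?thesis by (intro exI[of _ k]) simp
  qed
  moreover have "transpose G = G"
    using even_sym_nth[OF A(2)] by (simp add: A(1) vec_eq_iff transpose_def)
  ultimately show "even_integral G" by (simp add: even_integral_def A(1))
qed

lemma matrix_inv_right:
  fixes G :: "real^'n^'n"
  assumes "invertible G"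
  shows "G ** matrix_inv G = mat 1"
  using assms unfolding invertible_def matrix_inv_def by (rule someI2_ex) simp

lemma transpose_matrix_inv:
  fixes G :: "real^'n^'n"
  assumes "invertible G" "transpose G = G"
  shows "transpose (matrix_inv G) = matrix_inv G"
proof -
  have "transpose (G ** matrix_inv G) = mat 1" using matrix_inv_right[OF assms(1)] by (simp add: transpose_mat)
  then have "transpose (matrix_inv G) ** G = mat 1" by (simp add: matrix_transpose_mul assms(2))
  then have "transpose (matrix_inv G) ** G ** matrix_inv G = matrix_inv G" by simp
  then show ?thesis by (simp add: matrix_mul_assoc[symmetric] matrix_inv_right[OF assms(1)])
qed

text \<open>By Cramer's rule the product is the determinant of an integer matrix.\<close>

lemma det_matrix_inv_integral:
  fixes A :: "int^'n^'n"
  assumes "det A \<noteq> 0"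
  shows "of_int (det A) * matrix_inv (rmat A) $ i $ k \<in> \<int>"
proof -
  let ?G = "rmat A"
  have G: "det ?G \<noteq> 0" using assms by (simp add: det_rmat)
  then have inv: "invertible ?G" by (simp add: invertible_det_nz)
  have "?G *v (matrix_inv ?G *v axis k 1) = axis k 1"
    by (simp add: matrix_vector_mul_assoc matrix_inv_right[OF inv])
  then have "matrix_inv ?G *v axis k 1 = (\<chi> l. det (\<chi> i j. if j = l then axis k 1 $ i else ?G $ i $ j) / det ?G)"
    using cramer[OF G] by blast
  then have "(matrix_inv ?G *v axis k 1) $ i = det (\<chi> r j. if j = i then axis k 1 $ r else ?G $ r $ j) / det ?G"
    by simp
  moreover have "(matrix_inv ?G *v axis k 1) $ i = matrix_inv ?G $ i $ k"
    by (simp add: matrix_vector_mult_basis column_def)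
  moreover have "(\<chi> r j. if j = i then axis k 1 $ r else ?G $ r $ j) = rmat (\<chi> r j. if j = i then axis k 1 $ r else A $ r $ j)"
    by (auto simp: vec_eq_iff axis_def)
  ultimately have "of_int (det A) * matrix_inv ?G $ i $ k = of_int (det (\<chi> r j. if j = i then axis k 1 $ r else A $ r $ j))"
    using assms by (simp add: det_rmat)
  then show ?thesis by simp
qed

text \<open>Twice the determinant is a candidate for the minimum: the determinant clears
  denominators and the 2 makes the diagonal even.\<close>

lemma level_properties:
  fixes A :: "int^'n^'n"
  assumes A: "even_sym A" and D: "det A > 0"
  shows "level (rmat A) > 0 \<and> even_integral (real (level (rmat A)) *\<^sub>R matrix_inv (rmat A))"
  unfolding level_def
proof (rule LeastI)
  let ?H = "matrix_inv (rmat A)"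
  have inv: "invertible (rmat A)" using D by (simp add: invertible_det_nz det_rmat)
  have sym: "transpose (rmat A) = rmat A"
    using even_sym_nth[OF A] by (simp add: vec_eq_iff transpose_def)
  have H: "\<exists>m. of_int (det A) * ?H $ i $ k = of_int m" for i k
    using det_matrix_inv_integral[of A i k] D by (auto elim: Ints_cases)
  have "real (nat (2 * det A)) *\<^sub>R ?H = (2 * of_int (det A)) *\<^sub>R ?H" using D by simp
  moreover have "even_integral ((2 * of_int (det A)) *\<^sub>R ?H)"
    unfolding even_integral_def
  proof (intro conjI allI)
    show "transpose ((2 * of_int (det A)) *\<^sub>R ?H) = (2 * of_int (det A)) *\<^sub>R ?H"
      using transpose_matrix_inv[OF inv sym] by (simp add: vec_eq_iff transpose_def)
    show "((2 * of_int (det A)) *\<^sub>R ?H) $ i $ k \<in> \<int>" for i k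
      using H[of i k] by (auto simp: mult.assoc)
    show "\<exists>k::int. ((2 * of_int (det A)) *\<^sub>R ?H) $ i $ i = of_int (2 * k)" for i
      using H[of i i] by (auto simp: mult.assoc)
  qed
  ultimately show "nat (2 * det A) > 0 \<and> even_integral (real (nat (2 * det A)) *\<^sub>R ?H)" using D by simp
qed

lemma inner_matrix_sym:
  fixes G :: "real^'n^'n"
  assumes "transpose G = G"
  shows "p \<bullet> (G *v q) = q \<bullet> (G *v p)"
  using assms by (metis dot_lmul_matrix inner_commute transpose_matrix_vector)

lemma inner_matrix_add:
  fixes G :: "real^'n^'n"
  assumes "transpose G = G"
  shows "(p + q) \<bullet> (G *v (p + q)) = p \<bullet> (G *v p) + 2 * (p \<bullet> (G *v q)) + q \<bullet> (G *v q)"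
  using inner_matrix_sym[OF assms, of q p]
  by (simp add: matrix_vector_right_distrib inner_add_left inner_add_right)

lemma matrix_scaleR_vec: "G *v (k *\<^sub>R v) = k *\<^sub>R (G *v v)" for G :: "real^'n^'m"
  by (simp add: vec_eq_iff matrix_vector_mult_def sum_distrib_left mult_ac)

lemma scaleR_matrix_vec: "(k *\<^sub>R G) *v v = k *\<^sub>R (G *v v)" for G :: "real^'n^'m"
  by (simp add: vec_eq_iff matrix_vector_mult_def sum_distrib_left mult_ac)

lemma sqrt_power_powr: "c > 0 \<Longrightarrow> sqrt (c ^ n) = c powr (real n / 2)" for c :: real
  by (simp add: powr_half_sqrt[symmetric] powr_realpow[symmetric] powr_powr)

lemma ii_powr: "\<i> powr (of_nat n / 2) = eR (of_nat n / 8)"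
proof -
  have "\<i> powr (of_nat n / 2) = exp (of_nat n / 2 * (of_real pi / 2 * \<i>))"
    by (simp add: powr_def mult_ac)
  also have "of_nat n / 2 * (of_real pi / 2 * \<i>) = \<i> * of_real (2 * pi * (of_nat n / 8))"
    by simp
  finally show ?thesis by (simp only: eR_def cis_conv_exp)
qed

lemma vcong_add_smult: "vcong c u (u + c *s t)"
  by (simp add: vcong_def cong_iff_lin)

text \<open>With \<open>x = G *v y\<close> the exponent is \<open>q(u + y) - q(y)\<close>, and
  \<open>u + y\<close> is \<open>v + z\<close>. Expanding \<open>q(v + z)\<close> leaves a linear
  term in \<open>v\<close> that is integral once multiplied by \<open>a\<close>.\<close>

lemma gauss_sum_eq_qsum_lin:
  fixes A :: "int^'n^'n" and w y :: "real^'n"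
  defines "G \<equiv> rmat A" and "z \<equiv> w + y"
  assumes A: "even_sym A" and c: "c > 0" and h: "of_int a *\<^sub>R (G *v z) = rvec h"
  shows "gauss_sum G a c w (G *v y)
    = eR (of_int a / (2 * of_int c) * (z \<bullet> (G *v z) - y \<bullet> (G *v y))) * qsum_lin A a c h"
proof -
  have sym: "transpose G = G"
    using even_sym_nth[OF A] by (simp add: G_def vec_eq_iff transpose_def)
  have "ee (of_real (of_int a / of_int c * (1/2 * (u \<bullet> (G *v u)) + u \<bullet> (G *v y))))
      = eR (of_int a / (2 * of_int c) * (z \<bullet> (G *v z) - y \<bullet> (G *v y))) * eR (of_int (a * qf A v + 2 * idot v h) / of_int (2 * c))"
    if u: "u = rvec v + w" for u v
  proof -
    have "of_int a * (rvec v \<bullet> (G *v z)) = rvec v \<bullet> (of_int a *\<^sub>R (G *v z))" by simp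
    also have "\<dots> = of_int (idot v h)" unfolding h by (rule rvec_inner)
    finally have lin: "of_int a * (rvec v \<bullet> (G *v z)) = of_int (idot v h)" .
    have "u \<bullet> (G *v u) + 2 * (u \<bullet> (G *v y)) + y \<bullet> (G *v y) = (u + y) \<bullet> (G *v (u + y))"
      by (simp only: inner_matrix_add[OF sym])
    also have "u + y = rvec v + z" by (simp add: u z_def)
    also have "(rvec v + z) \<bullet> (G *v (rvec v + z)) = of_int (qf A v) + 2 * (rvec v \<bullet> (G *v z)) + z \<bullet> (G *v z)"
      unfolding inner_matrix_add[OF sym] by (simp only: G_def rvec_qf)
    finally have half: "1/2 * (u \<bullet> (G *v u)) + u \<bullet> (G *v y)
        = (of_int (qf A v) + 2 * (rvec v \<bullet> (G *v z)) + (z \<bullet> (G *v z) - y \<bullet> (G *v y))) / 2" by simp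
    have "of_int a / of_int c * (1/2 * (u \<bullet> (G *v u)) + u \<bullet> (G *v y))
        = of_int a / (2 * of_int c) * (z \<bullet> (G *v z) - y \<bullet> (G *v y)) + of_int (a * qf A v + 2 * idot v h) / of_int (2 * c)"
      unfolding half using c lin[symmetric] by (simp add: field_simps)
    then show ?thesis by (simp only: ee_of_real eR_add)
  qed
  moreover have "(\<chi> i. of_int (v $ i)) = rvec v" for v :: "int^'n" by (simp add: rvec_def)
  moreover have "{v :: int^'n. \<forall>i. 0 \<le> v $ i \<and> v $ i < c} = cube c" by (simp add: vbox_def)
  ultimately show ?thesis
    unfolding gauss_sum_def qsum_lin_def sum_distrib_left Let_def by simp
qed

theorem theorem1p1:
  fixes G :: "real^'n^'n" and D :: int and N :: nat and n :: nat
    and a c :: int and w x :: "real^'n"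
  assumes n: "n = CARD('n)"
    and G: "positive_definite G" "even_integral G"
    and D: "of_int D = det G"
    and N: "N = level G"
    and c: "c > 0"
    and a: "a \<noteq> 0"
    and ac: "coprime a c"
    and w: "rational_vec w" "integral_vec (G *v w)"
    and x: "rational_vec x" "integral_vec (of_int a *\<^sub>R x)"
  shows
    "(coprime (int N) c \<longrightarrow>
       (\<forall>c'. [c * c' = 1] (mod (a * int N)) \<longrightarrow>
         gauss_sum G a c w x =
           of_real (of_int c powr (real n / 2))
           * of_int (kronecker \<bar>a\<bar> c) ^ n
           * of_int (kronecker D c)
           * ee (of_int (int n * sgn a * (1 - odd_part c)) / 8)
           * ee (of_real
               (- (of_int a / (2 * of_int c)) * (x \<bullet> (matrix_inv G *v x))
                + of_int (a * c') / 2
                  * ((w + matrix_inv G *v x) \<bullet> (G *v (w + matrix_inv G *v x)))))))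
     \<and>
     (int N dvd c \<longrightarrow>
       (\<forall>a'. [a * a' = 1] (mod (c * int N)) \<longrightarrow>
         gauss_sum G a c w x =
           (if integral_vec (of_int a *\<^sub>R (w + matrix_inv G *v x)) then 1 else 0)
           * of_real (of_int c powr (real n / 2))
           * of_real (sqrt (of_int D))
           * \<i> powr (of_nat n / 2)
           * gauss_mu n D a c
           * ee (of_real (- (of_int (a' * a\<^sup>2) * (x \<bullet> (matrix_inv G *v x))
                             / (2 * of_int c))))))"
proof -
  obtain A where GA: "G = rmat A" and A: "even_sym A" using G(2) by (auto simp: even_integral_iff)
  have pos: "posdef A"
    unfolding posdef_def
  proof (intro allI impI)
    fix v :: "int^'n" assume "v \<noteq> 0"
    then have "rvec v \<noteq> 0" by (auto simp: vec_eq_iff)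
    then have "0 < rvec v \<bullet> (G *v rvec v)" using G(1) by (simp add: positive_definite_def)
    then show "0 < qf A v" unfolding GA rvec_qf by simp
  qed
  have DA: "D = det A" using D by (simp add: GA det_rmat)
  have D0: "det A > 0" using A pos by (rule posdef_det_pos)
  define H where "H = matrix_inv G"
  have inv: "invertible G" using D0 by (simp add: GA invertible_det_nz det_rmat)
  have GH: "G ** H = mat 1" unfolding H_def using inv by (rule matrix_inv_right)
  then have HG: "H ** G = mat 1" by (simp add: matrix_left_right_inverse)
  have GHv: "G *v (H *v v) = v" and HGv: "H *v (G *v v) = v" for v
    by (simp_all add: matrix_vector_mul_assoc GH HG)
  have sym: "transpose G = G" using G(1) by (simp add: positive_definite_def)
  have N0: "N > 0" and NH: "even_integral (real N *\<^sub>R H)"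
    using level_properties[OF A D0] by (simp_all add: N H_def GA)
  obtain B where B: "real N *\<^sub>R H = rmat B" "even_sym B" using NH by (auto simp: even_integral_iff)
  have Bv: "rvec (B *v v) = real N *\<^sub>R (H *v rvec v)" for v
    by (simp only: rvec_mult B(1)[symmetric] scaleR_matrix_vec)
  have ABv: "A *v (B *v v) = int N *s v" for v
    by (rule rvec_inj) (simp only: rvec_mult[of A] Bv GA[symmetric] matrix_scaleR_vec GHv rvec_smult of_int_of_nat_eq)
  have AB: "A ** B = mat (int N)"
    by (simp add: matrix_eq matrix_vector_mul_assoc[symmetric] ABv matrix_mat_mult_vec)
  interpret L: even_lattice A B "int N"
    using A pos B(2) AB N0 by unfold_locales auto
  define y where "y = H *v x"
  define z where "z = w + y"
  have Gy: "G *v y = x" by (simp add: y_def GHv)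
  obtain g where g: "G *v w = rvec g" using w(2) by (auto simp: integral_vec_iff)
  obtain \<xi> where \<xi>: "of_int a *\<^sub>R x = rvec \<xi>" using x(2) by (auto simp: integral_vec_iff)
  \<comment> \<open>Each of \<open>G *v w\<close> and \<open>a\<close> times \<open>x\<close> is
    integral by hypothesis, so their combination is integral although \<open>z\<close> is only
    rational.\<close>
  define h where "h = a *s g + \<xi>"
  have h: "of_int a *\<^sub>R (G *v z) = rvec h"
  proof -
    have "of_int a *\<^sub>R (G *v z) = of_int a *\<^sub>R rvec g + rvec \<xi>"
      by (simp only: z_def matrix_vector_right_distrib Gy g scaleR_add_right \<xi>)
    then show ?thesis by (simp add: h_def vec_eq_iff)
  qed
  have Bh: "rvec (B *v h) = (real N * of_int a) *\<^sub>R z"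
    by (simp only: Bv h[symmetric] matrix_scaleR_vec HGv scaleR_scaleR)
  have Bg: "rvec (B *v g) = real N *\<^sub>R w"
    by (simp only: Bv g[symmetric] HGv)
  define \<zeta> where "\<zeta> = z \<bullet> (G *v z)"
  define \<eta> where "\<eta> = y \<bullet> (G *v y)"
  have \<eta>: "x \<bullet> (matrix_inv G *v x) = \<eta>"
    unfolding \<eta>_def Gy unfolding y_def H_def by (rule inner_commute)
  have \<zeta>: "(w + matrix_inv G *v x) \<bullet> (G *v (w + matrix_inv G *v x)) = \<zeta>"
    by (simp only: \<zeta>_def z_def y_def H_def)
  have sum: "gauss_sum G a c w x = eR (of_int a / (2 * of_int c) * (\<zeta> - \<eta>)) * qsum_lin A a c h"
    using gauss_sum_eq_qsum_lin[OF A c, where w = w and y = y and a = a and h = h] h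
    by (simp add: GA[symmetric] z_def[symmetric] \<zeta>_def \<eta>_def Gy)
  have sqrt_c: "sqrt (of_int (c ^ CARD('n))) = of_int c powr (real n / 2)"
    using c by (simp add: n sqrt_power_powr)
  have a0: "(of_int a :: real) \<noteq> 0" and c0: "(of_int c :: real) > 0" and N0': "real N > 0"
    using a c N0 by auto
  show ?thesis
  proof (intro conjI impI allI)
    fix c' assume Nc: "coprime (int N) c" and "[c * c' = 1] (mod (a * int N))"
    then obtain m where m: "1 = c * c' + a * int N * m" by (auto simp: cong_iff_lin)
    have m': "of_int c * of_int c' = 1 - of_int a * real N * of_int m"
    proof -
      have "real_of_int 1 = of_int (c * c' + a * int N * m)" by (simp only: m[symmetric])
      then show ?thesis by simp
    qed
    \<comment> \<open>Since \<open>A *v (B *v h) = int N *s h\<close>, this choice gives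
      \<open>a *s (A *v r) = (a * N * m) *s h\<close>, which is \<open>h\<close> modulo
      \<open>c\<close>.\<close>
    define r where "r = m *s (B *v h)"
    have "h = a *s (A *v r) + c *s (c' *s h)"
    proof -
      have "1 * h $ i = (c * c' + a * int N * m) * h $ i" for i by (simp only: m)
      then show ?thesis by (simp add: r_def matrix_smult_vec ABv vec_eq_iff algebra_simps)
    qed
    then have "vcong c (a *s (A *v r)) h" by (metis vcong_add_smult)
    then have lin: "qsum_lin A a c h = eR (- of_int (a * qf A r) / of_int (2 * c)) * qsum A a c"
      by (rule qsum_lin_complete_square[OF A c])
    \<comment> \<open>Both \<open>qf A r\<close> and \<open>\<zeta>\<close> are multiples of
      \<open>\<theta>\<close>. The halves in the exponents are absorbed by evenness of
      \<open>B\<close>, and the two phases differ by the integer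
      \<open>\<theta> * m * c'\<close>.\<close>
    obtain \<theta> where \<theta>: "qf B h = 2 * \<theta>" using qf_even[OF B(2)] by blast
    have "qf A (B *v h) = int N * qf B h"
      by (simp add: qf_def ABv idot_smult idot_commute)
    then have qr: "qf A r = m\<^sup>2 * (int N * (2 * \<theta>))" by (simp add: r_def qf_smult \<theta>)
    have "of_int (qf B h) = rvec h \<bullet> rvec (B *v h)" by (simp only: qf_def rvec_inner)
    also have "\<dots> = (of_int a)\<^sup>2 * real N * \<zeta>"
      by (simp only: h[symmetric] Bh) (simp add: \<zeta>_def inner_commute power2_eq_square)
    finally have \<zeta>\<theta>: "\<zeta> = 2 * of_int \<theta> / ((of_int a)\<^sup>2 * real N)"
      using a0 N0' by (simp add: \<theta> field_simps)
    let ?p = "of_int a / (2 * of_int c) * (\<zeta> - \<eta>) + - of_int (a * qf A r) / of_int (2 * c)"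
    let ?q = "- (of_int a / (2 * of_int c)) * \<eta> + of_int (a * c') / 2 * \<zeta>"
    have "?p - ?q = (of_int \<theta> - (of_int a * real N * of_int m)\<^sup>2 * of_int \<theta> - of_int c * of_int c' * of_int \<theta>) / (of_int a * real N * of_int c)"
      using a0 c0 N0' by (simp add: qr \<zeta>\<theta> field_simps power2_eq_square)
    also have "\<dots> = of_int \<theta> * of_int m * (1 - of_int a * real N * of_int m) / of_int c"
      using a0 c0 N0' unfolding m' by (simp add: field_simps power2_eq_square)
    also have "\<dots> = of_int (\<theta> * m * c')"
      using c0 unfolding m'[symmetric] by simp
    finally have "eR ?p = eR ?q" by (intro eR_eqI) (simp only: Ints_of_int)
    then have "gauss_sum G a c w x = eR ?q * qsum A a c"
      unfolding sum lin by (simp only: eR_add[symmetric] mult.assoc[symmetric])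
    also have "qsum A a c = of_real (of_int c powr (real n / 2)) * of_int (kronecker \<bar>a\<bar> c) ^ n * of_int (kronecker D c)
        * eR (of_int (int n * sgn a * (1 - odd_part c)) / 8)"
      unfolding L.qsum_coprime_level[OF c Nc ac a] sqrt_c by (simp only: n DA)
    finally show "gauss_sum G a c w x =
        of_real (of_int c powr (real n / 2)) * of_int (kronecker \<bar>a\<bar> c) ^ n * of_int (kronecker D c)
        * ee (of_int (int n * sgn a * (1 - odd_part c)) / 8)
        * ee (of_real (- (of_int a / (2 * of_int c)) * (x \<bullet> (matrix_inv G *v x))
            + of_int (a * c') / 2 * ((w + matrix_inv G *v x) \<bullet> (G *v (w + matrix_inv G *v x)))))"
      unfolding \<zeta> \<eta> ee_of_real by (simp add: ee_of_real[symmetric] mult_ac)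
  next
    fix a' assume Nc: "int N dvd c" and "[a * a' = 1] (mod (c * int N))"
    then obtain m where m: "1 = a * a' + c * int N * m" by (auto simp: cong_iff_lin)
    have az: "w + matrix_inv G *v x = z" by (simp only: z_def y_def H_def)
    have "gauss_sum G a c w x = (if integral_vec (of_int a *\<^sub>R z) then 1 else 0)
        * eR (- (of_int (a' * a\<^sup>2) * \<eta> / (2 * of_int c))) * qsum A a c"
    proof (cases "integral_vec (of_int a *\<^sub>R z)")
      case False
      then obtain i where i: "of_int a * z $ i \<notin> \<int>" by (auto simp: integral_vec_def)
      \<comment> \<open>Up to the factor \<open>N\<close>, the vector \<open>a z\<close> is
        \<open>B *v h\<close>, so a fractional coordinate blocks divisibility and the sum
        vanishes.\<close>
      have "\<not> int N dvd (B *v h) $ i"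
      proof
        assume "int N dvd (B *v h) $ i"
        then obtain k where "(B *v h) $ i = int N * k" by auto
        moreover have "of_int ((B *v h) $ i) = real N * of_int a * z $ i"
          using Bh by (simp add: vec_eq_iff)
        ultimately have "of_int a * z $ i = of_int k" using N0' by simp
        then show False using i by simp
      qed
      then have "qsum_lin A a c h = 0"
        using A B(2) AB N0 c Nc by (intro qsum_lin_eq_0) auto
      then show ?thesis using False by (simp add: sum)
    next
      case True
      then obtain \<rho> where \<rho>: "of_int a *\<^sub>R z = rvec \<rho>" by (auto simp: integral_vec_iff)
      have A\<rho>: "A *v \<rho> = h"
        by (rule rvec_inj) (simp only: rvec_mult GA[symmetric] \<rho>[symmetric] matrix_scaleR_vec h)
      \<comment> \<open>Here \<open>h\<close> is in the image of \<open>A\<close>, so inverting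
        \<open>a\<close> modulo \<open>c\<close> solves the congruence.\<close>
      define r where "r = a' *s \<rho>"
      have "h = a *s (A *v r) + c *s ((int N * m) *s h)"
      proof -
        have "1 * h $ i = (a * a' + c * int N * m) * h $ i" for i by (simp only: m)
        then show ?thesis by (simp add: r_def matrix_smult_vec A\<rho> vec_eq_iff algebra_simps)
      qed
      then have "vcong c (a *s (A *v r)) h" by (metis vcong_add_smult)
      then have lin: "qsum_lin A a c h = eR (- of_int (a * qf A r) / of_int (2 * c)) * qsum A a c"
        by (rule qsum_lin_complete_square[OF A c])
      have m': "of_int a * of_int a' = 1 - of_int c * real N * of_int m"
      proof -
        have "real_of_int 1 = of_int (a * a' + c * int N * m)" by (simp only: m[symmetric])
        then show ?thesis by simp
      qed
      obtain \<sigma> where \<sigma>: "qf A \<rho> = 2 * \<sigma>" using qf_even[OF A] by blast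
      \<comment> \<open>The difference \<open>\<zeta> - \<eta>\<close> consists of terms in
        \<open>w\<close> which become integral only after multiplication by \<open>N\<close>, the
        mixed one also by \<open>a\<close>. The factor \<open>N\<close> comes from inverting
        \<open>a\<close> modulo \<open>c * N\<close> and not just modulo \<open>c\<close>.\<close>
      obtain \<tau> where \<tau>: "qf B g = 2 * \<tau>" using qf_even[OF B(2)] by blast
      have "of_int (qf A \<rho>) = (of_int a *\<^sub>R z) \<bullet> (G *v (of_int a *\<^sub>R z))"
        unfolding \<rho> GA rvec_qf ..
      then have \<sigma>': "(of_int a)\<^sup>2 * \<zeta> = 2 * of_int \<sigma>"
        by (simp add: \<sigma> matrix_scaleR_vec \<zeta>_def power2_eq_square)
      have "of_int (qf B g) = rvec g \<bullet> rvec (B *v g)" by (simp only: qf_def rvec_inner)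
      then have \<tau>': "real N * (w \<bullet> (G *v w)) = 2 * of_int \<tau>"
        by (simp add: \<tau> Bg g[symmetric] inner_commute)
      have "of_int (idot (B *v g) \<xi>) = (real N *\<^sub>R w) \<bullet> (of_int a *\<^sub>R x)"
        by (simp only: rvec_inner[symmetric] Bg \<xi>)
      then have wx: "real N * of_int a * (w \<bullet> x) = of_int (idot (B *v g) \<xi>)" by simp
      have \<zeta>\<eta>: "\<zeta> = w \<bullet> (G *v w) + 2 * (w \<bullet> x) + \<eta>"
        unfolding \<zeta>_def z_def \<eta>_def inner_matrix_add[OF sym] Gy ..
      have qr: "of_int (qf A r) = (of_int a')\<^sup>2 * ((of_int a)\<^sup>2 * \<zeta>)"
        by (simp add: r_def qf_smult \<sigma> \<sigma>')
      let ?k = "of_int c * real N * of_int m"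
      let ?p = "of_int a / (2 * of_int c) * (\<zeta> - \<eta>) + - of_int (a * qf A r) / of_int (2 * c)"
      let ?q = "- (of_int (a' * a\<^sup>2) * \<eta> / (2 * of_int c))"
      have "?p - ?q = of_int a / (2 * of_int c) * (\<zeta> * (1 - (of_int a * of_int a')\<^sup>2) - \<eta> * (1 - of_int a * of_int a'))"
        using c0 by (simp add: qr field_simps power2_eq_square)
      also have "\<zeta> * (1 - (of_int a * of_int a')\<^sup>2) - \<eta> * (1 - of_int a * of_int a')
          = ?k * (of_int a * of_int a' * \<zeta> + (\<zeta> - \<eta>))"
        unfolding m' by (simp add: algebra_simps power2_eq_square)
      also have "of_int a / (2 * of_int c) * (?k * (of_int a * of_int a' * \<zeta> + (\<zeta> - \<eta>)))
          = (of_int m * real N * of_int a' * ((of_int a)\<^sup>2 * \<zeta>) + of_int m * of_int a * (real N * (w \<bullet> (G *v w)))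
             + 2 * of_int m * (real N * of_int a * (w \<bullet> x))) / 2"
        using c0 by (simp add: \<zeta>\<eta> field_simps power2_eq_square)
      also have "\<dots> = of_int (m * int N * a' * \<sigma> + m * a * \<tau> + m * idot (B *v g) \<xi>)"
        unfolding \<sigma>' \<tau>' wx by simp
      finally have "eR ?p = eR ?q" by (intro eR_eqI) (simp only: Ints_of_int)
      then have "gauss_sum G a c w x = eR ?q * qsum A a c"
        unfolding sum lin by (simp only: eR_add[symmetric] mult.assoc[symmetric])
      then show ?thesis using True by simp
    qed
    also have "qsum A a c = of_real (of_int c powr (real n / 2)) * of_real (sqrt (of_int D)) * \<i> powr (of_nat n / 2) * gauss_mu n D a c"
      unfolding L.qsum_level_dvd[OF c Nc ac a] sqrt_c by (simp only: n DA ii_powr)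
    finally show "gauss_sum G a c w x =
        (if integral_vec (of_int a *\<^sub>R (w + matrix_inv G *v x)) then 1 else 0)
        * of_real (of_int c powr (real n / 2)) * of_real (sqrt (of_int D)) * \<i> powr (of_nat n / 2) * gauss_mu n D a c
        * ee (of_real (- (of_int (a' * a\<^sup>2) * (x \<bullet> (matrix_inv G *v x)) / (2 * of_int c))))"
      unfolding az \<eta> ee_of_real by (simp only: mult_ac)
  qed
qed

end
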